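(* Let $A$ and $B$ be basic finite dimensional algebras over a perfect field $k$, let $E$ and $F$ be complete sets of primitive orthogonal idempotents of $A$ and $B$ respectively, and let $$M=\bigoplus_{(g,e)\in F\times E}{}_gm_e\,(Bg\otimes eA),\qquad N=\bigoplus_{(f,h)\in E\times F}{}_fn_h\,(Af\otimes hB)$$ be finitely generated projective $B$-$A$- and $A$-$B$-bimodules respectively, where ${}_gm_e$ and ${}_fn_h$ are non-negative integers. Let $m\geq 1$ and let $C_m$ be the cyclic group of order $m$ with generator $t$ acting by cyclic permutation on $H_0\left(A,(N\otimes_BM)^{\otimes_A m}\right)$. If $H_0\left(A,(N\otimes_BM)^{\otimes_A m}\right)^{C_m}=0$, then $H_0\left(A,(N\otimes_BM)^{\otimes_A m}\right)=0$.
   Context: Here $\otimes=\otimes_k$, and a coefficient such as ${}_gm_e\,(Bg\otimes eA)$ denotes the direct sum of ${}_gm_e$ copies of the bimodule $Bg\otimes eA$. Basic means Morita reduced (the quotient by the Jacobson radical is a product of division algebras). For an $A$-bimodule $Z$, $H_0(A,Z)=Z/\langle az-za\mid a\in A,z\in Z\rangle$. The action of $C_m=\langle t\mid t^m=1\rangle$ on $H_0(A,(N\otimes_BM)^{\otimes_A m})$ is given, for $y_i\in N$, $x_i\in M$, by $$t(y_m\otimes x_m\otimes\cdots\otimes y_2\otimes x_2\otimes y_1\otimes x_1)=y_1\otimes x_1\otimes y_m\otimes x_m\otimes\cdots\otimes y_2\otimes x_2.$$ For a $kG$-module $H$, $H^G=\{x\in H\mid sx=x\ \forall s\in G\}$ denotes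 the invariants. *)

theory Defs
  imports "HOL-Algebra.Algebra"
begin

section \<open>Algebras over a field\<close>

text \<open>A field of characteristic 0 is perfect, and one of prime characteristic \<open>p\<close> is perfect iff
  every element is a \<open>p\<close>-th power; the two cases are merged below, since at most one prime \<open>p\<close>
  satisfies \<open>p \<cdot> 1 = 0\<close>.\<close>

definition perfect_field :: "('k, 'c) ring_scheme \<Rightarrow> bool" where
  "perfect_field K \<longleftrightarrow> field K \<and>
     (\<forall>p::nat. Factorial_Ring.prime p \<longrightarrow> add_pow K p \<one>\<^bsub>K\<^esub> = \<zero>\<^bsub>K\<^esub> \<longrightarrow>
        (\<forall>x\<in>carrier K. \<exists>y\<in>carrier K. y [^]\<^bsub>K\<^esub> p = x))"

text \<open>The library's locale \<open>algebra\<close> is restricted to commutative algebras.\<close>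

locale assoc_algebra = module R M + ring M for R (structure) and M (structure) +
  assumes smult_assoc_left:
      "\<lbrakk>c \<in> carrier R; x \<in> carrier M; y \<in> carrier M\<rbrakk> \<Longrightarrow>
         (c \<odot>\<^bsub>M\<^esub> x) \<otimes>\<^bsub>M\<^esub> y = c \<odot>\<^bsub>M\<^esub> (x \<otimes>\<^bsub>M\<^esub> y)"
    and smult_assoc_right:
      "\<lbrakk>c \<in> carrier R; x \<in> carrier M; y \<in> carrier M\<rbrakk> \<Longrightarrow>
         x \<otimes>\<^bsub>M\<^esub> (c \<odot>\<^bsub>M\<^esub> y) = c \<odot>\<^bsub>M\<^esub> (x \<otimes>\<^bsub>M\<^esub> y)"

definition fin_dim_algebra :: "('k, 'c) ring_scheme \<Rightarrow> ('k, 'a, 'd) module_scheme \<Rightarrow> bool" where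
  "fin_dim_algebra K A \<longleftrightarrow> assoc_algebra K A \<and>
     (\<exists>S. finite S \<and> S \<subseteq> carrier A \<and>
        (\<forall>x\<in>carrier A. \<exists>c\<in>S \<rightarrow> carrier K. x = (\<Oplus>\<^bsub>A\<^esub>s\<in>S. c s \<odot>\<^bsub>A\<^esub> s)))"

definition left_ideal :: "'a set \<Rightarrow> ('a, 'c) ring_scheme \<Rightarrow> bool" where
  "left_ideal I A \<longleftrightarrow> additive_subgroup I A \<and> (\<forall>a\<in>carrier A. \<forall>x\<in>I. a \<otimes>\<^bsub>A\<^esub> x \<in> I)"

definition maximal_left_ideal :: "'a set \<Rightarrow> ('a, 'c) ring_scheme \<Rightarrow> bool" where
  "maximal_left_ideal I A \<longleftrightarrow> left_ideal I A \<and> I \<noteq> carrier A \<and>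
     (\<forall>L. left_ideal L A \<and> I \<subseteq> L \<longrightarrow> L = I \<or> L = carrier A)"

definition jacobson_radical :: "('a, 'c) ring_scheme \<Rightarrow> 'a set" where
  "jacobson_radical A = {x \<in> carrier A. \<forall>I. maximal_left_ideal I A \<longrightarrow> x \<in> I}"

definition division_algebra :: "('k, 'c) ring_scheme \<Rightarrow> ('k, 'a, 'd) module_scheme \<Rightarrow> bool" where
  "division_algebra K D \<longleftrightarrow> assoc_algebra K D \<and> \<one>\<^bsub>D\<^esub> \<noteq> \<zero>\<^bsub>D\<^esub> \<and> carrier D - {\<zero>\<^bsub>D\<^esub>} \<subseteq> Units D"

text \<open>The isomorphism between \<open>A/J\<close> and the product of the division algebras is one of algebras:
  a ring isomorphism \<open>h\<close> that commutes with the scalars. Taking the division algebras on the type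
  \<open>'a set\<close>, the type of the elements of \<open>A/J\<close>, is no restriction because each factor is isomorphic
  to a subset of \<open>A/J\<close>.\<close>

definition basic_algebra :: "('k, 'c) ring_scheme \<Rightarrow> ('k, 'a) module \<Rightarrow> bool" where
  "basic_algebra K A \<longleftrightarrow> assoc_algebra K A \<and>
     (\<exists>(Ds :: ('k, 'a set) module list) h.
        (\<forall>D\<in>set Ds. division_algebra K D) \<and>
        h \<in> ring_iso (A Quot jacobson_radical A) (RDirProd_list Ds) \<and>
        (\<forall>c\<in>carrier K. \<forall>x\<in>carrier A.
           h (jacobson_radical A +>\<^bsub>A\<^esub> c \<odot>\<^bsub>A\<^esub> x) =
             map2 (\<lambda>D d. c \<odot>\<^bsub>D\<^esub> d) Ds (h (jacobson_radical A +>\<^bsub>A\<^esub> x))))"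

definition idempotent_elem :: "('a, 'c) ring_scheme \<Rightarrow> 'a \<Rightarrow> bool" where
  "idempotent_elem A e \<longleftrightarrow> e \<in> carrier A \<and> e \<otimes>\<^bsub>A\<^esub> e = e"

definition orthogonal_elems :: "('a, 'c) ring_scheme \<Rightarrow> 'a \<Rightarrow> 'a \<Rightarrow> bool" where
  "orthogonal_elems A e f \<longleftrightarrow> e \<otimes>\<^bsub>A\<^esub> f = \<zero>\<^bsub>A\<^esub> \<and> f \<otimes>\<^bsub>A\<^esub> e = \<zero>\<^bsub>A\<^esub>"

definition primitive_idempotent :: "('a, 'c) ring_scheme \<Rightarrow> 'a \<Rightarrow> bool" where
  "primitive_idempotent A e \<longleftrightarrow> idempotent_elem A e \<and> e \<noteq> \<zero>\<^bsub>A\<^esub> \<and>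
     (\<forall>f f'. idempotent_elem A f \<and> idempotent_elem A f' \<and> orthogonal_elems A f f' \<and>
        e = f \<oplus>\<^bsub>A\<^esub> f' \<longrightarrow> f = \<zero>\<^bsub>A\<^esub> \<or> f' = \<zero>\<^bsub>A\<^esub>)"

definition complete_primitive_idempotents :: "('a, 'c) ring_scheme \<Rightarrow> 'a set \<Rightarrow> bool" where
  "complete_primitive_idempotents A E \<longleftrightarrow> finite E \<and>
     (\<forall>e\<in>E. primitive_idempotent A e) \<and>
     (\<forall>e\<in>E. \<forall>f\<in>E. e \<noteq> f \<longrightarrow> orthogonal_elems A e f) \<and>
     (\<Oplus>\<^bsub>A\<^esub>e\<in>E. e) = \<one>\<^bsub>A\<^esub>"


section \<open>Bimodules\<close>

text \<open>As in the library's record \<open>module\<close>, only the additive part of the underlying ring record is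
  meaningful. There is no separate scalar action: \<open>k\<close> acts on a \<open>B\<close>-\<open>A\<close>-bimodule through \<open>B\<close>, and
  on all the bimodules below that action agrees with the one through \<open>A\<close>.\<close>

record ('l, 'r, 'x) bimodule = "'x ring" +
  lact :: "'l \<Rightarrow> 'x \<Rightarrow> 'x"
  ract :: "'x \<Rightarrow> 'r \<Rightarrow> 'x"

text \<open>\<open>Ae\<close> as an \<open>A\<close>-\<open>k\<close>-bimodule, and \<open>eA\<close> as a \<open>k\<close>-\<open>A\<close>-bimodule.\<close>

definition left_proj :: "('k, 'a, 'd) module_scheme \<Rightarrow> 'a \<Rightarrow> ('a, 'k, 'a) bimodule" where
  "left_proj A e = \<lparr>carrier = {a \<otimes>\<^bsub>A\<^esub> e | a. a \<in> carrier A},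
     monoid.mult = undefined, one = undefined, ring.zero = \<zero>\<^bsub>A\<^esub>, ring.add = (\<oplus>\<^bsub>A\<^esub>),
     lact = (\<otimes>\<^bsub>A\<^esub>), ract = (\<lambda>x c. c \<odot>\<^bsub>A\<^esub> x)\<rparr>"

definition right_proj :: "('k, 'a, 'd) module_scheme \<Rightarrow> 'a \<Rightarrow> ('k, 'a, 'a) bimodule" where
  "right_proj A e = \<lparr>carrier = {e \<otimes>\<^bsub>A\<^esub> a | a. a \<in> carrier A},
     monoid.mult = undefined, one = undefined, ring.zero = \<zero>\<^bsub>A\<^esub>, ring.add = (\<oplus>\<^bsub>A\<^esub>),
     lact = (\<odot>\<^bsub>A\<^esub>), ract = (\<otimes>\<^bsub>A\<^esub>)\<rparr>"

definition bimod_sum ::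
    "'i set \<Rightarrow> ('i \<Rightarrow> ('l, 'r, 'x) bimodule) \<Rightarrow> ('l, 'r, 'i \<Rightarrow> 'x) bimodule" where
  "bimod_sum I U =
    (let G = sum_group I (\<lambda>i. add_monoid (U i)) in
     \<lparr>carrier = carrier G,
      monoid.mult = undefined, one = undefined, ring.zero = \<one>\<^bsub>G\<^esub>, ring.add = (\<otimes>\<^bsub>G\<^esub>),
      lact = (\<lambda>b x. \<lambda>i\<in>I. lact (U i) b (x i)),
      ract = (\<lambda>x a. \<lambda>i\<in>I. ract (U i) (x i) a)\<rparr>)"


section \<open>Tensor products\<close>

text \<open>The abelian group with generators \<open>S\<close> and relations \<open>Rel\<close>, the class in it of an element of
  the free abelian group on \<open>S\<close>, and the map on classes induced by a map \<open>\<phi>\<close> of generators. The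
  union in the last definition is, as in the library's \<open>rcoset_mult\<close>, over equal cosets whenever
  \<open>\<phi>\<close> respects the relations.\<close>

definition presented_group :: "'x set \<Rightarrow> ('x \<Rightarrow>\<^sub>0 int) set \<Rightarrow> ('x \<Rightarrow>\<^sub>0 int) set monoid" where
  "presented_group S Rel = free_Abelian_group S Mod generate (free_Abelian_group S) Rel"

definition presented_class ::
    "'x set \<Rightarrow> ('x \<Rightarrow>\<^sub>0 int) set \<Rightarrow> ('x \<Rightarrow>\<^sub>0 int) \<Rightarrow> ('x \<Rightarrow>\<^sub>0 int) set" where
  "presented_class S Rel u =
     generate (free_Abelian_group S) Rel #>\<^bsub>free_Abelian_group S\<^esub> u"

definition presented_map ::
    "'x set \<Rightarrow> ('x \<Rightarrow>\<^sub>0 int) set \<Rightarrow> ('x \<Rightarrow> 'x) \<Rightarrow> ('x \<Rightarrow>\<^sub>0 int) set \<Rightarrow> ('x \<Rightarrow>\<^sub>0 int) set" where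
  "presented_map S Rel \<phi> T = (\<Union>u\<in>T. presented_class S Rel (frag_extend (frag_of \<circ> \<phi>) u))"

text \<open>The tensor product of \<open>U\<close> and \<open>V\<close> over \<open>R\<close>.\<close>

definition tensor_rels ::
    "('r, 'c) ring_scheme \<Rightarrow> ('l, 'r, 'x) bimodule \<Rightarrow> ('r, 's, 'y) bimodule
      \<Rightarrow> ('x \<times> 'y \<Rightarrow>\<^sub>0 int) set" where
  "tensor_rels R U V =
     {frag_of (x \<oplus>\<^bsub>U\<^esub> x', y) - frag_of (x, y) - frag_of (x', y) | x x' y.
        x \<in> carrier U \<and> x' \<in> carrier U \<and> y \<in> carrier V} \<union>
     {frag_of (x, y \<oplus>\<^bsub>V\<^esub> y') - frag_of (x, y) - frag_of (x, y') | x y y'.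
        x \<in> carrier U \<and> y \<in> carrier V \<and> y' \<in> carrier V} \<union>
     {frag_of (ract U x r, y) - frag_of (x, lact V r y) | x r y.
        x \<in> carrier U \<and> r \<in> carrier R \<and> y \<in> carrier V}"

definition tensor ::
    "('r, 'c) ring_scheme \<Rightarrow> ('l, 'r, 'x) bimodule \<Rightarrow> ('r, 's, 'y) bimodule
      \<Rightarrow> ('l, 's, ('x \<times> 'y \<Rightarrow>\<^sub>0 int) set) bimodule" where
  "tensor R U V =
    (let gens = carrier U \<times> carrier V; rels = tensor_rels R U V; G = presented_group gens rels in
     \<lparr>carrier = carrier G,
      monoid.mult = undefined, one = undefined, ring.zero = \<one>\<^bsub>G\<^esub>, ring.add = (\<otimes>\<^bsub>G\<^esub>),
      lact = (\<lambda>b. presented_map gens rels (\<lambda>(x, y). (lact U b x, y))),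
      ract = (\<lambda>T a. presented_map gens rels (\<lambda>(x, y). (x, ract V y a)) T)\<rparr>)"

text \<open>The direct sum over \<open>(g,e) \<in> F \<times> E\<close> of \<open>c g e\<close> copies of \<open>Bg \<otimes>\<^sub>k eA\<close>.\<close>

definition proj_bimodule ::
    "('k, 'c) ring_scheme \<Rightarrow> ('k, 'b) module \<Rightarrow> ('k, 'a) module \<Rightarrow> 'b set \<Rightarrow> 'a set
      \<Rightarrow> ('b \<Rightarrow> 'a \<Rightarrow> nat)
      \<Rightarrow> ('b, 'a, ('b \<times> 'a) \<times> nat \<Rightarrow> ('b \<times> 'a \<Rightarrow>\<^sub>0 int) set) bimodule" where
  "proj_bimodule K B A F E c =
     bimod_sum (SIGMA (g, e) : F \<times> E. {..<c g e})
       (\<lambda>((g, e), i). tensor K (left_proj B g) (right_proj A e))"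

text \<open>The \<open>m\<close>-fold tensor power over \<open>A\<close> of an \<open>A\<close>-bimodule, for \<open>m \<ge> 1\<close>. The type of an iterated
  binary tensor product would depend on \<open>m\<close>, so the power is presented directly by generators
  \<open>[p\<^sub>m, \<dots>, p\<^sub>1]\<close>, standing for \<open>p\<^sub>m \<otimes> \<dots> \<otimes> p\<^sub>1\<close>, subject to additivity in each factor and
  \<open>A\<close>-balancedness between neighbouring factors.\<close>

definition power_gens :: "('a, 'a, 'p) bimodule \<Rightarrow> nat \<Rightarrow> 'p list set" where
  "power_gens P m = {ps. length ps = m \<and> set ps \<subseteq> carrier P}"

definition power_rels ::
    "('a, 'c) ring_scheme \<Rightarrow> ('a, 'a, 'p) bimodule \<Rightarrow> nat \<Rightarrow> ('p list \<Rightarrow>\<^sub>0 int) set" where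
  "power_rels A P m =
     {frag_of (ps @ [x \<oplus>\<^bsub>P\<^esub> y] @ qs) - frag_of (ps @ [x] @ qs) - frag_of (ps @ [y] @ qs) | ps qs x y.
        ps @ [x] @ qs \<in> power_gens P m \<and> y \<in> carrier P} \<union>
     {frag_of (ps @ [ract P x a, y] @ qs) - frag_of (ps @ [x, lact P a y] @ qs) | ps qs x y a.
        ps @ [x, y] @ qs \<in> power_gens P m \<and> a \<in> carrier A}"

definition tensor_power ::
    "('a, 'c) ring_scheme \<Rightarrow> ('a, 'a, 'p) bimodule \<Rightarrow> nat
      \<Rightarrow> ('a, 'a, ('p list \<Rightarrow>\<^sub>0 int) set) bimodule" where
  "tensor_power A P m =
    (let gens = power_gens P m; rels = power_rels A P m; G = presented_group gens rels in
     \<lparr>carrier = carrier G,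
      monoid.mult = undefined, one = undefined, ring.zero = \<one>\<^bsub>G\<^esub>, ring.add = (\<otimes>\<^bsub>G\<^esub>),
      lact = (\<lambda>a. presented_map gens rels (\<lambda>ps. lact P a (hd ps) # tl ps)),
      ract = (\<lambda>T a. presented_map gens rels (\<lambda>ps. butlast ps @ [ract P (last ps) a]) T)\<rparr>)"


section \<open>Degree zero Hochschild homology and the cyclic action\<close>

text \<open>The additive subgroup generated by the elements \<open>az - za\<close> is already a \<open>k\<close>-subspace. As for
  the library's \<open>A_Mod\<close>, the quotient is a \<open>monoid\<close> record, whose zero element is written \<open>\<one>\<close>.\<close>

definition commutator_subgroup :: "('a, 'c) ring_scheme \<Rightarrow> ('a, 'a, 'z) bimodule \<Rightarrow> 'z set" where
  "commutator_subgroup A Z =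
     generate (add_monoid Z)
       {lact Z a z \<ominus>\<^bsub>Z\<^esub> ract Z z a | a z. a \<in> carrier A \<and> z \<in> carrier Z}"

definition H0 :: "('a, 'c) ring_scheme \<Rightarrow> ('a, 'a, 'z) bimodule \<Rightarrow> 'z set monoid" where
  "H0 A Z = Z A_Mod commutator_subgroup A Z"

definition H0_class :: "('a, 'c) ring_scheme \<Rightarrow> ('a, 'a, 'z) bimodule \<Rightarrow> 'z \<Rightarrow> 'z set" where
  "H0_class A Z z = commutator_subgroup A Z +>\<^bsub>Z\<^esub> z"

text \<open>The generator \<open>t\<close>, sending the class of \<open>p\<^sub>m \<otimes> \<dots> \<otimes> p\<^sub>1\<close> to that of
  \<open>p\<^sub>1 \<otimes> p\<^sub>m \<otimes> \<dots> \<otimes> p\<^sub>2\<close>. Rotation is well defined on \<open>H0\<close> but not on the tensor power, so both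
  layers of cosets are opened; the union is again over equal cosets.\<close>

definition cyclic_shift ::
    "('a, 'c) ring_scheme \<Rightarrow> ('a, 'a, 'p) bimodule \<Rightarrow> nat
      \<Rightarrow> ('p list \<Rightarrow>\<^sub>0 int) set set \<Rightarrow> ('p list \<Rightarrow>\<^sub>0 int) set set" where
  "cyclic_shift A P m c =
     (\<Union>T\<in>c. \<Union>u\<in>T. H0_class A (tensor_power A P m)
        (presented_class (power_gens P m) (power_rels A P m)
           (frag_extend (frag_of \<circ> (\<lambda>ps. last ps # butlast ps)) u)))"

text \<open>The action of \<open>C\<^sub>m\<close>, realised as the integers modulo \<open>m\<close> with \<open>t\<close> the residue class of 1.\<close>

definition cyclic_action ::
    "('a, 'c) ring_scheme \<Rightarrow> ('a, 'a, 'p) bimodule \<Rightarrow> nat \<Rightarrow> int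
      \<Rightarrow> ('p list \<Rightarrow>\<^sub>0 int) set set \<Rightarrow> ('p list \<Rightarrow>\<^sub>0 int) set set" where
  "cyclic_action A P m s = cyclic_shift A P m ^^ nat s"

text \<open>The elements invariant under all of \<open>G\<close>; the library's \<open>invariants\<close> is for a single element.\<close>

definition group_invariants ::
    "('g, 'c) monoid_scheme \<Rightarrow> ('g \<Rightarrow> 'h \<Rightarrow> 'h) \<Rightarrow> 'h set \<Rightarrow> 'h set" where
  "group_invariants G \<phi> H = {x \<in> H. \<forall>s\<in>carrier G. \<phi> s x = x}"

end

theory Submission
  imports Defs
begin

text \<open>Put \<open>P = N \<otimes>\<^sub>B M\<close>. It is generated by elements \<open>a q a'\<close> with \<open>q = f q e\<close> for idempotents
  \<open>f, e\<close> that depend on an index \<open>j\<close> of \<open>q\<close>, because it is a direct sum of bimodules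
  \<open>Af \<otimes> hBg \<otimes> eA\<close>. With \<open>P\<^sup>m\<close> the tensor power over \<open>A\<close>, the group \<open>H\<^sub>0(A, P\<^sup>m)\<close> is therefore a
  direct sum over words \<open>j\<^sub>m \<dots> j\<^sub>1\<close> of tensor products of spaces \<open>hBg\<close> and \<open>e A f'\<close>, where \<open>e\<close>
  and \<open>f'\<close> belong to cyclically consecutive letters. If it is nonzero, some word has all these
  spaces nonzero. Choose a nonzero element in each space, depending only on the letters concerned:
  a word \<open>\<sigma>\<close> then gives an element \<open>z \<sigma>\<close>, and the cyclic shift sends \<open>z \<sigma>\<close> to \<open>z (rot \<sigma>)\<close>. The
  sum of the \<open>z \<sigma>\<close> over a finite set of words that is stable under rotation is invariant.

  It is nonzero because the \<open>z \<sigma>\<close> lie in different summands. This is detected by traces: bimodule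
  homomorphisms \<open>\<Phi>\<^sub>i : P \<rightarrow> Hom\<^sub>k(A, A)\<close> induce the functional \<open>p\<^sub>m \<otimes> \<dots> \<otimes> p\<^sub>1 \<mapsto> tr (\<Phi>\<^sub>m p\<^sub>m \<circ> \<dots> \<circ> \<Phi>\<^sub>1 p\<^sub>1)\<close> on
  \<open>H\<^sub>0(A, P\<^sup>m)\<close>, and linear functionals on \<open>A\<close> and \<open>B\<close> supply \<open>\<Phi>\<^sub>i\<close> for which this vanishes on all
  chosen elements but one.\<close>

section \<open>Presented abelian groups\<close>

text \<open>An orbit sum taken with multiplicity would also count a periodic word several times,
  possibly a multiple of the characteristic. The invariant is therefore a sum over a set of words,
  in which every word has coefficient one, and the functional of a single word takes the value 1 on
  its element. Since each chosen element depends only on a pair of consecutive letters, a word fixed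
  by a rotation yields an element fixed by that power of the shift, and no scalar can spoil the
  invariance.

  The decomposition into summands is not constructed, because groups given by generators and
  relations come without normal forms. Two one-sided statements replace it: the homology is trivial
  unless some word has all its spaces nonzero, which uses only the relations; and the elements of
  different words are separated, which uses only homomorphisms out of the presented groups. The
  trace suits the second purpose because tr (a V) = tr (V a) matches the commutator relation that
  defines the homology.\<close>

lemma frag_extend_frag_of_keys:
  assumes "\<And>x. x \<in> S \<Longrightarrow> f x \<in> S'" "Poly_Mapping.keys u \<subseteq> S"
  shows "Poly_Mapping.keys (frag_extend (frag_of \<circ> f) u) \<subseteq> S'"
  using assms(2)
proof (induction u rule: frag_induction)
  case (diff a b)
  then show ?case
    by (auto simp: frag_extend_diff dest!: subsetD[OF keys_diff])
qed (use assms(1) in auto)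

locale presentation =
  fixes S :: "'x set" and Rel :: "('x \<Rightarrow>\<^sub>0 int) set"
  assumes Rel_subset: "Rel \<subseteq> carrier (free_Abelian_group S)"
begin

abbreviation PG where "PG \<equiv> presented_group S Rel"
abbreviation cls where "cls \<equiv> presented_class S Rel"
abbreviation relators where "relators \<equiv> generate (free_Abelian_group S) Rel"

sublocale free: comm_group "free_Abelian_group S"
  by (rule abelian_free_Abelian_group)

lemma subgroup_relators: "subgroup relators (free_Abelian_group S)"
  by (rule free.generate_is_subgroup[OF Rel_subset])

sublocale relators: normal relators "free_Abelian_group S"
  using subgroup_relators by (rule free.subgroup_imp_normal)

sublocale PG: comm_group PG
  unfolding presented_group_def by (rule free.abelian_FactGroup[OF subgroup_relators])

lemma carrier_PG: "carrier PG = cls ` carrier (free_Abelian_group S)"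
  by (simp add: presented_group_def presented_class_def carrier_FactGroup)

lemma cls_closed [simp]: "Poly_Mapping.keys u \<subseteq> S \<Longrightarrow> cls u \<in> carrier PG"
  by (auto simp: carrier_PG)

lemma cls_add:
  "Poly_Mapping.keys u \<subseteq> S \<Longrightarrow> Poly_Mapping.keys v \<subseteq> S \<Longrightarrow> cls (u + v) = cls u \<otimes>\<^bsub>PG\<^esub> cls v"
  using hom_mult[OF relators.r_coset_hom_Mod, of u v]
  by (simp add: presented_group_def presented_class_def)

lemma cls_relator: "r \<in> relators \<Longrightarrow> cls r = \<one>\<^bsub>PG\<^esub>"
  using free.coset_join2[OF relators.mem_carrier subgroup_relators, of r]
  by (simp add: presented_class_def presented_group_def FactGroup_def)

lemma cls_zero: "cls 0 = \<one>\<^bsub>PG\<^esub>"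
  using cls_relator[OF relators.one_closed] by simp

lemma cls_uminus: "Poly_Mapping.keys u \<subseteq> S \<Longrightarrow> cls (- u) = inv\<^bsub>PG\<^esub> cls u"
  by (rule PG.inv_equality[symmetric]) (auto simp: cls_zero simp flip: cls_add)

lemma cls_diff:
  "Poly_Mapping.keys u \<subseteq> S \<Longrightarrow> Poly_Mapping.keys v \<subseteq> S \<Longrightarrow> cls (u - v) = cls u \<otimes>\<^bsub>PG\<^esub> inv\<^bsub>PG\<^esub> cls v"
  using cls_add[of u "- v"] by (simp add: cls_uminus)

lemma cls_eq_oneD:
  assumes "Poly_Mapping.keys u \<subseteq> S" "cls u = \<one>\<^bsub>PG\<^esub>" shows "u \<in> relators"
  using assms free.rcos_self[OF _ subgroup_relators, of u]
  by (simp add: presented_class_def presented_group_def FactGroup_def)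

lemma cls_generator_cong:
  assumes "frag_of x - frag_of y \<in> Rel" "x \<in> S" "y \<in> S"
  shows "cls (frag_of x) = cls (frag_of y)"
proof -
  have "cls (frag_of x - frag_of y) = \<one>\<^bsub>PG\<^esub>"
    using assms(1) by (intro cls_relator generate.incl)
  then show ?thesis
    using assms(2,3) by (simp add: cls_diff PG.inv_solve_right')
qed

lemma cls_generator_add:
  assumes "frag_of x - frag_of y - frag_of z \<in> Rel" "x \<in> S" "y \<in> S" "z \<in> S"
  shows "cls (frag_of x) = cls (frag_of y) \<otimes>\<^bsub>PG\<^esub> cls (frag_of z)"
proof -
  have "cls (frag_of x - (frag_of y + frag_of z)) = \<one>\<^bsub>PG\<^esub>"
    using assms(1) by (intro cls_relator generate.incl) (simp add: diff_diff_eq)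
  moreover have "Poly_Mapping.keys (frag_of y + frag_of z) \<subseteq> S"
    using assms by (auto dest!: subsetD[OF keys_add])
  ultimately show ?thesis
    using assms(2-) by (simp add: cls_diff PG.inv_solve_right' flip: cls_add)
qed

text \<open>The single step \<open>T \<otimes> inv T'\<close> covers inverses (take \<open>T\<close>
  to be the unit) and then products. The later induction rules for tensor products, powers and
  homology inherit this shape.\<close>

lemma PG_induct [consumes 1, case_names one generator div]:
  assumes "T \<in> carrier PG" and "P \<one>\<^bsub>PG\<^esub>" and "\<And>x. x \<in> S \<Longrightarrow> P (cls (frag_of x))"
    and "\<And>T T'. T \<in> carrier PG \<Longrightarrow> T' \<in> carrier PG \<Longrightarrow> P T \<Longrightarrow> P T' \<Longrightarrow> P (T \<otimes>\<^bsub>PG\<^esub> inv\<^bsub>PG\<^esub> T')"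
  shows "P T"
proof -
  obtain u where u: "Poly_Mapping.keys u \<subseteq> S" "T = cls u"
    using assms(1) by (auto simp: carrier_PG)
  have "P (cls u)"
    using u(1) by (rule free_Abelian_group_induct) (use assms in \<open>auto simp: cls_zero cls_diff\<close>)
  then show ?thesis using u by simp
qed

text \<open>The extension of \<open>f\<close> to the free group is determined by its values on
  \<open>S\<close>. The hypothesis on relators therefore speaks of any homomorphism \<open>h\<close>
  extending \<open>f\<close>, and callers evaluate \<open>h\<close> on a relator without naming the
  extension.\<close>

lemma universal:
  assumes G: "comm_group G" and f: "f ` S \<subseteq> carrier G"
    and rel: "\<And>h r. h \<in> hom (free_Abelian_group S) G \<Longrightarrow> (\<And>x. x \<in> S \<Longrightarrow> h (frag_of x) = f x) \<Longrightarrow>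
      r \<in> Rel \<Longrightarrow> h r = \<one>\<^bsub>G\<^esub>"
  obtains g where "g \<in> hom PG G" "\<And>x. x \<in> S \<Longrightarrow> g (cls (frag_of x)) = f x"
proof -
  interpret G: comm_group G by fact
  obtain h where h: "h \<in> hom (free_Abelian_group S) G" "\<And>x. x \<in> S \<Longrightarrow> h (frag_of x) = f x"
    using G.free_Abelian_group_universal[OF f] by blast
  interpret h: group_hom "free_Abelian_group S" G h
    by unfold_locales (rule h(1))
  have "Rel \<subseteq> kernel (free_Abelian_group S) G h"
    using Rel_subset rel[OF h] unfolding kernel_def by blast
  then have "relators \<subseteq> kernel (free_Abelian_group S) G h"
    by (rule free.generate_subgroup_incl[OF _ h.subgroup_kernel])
  then have "h r = \<one>\<^bsub>G\<^esub>" if "r \<in> relators" for r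
    using that by (auto simp: kernel_def)
  then have eq: "h x = h y" if "x \<in> carrier (free_Abelian_group S)"
      "y \<in> carrier (free_Abelian_group S)" "relators #>\<^bsub>free_Abelian_group S\<^esub> x = relators #>\<^bsub>free_Abelian_group S\<^esub> y" for x y
  proof -
    have "x - y \<in> relators"
    proof -
      have "Poly_Mapping.keys (x - y) \<subseteq> S"
        using that by (auto dest!: subsetD[OF keys_diff])
      moreover have "cls (x - y) = \<one>\<^bsub>PG\<^esub>"
        using that by (simp add: cls_diff) (simp add: presented_class_def[symmetric])
      ultimately show ?thesis by (rule cls_eq_oneD)
    qed
    then have "h (x - y) = \<one>\<^bsub>G\<^esub>" by fact
    moreover have "h x = h (x - y) \<otimes>\<^bsub>G\<^esub> h y"
      using h.hom_mult[of "x - y" y] that by (auto dest!: subsetD[OF keys_diff])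
    ultimately show ?thesis using that by simp
  qed
  obtain g where "g \<in> hom (free_Abelian_group S Mod relators) G"
    "\<And>x. x \<in> carrier (free_Abelian_group S) \<Longrightarrow> g (relators #>\<^bsub>free_Abelian_group S\<^esub> x) = h x"
    using FactGroup_universal[OF h(1) relators.normal_axioms] eq by metis
  then show thesis
    by (intro that[of g]) (auto simp: presented_group_def presented_class_def h)
qed

text \<open>The linear extension of \<open>\<phi>\<close>, followed by \<open>cls\<close>, kills
  \<open>Rel\<close> and hence is constant on each class. This is what makes the union in
  \<open>presented_map\<close> a union of equal cosets.\<close>

lemma presented_map_cls:
  assumes \<phi>: "\<And>x. x \<in> S \<Longrightarrow> \<phi> x \<in> S"
    and rel: "\<And>r. r \<in> Rel \<Longrightarrow> cls (frag_extend (frag_of \<circ> \<phi>) r) = \<one>\<^bsub>PG\<^esub>"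
  shows "Poly_Mapping.keys u \<subseteq> S \<Longrightarrow>
      presented_map S Rel \<phi> (cls u) = cls (frag_extend (frag_of \<circ> \<phi>) u)"
    and "presented_map S Rel \<phi> \<in> hom PG PG"
proof -
  let ?e = "frag_extend (frag_of \<circ> \<phi>)"
  note ekeys = frag_extend_frag_of_keys[of S \<phi> S, OF \<phi>]
  have hom: "(\<lambda>u. cls (?e u)) \<in> hom (free_Abelian_group S) PG"
    by (rule homI) (auto simp: ekeys frag_extend_add cls_add)
  interpret h: group_hom "free_Abelian_group S" PG "\<lambda>u. cls (?e u)"
    by unfold_locales (rule hom)
  have "Rel \<subseteq> kernel (free_Abelian_group S) PG (\<lambda>u. cls (?e u))"
    using Rel_subset rel unfolding kernel_def by blast
  then have "relators \<subseteq> kernel (free_Abelian_group S) PG (\<lambda>u. cls (?e u))"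
    by (rule free.generate_subgroup_incl[OF _ h.subgroup_kernel])
  then have ker: "cls (?e r) = \<one>\<^bsub>PG\<^esub>" if "r \<in> relators" for r
    using that by (auto simp: kernel_def)
  show cls: "presented_map S Rel \<phi> (cls u) = cls (?e u)" if u: "Poly_Mapping.keys u \<subseteq> S" for u
  proof -
    have "cls (?e v) = cls (?e u)" if v: "v \<in> cls u" for v
    proof -
      obtain r where r: "r \<in> relators" "v = r + u"
        using v by (auto simp: presented_class_def r_coset_def)
      have "Poly_Mapping.keys r \<subseteq> S"
        using relators.mem_carrier[OF r(1)] by simp
      then show ?thesis
        using ekeys[of r] ekeys[of u] u r by (simp add: frag_extend_add cls_add ker)
    qed
    \<comment> \<open>A union over a constant family is the common value only if the index set is
      nonempty.\<close>
    moreover have "u \<in> cls u"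
      using free.rcos_self[OF _ subgroup_relators, of u] u by (simp add: presented_class_def)
    ultimately have "(\<Union>v\<in>cls u. cls (?e v)) = cls (?e u)"
      by blast
    then show ?thesis
      unfolding presented_map_def .
  qed
  show "presented_map S Rel \<phi> \<in> hom PG PG"
  proof (rule homI)
    fix x y assume "x \<in> carrier PG" "y \<in> carrier PG"
    then obtain u v where u: "Poly_Mapping.keys u \<subseteq> S" "x = cls u"
      and v: "Poly_Mapping.keys v \<subseteq> S" "y = cls v"
      by (auto simp: carrier_PG)
    show "presented_map S Rel \<phi> x \<in> carrier PG"
      using cls[OF u(1)] cls_closed[OF ekeys[OF _ u(1)]] u(2) by simp
    have "Poly_Mapping.keys (u + v) \<subseteq> S"
      using u v by (auto dest!: subsetD[OF keys_add])
    then have "presented_map S Rel \<phi> (cls (u + v)) = cls (?e u + ?e v)"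
      by (simp only: cls frag_extend_add)
    then show "presented_map S Rel \<phi> (x \<otimes>\<^bsub>PG\<^esub> y) = presented_map S Rel \<phi> x \<otimes>\<^bsub>PG\<^esub> presented_map S Rel \<phi> y"
      using u v by (simp only: cls_add cls ekeys)
  qed
qed

end

section \<open>Bimodules and their tensor products\<close>

text \<open>A bimodule record built below has an additive monoid that agrees with a known group in
  carrier, operation and unit. This lemma transports the group structure to it.\<close>

lemma comm_group_cong:
  assumes "comm_group G" "carrier H = carrier G" "monoid.mult H = monoid.mult G" "\<one>\<^bsub>H\<^esub> = \<one>\<^bsub>G\<^esub>"
  shows "comm_group H"
proof -
  interpret G: comm_group G by fact
  show ?thesis
    using G.l_inv_ex by (intro comm_groupI) (auto simp: assms G.m_ac)
qed

lemma (in abelian_group_hom) hom_minus [simp]: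
  "x \<in> carrier G \<Longrightarrow> y \<in> carrier G \<Longrightarrow> h (x \<ominus>\<^bsub>G\<^esub> y) = h x \<ominus>\<^bsub>H\<^esub> h y"
  by (simp add: a_minus_def)

lemma abelian_group_hom_of_hom:
  assumes "abelian_group G" "abelian_group H" "h \<in> hom (add_monoid G) (add_monoid H)"
  shows "abelian_group_hom G H h"
proof (rule abelian_group_homI[OF assms(1,2)])
  interpret G: abelian_group G by fact
  interpret H: abelian_group H by fact
  show "group_hom (add_monoid G) (add_monoid H) h"
    by (simp add: group_hom_def group_hom_axioms_def assms(3) G.a_group H.a_group)
qed

lemma abelian_group_hom_of_additive:
  assumes "abelian_group G" "abelian_group H" "\<And>x. x \<in> carrier G \<Longrightarrow> h x \<in> carrier H"
    "\<And>x y. x \<in> carrier G \<Longrightarrow> y \<in> carrier G \<Longrightarrow> h (x \<oplus>\<^bsub>G\<^esub> y) = h x \<oplus>\<^bsub>H\<^esub> h y"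
  shows "abelian_group_hom G H h"
  using assms by (intro abelian_group_hom_of_hom) (auto intro: homI)

locale bimod = L: ring L + R: ring R + U: abelian_group U
  for L :: "('l, 'c) ring_scheme" and R :: "('r, 'd) ring_scheme" and U :: "('l, 'r, 'x) bimodule" +
  assumes lact_closed [simp]: "b \<in> carrier L \<Longrightarrow> x \<in> carrier U \<Longrightarrow> lact U b x \<in> carrier U"
    and ract_closed [simp]: "x \<in> carrier U \<Longrightarrow> a \<in> carrier R \<Longrightarrow> ract U x a \<in> carrier U"
    and lact_add: "b \<in> carrier L \<Longrightarrow> x \<in> carrier U \<Longrightarrow> y \<in> carrier U \<Longrightarrow>
      lact U b (x \<oplus>\<^bsub>U\<^esub> y) = lact U b x \<oplus>\<^bsub>U\<^esub> lact U b y"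
    and ract_add: "x \<in> carrier U \<Longrightarrow> y \<in> carrier U \<Longrightarrow> a \<in> carrier R \<Longrightarrow>
      ract U (x \<oplus>\<^bsub>U\<^esub> y) a = ract U x a \<oplus>\<^bsub>U\<^esub> ract U y a"
    and add_lact: "b \<in> carrier L \<Longrightarrow> b' \<in> carrier L \<Longrightarrow> x \<in> carrier U \<Longrightarrow>
      lact U (b \<oplus>\<^bsub>L\<^esub> b') x = lact U b x \<oplus>\<^bsub>U\<^esub> lact U b' x"
    and add_ract: "x \<in> carrier U \<Longrightarrow> a \<in> carrier R \<Longrightarrow> a' \<in> carrier R \<Longrightarrow>
      ract U x (a \<oplus>\<^bsub>R\<^esub> a') = ract U x a \<oplus>\<^bsub>U\<^esub> ract U x a'"
    and lact_mult: "b \<in> carrier L \<Longrightarrow> b' \<in> carrier L \<Longrightarrow> x \<in> carrier U \<Longrightarrow>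
      lact U (b \<otimes>\<^bsub>L\<^esub> b') x = lact U b (lact U b' x)"
    and ract_mult: "x \<in> carrier U \<Longrightarrow> a \<in> carrier R \<Longrightarrow> a' \<in> carrier R \<Longrightarrow>
      ract U x (a \<otimes>\<^bsub>R\<^esub> a') = ract U (ract U x a) a'"
    and lact_ract: "b \<in> carrier L \<Longrightarrow> x \<in> carrier U \<Longrightarrow> a \<in> carrier R \<Longrightarrow>
      lact U b (ract U x a) = ract U (lact U b x) a"
begin

lemma lact_hom: "b \<in> carrier L \<Longrightarrow> abelian_group_hom U U (lact U b)"
  by (rule abelian_group_hom_of_additive) (auto simp: lact_add U.abelian_group_axioms)

lemma ract_hom: "a \<in> carrier R \<Longrightarrow> abelian_group_hom U U (\<lambda>x. ract U x a)"
  by (rule abelian_group_hom_of_additive) (auto simp: ract_add U.abelian_group_axioms)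

lemma lact_scalar_hom: "x \<in> carrier U \<Longrightarrow> abelian_group_hom L U (\<lambda>b. lact U b x)"
  by (rule abelian_group_hom_of_additive)
    (auto simp: add_lact U.abelian_group_axioms L.abelian_group_axioms)

lemma ract_scalar_hom: "x \<in> carrier U \<Longrightarrow> abelian_group_hom R U (ract U x)"
  by (rule abelian_group_hom_of_additive)
    (auto simp: add_ract U.abelian_group_axioms R.abelian_group_axioms)

lemmas lact_zero [simp] = abelian_group_hom.hom_zero[OF lact_hom]
lemmas ract_zero [simp] = abelian_group_hom.hom_zero[OF ract_hom]
lemmas zero_lact [simp] = abelian_group_hom.hom_zero[OF lact_scalar_hom]
lemmas zero_ract [simp] = abelian_group_hom.hom_zero[OF ract_scalar_hom]
lemmas lact_minus = abelian_group_hom.hom_minus[OF lact_hom]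
lemmas ract_minus = abelian_group_hom.hom_minus[OF ract_hom]

end

definition tens ::
  "('r, 'c) ring_scheme \<Rightarrow> ('l, 'r, 'x) bimodule \<Rightarrow> ('r, 's, 'y) bimodule \<Rightarrow> 'x \<Rightarrow> 'y
    \<Rightarrow> ('x \<times> 'y \<Rightarrow>\<^sub>0 int) set" where
  "tens R U V x y = presented_class (carrier U \<times> carrier V) (tensor_rels R U V) (frag_of (x, y))"

locale tensor_pair = U: bimod L R U + V: bimod R Q V
  for L :: "('l, 'c) ring_scheme" and R :: "('r, 'd) ring_scheme" and Q :: "('s, 'e) ring_scheme"
    and U :: "('l, 'r, 'x) bimodule" and V :: "('r, 's, 'y) bimodule"
begin

abbreviation W where "W \<equiv> tensor R U V"

sublocale presentation "carrier U \<times> carrier V" "tensor_rels R U V"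
  by unfold_locales (auto simp: tensor_rels_def dest!: subsetD[OF keys_diff])

lemma tensor_simps: "carrier W = carrier PG" "\<zero>\<^bsub>W\<^esub> = \<one>\<^bsub>PG\<^esub>" "T \<oplus>\<^bsub>W\<^esub> T' = T \<otimes>\<^bsub>PG\<^esub> T'"
    "T \<ominus>\<^bsub>W\<^esub> T' = T \<otimes>\<^bsub>PG\<^esub> inv\<^bsub>PG\<^esub> T'"
  unfolding a_minus_def a_inv_def m_inv_def by (simp_all add: tensor_def Let_def)

lemma hom_tensor: "hom (add_monoid W) G = hom PG G" "hom G (add_monoid W) = hom G PG"
  by (simp_all add: hom_def tensor_simps)

sublocale W: abelian_group W
  by (rule comm_group_abelian_groupI, rule comm_group_cong[OF PG.comm_group_axioms])
    (simp_all add: tensor_simps fun_eq_iff)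

lemma tens_closed [simp]: "x \<in> carrier U \<Longrightarrow> y \<in> carrier V \<Longrightarrow> tens R U V x y \<in> carrier W"
  by (simp add: tensor_simps tens_def)

lemma tens_add_left: "x \<in> carrier U \<Longrightarrow> x' \<in> carrier U \<Longrightarrow> y \<in> carrier V \<Longrightarrow>
    tens R U V (x \<oplus>\<^bsub>U\<^esub> x') y = tens R U V x y \<oplus>\<^bsub>W\<^esub> tens R U V x' y"
  unfolding tens_def tensor_simps by (rule cls_generator_add) (auto simp: tensor_rels_def)

lemma tens_add_right: "x \<in> carrier U \<Longrightarrow> y \<in> carrier V \<Longrightarrow> y' \<in> carrier V \<Longrightarrow>
    tens R U V x (y \<oplus>\<^bsub>V\<^esub> y') = tens R U V x y \<oplus>\<^bsub>W\<^esub> tens R U V x y'"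
  unfolding tens_def tensor_simps by (rule cls_generator_add) (auto simp: tensor_rels_def)

lemma tens_balanced: "x \<in> carrier U \<Longrightarrow> r \<in> carrier R \<Longrightarrow> y \<in> carrier V \<Longrightarrow>
    tens R U V (ract U x r) y = tens R U V x (lact V r y)"
  unfolding tens_def tensor_simps by (rule cls_generator_cong) (auto simp: tensor_rels_def)

lemma tens_left_hom: "y \<in> carrier V \<Longrightarrow> abelian_group_hom U W (\<lambda>x. tens R U V x y)"
  by (rule abelian_group_hom_of_additive)
    (auto simp: tens_add_left U.U.abelian_group_axioms W.abelian_group_axioms)

lemma tens_right_hom: "x \<in> carrier U \<Longrightarrow> abelian_group_hom V W (tens R U V x)"
  by (rule abelian_group_hom_of_additive)
    (auto simp: tens_add_right V.U.abelian_group_axioms W.abelian_group_axioms)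

lemmas tens_zero_left [simp] = abelian_group_hom.hom_zero[OF tens_left_hom]
lemmas tens_zero_right [simp] = abelian_group_hom.hom_zero[OF tens_right_hom]

lemma tensor_induct [consumes 1, case_names zero tens minus]:
  assumes "T \<in> carrier W" "P \<zero>\<^bsub>W\<^esub>"
    "\<And>x y. x \<in> carrier U \<Longrightarrow> y \<in> carrier V \<Longrightarrow> P (tens R U V x y)"
    "\<And>T T'. T \<in> carrier W \<Longrightarrow> T' \<in> carrier W \<Longrightarrow> P T \<Longrightarrow> P T' \<Longrightarrow> P (T \<ominus>\<^bsub>W\<^esub> T')"
  shows "P T"
  using assms unfolding tensor_simps
  by (induction T rule: PG_induct) (auto simp: tens_def)

lemma tensor_universal:
  assumes Z: "abelian_group Z"
    and f: "\<And>x y. x \<in> carrier U \<Longrightarrow> y \<in> carrier V \<Longrightarrow> f x y \<in> carrier Z"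
    and add_left: "\<And>x x' y. x \<in> carrier U \<Longrightarrow> x' \<in> carrier U \<Longrightarrow> y \<in> carrier V \<Longrightarrow>
      f (x \<oplus>\<^bsub>U\<^esub> x') y = f x y \<oplus>\<^bsub>Z\<^esub> f x' y"
    and add_right: "\<And>x y y'. x \<in> carrier U \<Longrightarrow> y \<in> carrier V \<Longrightarrow> y' \<in> carrier V \<Longrightarrow>
      f x (y \<oplus>\<^bsub>V\<^esub> y') = f x y \<oplus>\<^bsub>Z\<^esub> f x y'"
    and balanced: "\<And>x r y. x \<in> carrier U \<Longrightarrow> r \<in> carrier R \<Longrightarrow> y \<in> carrier V \<Longrightarrow>
      f (ract U x r) y = f x (lact V r y)"
  obtains h where "abelian_group_hom W Z h"
    "\<And>x y. x \<in> carrier U \<Longrightarrow> y \<in> carrier V \<Longrightarrow> h (tens R U V x y) = f x y"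
proof -
  interpret Z: abelian_group Z by fact
  obtain g where g: "g \<in> hom PG (add_monoid Z)"
    "\<And>z. z \<in> carrier U \<times> carrier V \<Longrightarrow> g (cls (frag_of z)) = (case z of (x, y) \<Rightarrow> f x y)"
  proof (rule universal[OF Z.a_comm_group, of "\<lambda>(x, y). f x y"])
    fix h r
    assume h: "h \<in> hom (free_Abelian_group (carrier U \<times> carrier V)) (add_monoid Z)"
      and hf: "\<And>z. z \<in> carrier U \<times> carrier V \<Longrightarrow> h (frag_of z) = (case z of (x, y) \<Rightarrow> f x y)"
      and r: "r \<in> tensor_rels R U V"
    interpret h: group_hom "free_Abelian_group (carrier U \<times> carrier V)" "add_monoid Z" h
      by unfold_locales (rule h)
    have diff: "h (u - v) = h u \<ominus>\<^bsub>Z\<^esub> h v"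
      if "Poly_Mapping.keys u \<subseteq> carrier U \<times> carrier V" "Poly_Mapping.keys v \<subseteq> carrier U \<times> carrier V" for u v
      using h.hom_mult[of u "- v"] h.hom_inv[of v] that by (simp add: a_minus_def a_inv_def)
    have keys_minus: "Poly_Mapping.keys (u - v) \<subseteq> carrier U \<times> carrier V"
      if "Poly_Mapping.keys u \<subseteq> carrier U \<times> carrier V" "Poly_Mapping.keys v \<subseteq> carrier U \<times> carrier V" for u v :: "'x \<times> 'y \<Rightarrow>\<^sub>0 int"
      using that by (auto dest!: subsetD[OF keys_diff])
    have cancel: "(a \<oplus>\<^bsub>Z\<^esub> b) \<ominus>\<^bsub>Z\<^esub> a \<ominus>\<^bsub>Z\<^esub> b = \<zero>\<^bsub>Z\<^esub>" if "a \<in> carrier Z" "b \<in> carrier Z" for a b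
    proof -
      have "(a \<oplus>\<^bsub>Z\<^esub> b) \<ominus>\<^bsub>Z\<^esub> a = b"
        using that by (simp add: a_minus_def Z.a_comm[of a b] Z.a_assoc Z.r_neg)
      then show ?thesis
        using that by (simp add: a_minus_def Z.r_neg)
    qed
    from r show "h r = \<one>\<^bsub>add_monoid Z\<^esub>"
      unfolding tensor_rels_def
      by (elim UnE CollectE exE conjE)
        (simp_all add: diff keys_minus hf f add_left add_right balanced cancel Z.r_neg a_minus_def[of Z "f _ _" "f _ _"])
  qed (use f in \<open>auto simp: image_subset_iff\<close>)
  show thesis
    by (rule that[of g]) (use g in \<open>auto intro!: abelian_group_hom_of_hom W.abelian_group_axioms Z
      simp: hom_tensor tens_def\<close>)
qed

text \<open>Maps that are additive and commute with the inner action carry each relator to a relator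
  of the same kind. The two outer actions are the cases in which \<open>q\<close> or
  \<open>p\<close> is the identity.\<close>

lemma presented_map_tensor:
  assumes p: "\<And>x. x \<in> carrier U \<Longrightarrow> p x \<in> carrier U" and q: "\<And>y. y \<in> carrier V \<Longrightarrow> q y \<in> carrier V"
    and p_add: "\<And>x x'. x \<in> carrier U \<Longrightarrow> x' \<in> carrier U \<Longrightarrow> p (x \<oplus>\<^bsub>U\<^esub> x') = p x \<oplus>\<^bsub>U\<^esub> p x'"
    and q_add: "\<And>y y'. y \<in> carrier V \<Longrightarrow> y' \<in> carrier V \<Longrightarrow> q (y \<oplus>\<^bsub>V\<^esub> y') = q y \<oplus>\<^bsub>V\<^esub> q y'"
    and p_ract: "\<And>x r. x \<in> carrier U \<Longrightarrow> r \<in> carrier R \<Longrightarrow> p (ract U x r) = ract U (p x) r"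
    and q_lact: "\<And>y r. y \<in> carrier V \<Longrightarrow> r \<in> carrier R \<Longrightarrow> q (lact V r y) = lact V r (q y)"
  defines "\<psi> \<equiv> presented_map (carrier U \<times> carrier V) (tensor_rels R U V) (\<lambda>(x, y). (p x, q y))"
  shows "abelian_group_hom W W \<psi>"
    and "x \<in> carrier U \<Longrightarrow> y \<in> carrier V \<Longrightarrow> \<psi> (tens R U V x y) = tens R U V (p x) (q y)"
proof -
  have "cls (frag_extend (frag_of \<circ> (\<lambda>(x, y). (p x, q y))) r) = \<one>\<^bsub>PG\<^esub>" if "r \<in> tensor_rels R U V" for r
  proof (rule cls_relator, rule generate.incl)
    show "frag_extend (frag_of \<circ> (\<lambda>(x, y). (p x, q y))) r \<in> tensor_rels R U V"
      using that unfolding tensor_rels_def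
    proof (elim UnE CollectE exE conjE, goal_cases)
      case (1 x x' y)
      then show ?case
        by (intro UnI1 CollectI exI[of _ "p x"] exI[of _ "p x'"] exI[of _ "q y"])
          (simp add: frag_extend_diff p q p_add)
    next
      case (2 x y y')
      show ?case
        by (rule UnI1[OF UnI2], intro CollectI exI[of _ "p x"] exI[of _ "q y"] exI[of _ "q y'"])
          (use 2 in \<open>simp add: frag_extend_diff p q q_add\<close>)
    next
      case (3 x r y)
      then show ?case
        by (intro UnI2 CollectI exI[of _ "p x"] exI[of _ r] exI[of _ "q y"])
          (simp add: frag_extend_diff p q p_ract q_lact)
    qed
  qed
  note m = presented_map_cls[of "\<lambda>(x, y). (p x, q y)", OF _ this]
  show "abelian_group_hom W W \<psi>"
    by (rule abelian_group_hom_of_hom[OF W.abelian_group_axioms W.abelian_group_axioms])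
      (use m(2) p q in \<open>auto simp: hom_tensor \<psi>_def\<close>)
  show "\<psi> (tens R U V x y) = tens R U V (p x) (q y)" if "x \<in> carrier U" "y \<in> carrier V"
    using that m(1)[of "frag_of (x, y)"] p q by (auto simp: \<psi>_def tens_def)
qed

lemma lact_tensor:
  assumes "b \<in> carrier L"
  shows "abelian_group_hom W W (lact W b)"
    and "x \<in> carrier U \<Longrightarrow> y \<in> carrier V \<Longrightarrow> lact W b (tens R U V x y) = tens R U V (lact U b x) y"
proof -
  have eq: "lact W b = presented_map (carrier U \<times> carrier V) (tensor_rels R U V) (\<lambda>(x, y). (lact U b x, y))"
    by (simp add: tensor_def Let_def)
  show "abelian_group_hom W W (lact W b)"
    "x \<in> carrier U \<Longrightarrow> y \<in> carrier V \<Longrightarrow> lact W b (tens R U V x y) = tens R U V (lact U b x) y"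
    using presented_map_tensor[of "lact U b" "\<lambda>y. y"] assms unfolding eq
    by (simp_all add: U.lact_add U.lact_ract)
qed

lemma ract_tensor:
  assumes "a \<in> carrier Q"
  shows "abelian_group_hom W W (\<lambda>t. ract W t a)"
    and "x \<in> carrier U \<Longrightarrow> y \<in> carrier V \<Longrightarrow> ract W (tens R U V x y) a = tens R U V x (ract V y a)"
proof -
  have eq: "ract W t a = presented_map (carrier U \<times> carrier V) (tensor_rels R U V) (\<lambda>(x, y). (x, ract V y a)) t" for t
    by (simp add: tensor_def Let_def)
  show "abelian_group_hom W W (\<lambda>t. ract W t a)"
    "x \<in> carrier U \<Longrightarrow> y \<in> carrier V \<Longrightarrow> ract W (tens R U V x y) a = tens R U V x (ract V y a)"
    using presented_map_tensor[of "\<lambda>x. x" "\<lambda>y. ract V y a"] assms unfolding eq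
    by (simp_all add: V.ract_add V.lact_ract)
qed

sublocale tensor: bimod L Q W
proof unfold_locales
  note [simp] = lact_tensor(2) ract_tensor(2)
    abelian_group_hom.hom_minus[OF lact_tensor(1)] abelian_group_hom.hom_minus[OF ract_tensor(1)]
    abelian_group_hom.hom_zero[OF lact_tensor(1)] abelian_group_hom.hom_zero[OF ract_tensor(1)]
    abelian_group_hom.hom_closed[OF lact_tensor(1)] abelian_group_hom.hom_closed[OF ract_tensor(1)]
  \<comment> \<open>Additivity in the scalar has to survive the difference step of
    \<open>tensor_induct\<close>: there a difference of sums is compared with a sum of
    differences.\<close>
  have interchange: "(s \<ominus>\<^bsub>W\<^esub> s') \<oplus>\<^bsub>W\<^esub> (t \<ominus>\<^bsub>W\<^esub> t') = (s \<oplus>\<^bsub>W\<^esub> t) \<ominus>\<^bsub>W\<^esub> (s' \<oplus>\<^bsub>W\<^esub> t')"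
    if "s \<in> carrier W" "s' \<in> carrier W" "t \<in> carrier W" "t' \<in> carrier W" for s s' t t'
    using that by (simp add: a_minus_def W.minus_add W.a_ac)
  show "lact W (b \<oplus>\<^bsub>L\<^esub> b') x = lact W b x \<oplus>\<^bsub>W\<^esub> lact W b' x" if "b \<in> carrier L" "b' \<in> carrier L" "x \<in> carrier W" for b b' x
    using that(3,1,2) by (induction x rule: tensor_induct) (auto simp: U.add_lact tens_add_left interchange)
  show "ract W x (a \<oplus>\<^bsub>Q\<^esub> a') = ract W x a \<oplus>\<^bsub>W\<^esub> ract W x a'" if "x \<in> carrier W" "a \<in> carrier Q" "a' \<in> carrier Q" for x a a'
    using that by (induction x rule: tensor_induct) (auto simp: V.add_ract tens_add_right interchange)
  show "lact W (b \<otimes>\<^bsub>L\<^esub> b') x = lact W b (lact W b' x)" if "b \<in> carrier L" "b' \<in> carrier L" "x \<in> carrier W" for b b' x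
    using that(3,1,2) by (induction x rule: tensor_induct) (auto simp: U.lact_mult)
  show "ract W x (a \<otimes>\<^bsub>Q\<^esub> a') = ract W (ract W x a) a'" if "x \<in> carrier W" "a \<in> carrier Q" "a' \<in> carrier Q" for x a a'
    using that by (induction x rule: tensor_induct) (auto simp: V.ract_mult)
  show "lact W b (ract W x a) = ract W (lact W b x) a" if "b \<in> carrier L" "x \<in> carrier W" "a \<in> carrier Q" for b x a
    using that(2,1,3) by (induction x rule: tensor_induct) auto
qed (auto simp: abelian_group_hom.hom_add[OF lact_tensor(1)] abelian_group_hom.hom_add[OF ract_tensor(1)]
    abelian_group_hom.hom_closed[OF lact_tensor(1)] abelian_group_hom.hom_closed[OF ract_tensor(1)])

lemma bimod_tensor: "bimod L Q W" ..

end

section \<open>One-sided projectives and direct sums\<close>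

lemma (in assoc_algebra) bimod_left_proj:
  assumes e: "e \<in> carrier M"
  shows "bimod M R (left_proj M e)"
proof -
  interpret abelian_group "left_proj M e"
  proof (rule abelian_groupI)
    fix x assume "x \<in> carrier (left_proj M e)"
    then obtain a where a: "a \<in> carrier M" "x = a \<otimes>\<^bsub>M\<^esub> e" by (auto simp: left_proj_def)
    have "\<ominus>\<^bsub>M\<^esub> x = (\<ominus>\<^bsub>M\<^esub> a) \<otimes>\<^bsub>M\<^esub> e" using a e by (simp add: l_minus)
    then show "\<exists>y\<in>carrier (left_proj M e). y \<oplus>\<^bsub>left_proj M e\<^esub> x = \<zero>\<^bsub>left_proj M e\<^esub>"
      using a e M.l_neg[of x] by (intro bexI[of _ "\<ominus>\<^bsub>M\<^esub> x"]) (auto simp: left_proj_def)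
  next
    show "\<zero>\<^bsub>left_proj M e\<^esub> \<in> carrier (left_proj M e)"
      using e by (auto simp: left_proj_def intro!: exI[of _ "\<zero>\<^bsub>M\<^esub>"])
  next
    fix x y assume "x \<in> carrier (left_proj M e)" "y \<in> carrier (left_proj M e)"
    then obtain a b where "a \<in> carrier M" "x = a \<otimes>\<^bsub>M\<^esub> e" "b \<in> carrier M" "y = b \<otimes>\<^bsub>M\<^esub> e"
      by (auto simp: left_proj_def)
    then show "x \<oplus>\<^bsub>left_proj M e\<^esub> y \<in> carrier (left_proj M e)"
      using e by (auto simp: left_proj_def intro!: exI[of _ "a \<oplus>\<^bsub>M\<^esub> b"] l_distr[symmetric])
  qed (use e in \<open>auto simp: left_proj_def M.a_ac\<close>)
  show ?thesis
  proof
    fix a x assume "a \<in> carrier M" "x \<in> carrier (left_proj M e)"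
    then show "lact (left_proj M e) a x \<in> carrier (left_proj M e)"
      using e by (auto simp: left_proj_def m_assoc[symmetric])
  next
    fix x c assume c: "c \<in> carrier R" and "x \<in> carrier (left_proj M e)"
    then obtain a where a: "a \<in> carrier M" "x = a \<otimes>\<^bsub>M\<^esub> e" by (auto simp: left_proj_def)
    then show "ract (left_proj M e) x c \<in> carrier (left_proj M e)"
      using e c by (auto simp: left_proj_def smult_assoc_left intro!: exI[of _ "c \<odot>\<^bsub>M\<^esub> a"])
  qed (use e in \<open>auto simp: left_proj_def l_distr r_distr m_assoc smult_r_distr smult_l_distr
      smult_assoc_left smult_assoc_right R.m_comm[of _ _] smult_assoc1[symmetric]\<close>)
qed

lemma (in assoc_algebra) bimod_right_proj:
  assumes e: "e \<in> carrier M"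
  shows "bimod R M (right_proj M e)"
proof -
  interpret abelian_group "right_proj M e"
  proof (rule abelian_groupI)
    fix x assume "x \<in> carrier (right_proj M e)"
    then obtain a where a: "a \<in> carrier M" "x = e \<otimes>\<^bsub>M\<^esub> a" by (auto simp: right_proj_def)
    have "\<ominus>\<^bsub>M\<^esub> x = e \<otimes>\<^bsub>M\<^esub> (\<ominus>\<^bsub>M\<^esub> a)" using a e by (simp add: r_minus)
    then show "\<exists>y\<in>carrier (right_proj M e). y \<oplus>\<^bsub>right_proj M e\<^esub> x = \<zero>\<^bsub>right_proj M e\<^esub>"
      using a e M.l_neg[of x] by (intro bexI[of _ "\<ominus>\<^bsub>M\<^esub> x"]) (auto simp: right_proj_def)
  next
    show "\<zero>\<^bsub>right_proj M e\<^esub> \<in> carrier (right_proj M e)"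
      using e by (auto simp: right_proj_def intro!: exI[of _ "\<zero>\<^bsub>M\<^esub>"])
  next
    fix x y assume "x \<in> carrier (right_proj M e)" "y \<in> carrier (right_proj M e)"
    then obtain a b where "a \<in> carrier M" "x = e \<otimes>\<^bsub>M\<^esub> a" "b \<in> carrier M" "y = e \<otimes>\<^bsub>M\<^esub> b"
      by (auto simp: right_proj_def)
    then show "x \<oplus>\<^bsub>right_proj M e\<^esub> y \<in> carrier (right_proj M e)"
      using e by (auto simp: right_proj_def intro!: exI[of _ "a \<oplus>\<^bsub>M\<^esub> b"] r_distr[symmetric])
  qed (use e in \<open>auto simp: right_proj_def M.a_ac\<close>)
  show ?thesis
  proof
    fix a x assume "a \<in> carrier M" "x \<in> carrier (right_proj M e)"
    then show "ract (right_proj M e) x a \<in> carrier (right_proj M e)"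
      using e by (auto simp: right_proj_def m_assoc)
  next
    fix x c assume c: "c \<in> carrier R" and "x \<in> carrier (right_proj M e)"
    then obtain a where a: "a \<in> carrier M" "x = e \<otimes>\<^bsub>M\<^esub> a" by (auto simp: right_proj_def)
    then show "lact (right_proj M e) c x \<in> carrier (right_proj M e)"
      using e c by (auto simp: right_proj_def smult_assoc_right intro!: exI[of _ "c \<odot>\<^bsub>M\<^esub> a"])
  qed (use e in \<open>auto simp: right_proj_def l_distr r_distr m_assoc smult_r_distr smult_l_distr
      smult_assoc_left smult_assoc_right smult_assoc1\<close>)
qed

definition sum_incl :: "'i set \<Rightarrow> ('i \<Rightarrow> ('l, 'r, 'x) bimodule) \<Rightarrow> 'i \<Rightarrow> 'x \<Rightarrow> 'i \<Rightarrow> 'x" where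
  "sum_incl I U i u = (\<lambda>k\<in>I. if k = i then u else \<zero>\<^bsub>U k\<^esub>)"

locale bimod_family =
  fixes L :: "('l, 'c) ring_scheme" and R :: "('r, 'd) ring_scheme"
    and I :: "'i set" and U :: "'i \<Rightarrow> ('l, 'r, 'x) bimodule"
  assumes bimod: "i \<in> I \<Longrightarrow> bimod L R (U i)" and ring_L: "ring L" and ring_R: "ring R"
begin

abbreviation Sm where "Sm \<equiv> bimod_sum I U"

lemma abelian_group: "i \<in> I \<Longrightarrow> abelian_group (U i)"
  using bimod by (simp add: bimod_def)

lemma group_add_monoid: "i \<in> I \<Longrightarrow> group (add_monoid (U i))"
  using abelian_group by (rule abelian_group.a_group)

lemma sum_simps:
  "carrier Sm = {x \<in> \<Pi>\<^sub>E i\<in>I. carrier (U i). finite {i \<in> I. x i \<noteq> \<zero>\<^bsub>U i\<^esub>}}"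
  "\<zero>\<^bsub>Sm\<^esub> = (\<lambda>i\<in>I. \<zero>\<^bsub>U i\<^esub>)" "x \<oplus>\<^bsub>Sm\<^esub> y = (\<lambda>i\<in>I. x i \<oplus>\<^bsub>U i\<^esub> y i)"
  "lact Sm b x = (\<lambda>i\<in>I. lact (U i) b (x i))" "ract Sm x a = (\<lambda>i\<in>I. ract (U i) (x i) a)"
  by (simp_all add: bimod_sum_def Let_def carrier_sum_group group_add_monoid)

lemma sum_memD: "x \<in> carrier Sm \<Longrightarrow> i \<in> I \<Longrightarrow> x i \<in> carrier (U i)"
  by (auto simp: sum_simps)

lemma sum_restrict: "x \<in> carrier Sm \<Longrightarrow> (\<lambda>i\<in>I. x i) = x"
  by (auto simp: sum_simps PiE_def extensional_restrict)

text \<open>A coordinatewise map that preserves zero can only shrink the support, which therefore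
  stays finite.\<close>

lemma sum_memI:
  assumes "x \<in> carrier Sm" "\<And>i. i \<in> I \<Longrightarrow> f i (x i) \<in> carrier (U i)" "\<And>i. i \<in> I \<Longrightarrow> f i \<zero>\<^bsub>U i\<^esub> = \<zero>\<^bsub>U i\<^esub>"
  shows "(\<lambda>i\<in>I. f i (x i)) \<in> carrier Sm"
proof -
  have "{i \<in> I. f i (x i) \<noteq> \<zero>\<^bsub>U i\<^esub>} \<subseteq> {i \<in> I. x i \<noteq> \<zero>\<^bsub>U i\<^esub>}"
    using assms(3) by auto
  then show ?thesis
    using assms(1,2) by (auto simp: sum_simps conj_commute intro: finite_subset cong: conj_cong)
qed

lemma abelian_group_sum: "abelian_group Sm"
proof (rule comm_group_abelian_groupI, rule comm_group_cong)
  let ?G = "sum_group I (\<lambda>i. add_monoid (U i))"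
  interpret G: group ?G
    by (rule sum_group) (rule group_add_monoid)
  show "comm_group ?G"
  proof (rule G.group_comm_groupI)
    fix x y assume "x \<in> carrier ?G" "y \<in> carrier ?G"
    then show "x \<otimes>\<^bsub>?G\<^esub> y = y \<otimes>\<^bsub>?G\<^esub> x"
      by (auto simp: carrier_sum_group group_add_monoid intro!: restrict_ext
          abelian_monoid.a_comm[OF abelian_group.axioms(1)[OF abelian_group]])
  qed
qed (auto simp: bimod_sum_def Let_def)

sublocale sum: bimod L R Sm
proof -
  interpret L: ring L by (rule ring_L)
  interpret R: ring R by (rule ring_R)
  interpret abelian_group Sm by (rule abelian_group_sum)
  show "bimod L R Sm"
  proof
    fix b x assume "b \<in> carrier L" "x \<in> carrier Sm"
    then show "lact Sm b x \<in> carrier Sm"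
      unfolding sum_simps(4) by (intro sum_memI) (auto simp: sum_memD bimod.lact_closed[OF bimod] bimod.lact_zero[OF bimod])
  next
    fix x a assume "a \<in> carrier R" "x \<in> carrier Sm"
    then show "ract Sm x a \<in> carrier Sm"
      unfolding sum_simps(5) by (intro sum_memI[where f = "\<lambda>i u. ract (U i) u a"])
        (auto simp: sum_memD bimod.ract_closed[OF bimod] bimod.ract_zero[OF bimod])
  qed (auto simp: sum_simps(3-5) sum_memD cong: restrict_cong
      intro!: restrict_ext
      bimod.lact_add[OF bimod] bimod.ract_add[OF bimod] bimod.add_lact[OF bimod] bimod.add_ract[OF bimod]
      bimod.lact_mult[OF bimod] bimod.ract_mult[OF bimod] bimod.lact_ract[OF bimod])
qed

lemma proj_hom: "i \<in> I \<Longrightarrow> abelian_group_hom Sm (U i) (\<lambda>x. x i)"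
  by (rule abelian_group_hom_of_additive)
    (auto simp: abelian_group_sum abelian_group sum_memD sum_simps(3))

lemma incl_closed [simp]: "i \<in> I \<Longrightarrow> u \<in> carrier (U i) \<Longrightarrow> sum_incl I U i u \<in> carrier Sm"
  using abelian_group
  by (auto simp: sum_simps(1) sum_incl_def abelian_monoid.zero_closed abelian_group.axioms(1)
    intro: finite_subset[of _ "{i}"])

lemma incl_hom:
  assumes "i \<in> I"
  shows "abelian_group_hom (U i) Sm (sum_incl I U i)"
proof (rule abelian_group_hom_of_additive)
  fix x y assume "x \<in> carrier (U i)" "y \<in> carrier (U i)"
  then show "sum_incl I U i (x \<oplus>\<^bsub>U i\<^esub> y) = sum_incl I U i x \<oplus>\<^bsub>Sm\<^esub> sum_incl I U i y"
    using abelian_group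
    by (auto simp: sum_simps(3) sum_incl_def abelian_monoid.l_zero abelian_monoid.zero_closed
        abelian_group.axioms(1) intro!: restrict_ext)
qed (use assms in \<open>simp_all add: abelian_group_sum abelian_group\<close>)

lemma lact_incl:
  "i \<in> I \<Longrightarrow> b \<in> carrier L \<Longrightarrow> lact Sm b (sum_incl I U i u) = sum_incl I U i (lact (U i) b u)"
  by (auto simp: sum_simps(4) sum_incl_def bimod.lact_zero[OF bimod] intro!: restrict_ext)

lemma ract_incl:
  "i \<in> I \<Longrightarrow> a \<in> carrier R \<Longrightarrow> ract Sm (sum_incl I U i u) a = sum_incl I U i (ract (U i) u a)"
  by (auto simp: sum_simps(5) sum_incl_def bimod.ract_zero[OF bimod] intro!: restrict_ext)

lemma incl_eq: "i \<in> I \<Longrightarrow> sum_incl I U i u i = u"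
  and incl_neq: "k \<in> I \<Longrightarrow> k \<noteq> i \<Longrightarrow> sum_incl I U i u k = \<zero>\<^bsub>U k\<^esub>"
  by (simp_all add: sum_incl_def)

lemma sum_induct [consumes 1, case_names zero incl add]:
  assumes x: "x \<in> carrier Sm" and zero: "P \<zero>\<^bsub>Sm\<^esub>"
    and incl: "\<And>i u. i \<in> I \<Longrightarrow> u \<in> carrier (U i) \<Longrightarrow> P (sum_incl I U i u)"
    and add: "\<And>x y. x \<in> carrier Sm \<Longrightarrow> y \<in> carrier Sm \<Longrightarrow> P x \<Longrightarrow> P y \<Longrightarrow> P (x \<oplus>\<^bsub>Sm\<^esub> y)"
  shows "P x"
proof -
  \<comment> \<open>\<open>?r J\<close> truncates \<open>x\<close> to the coordinates in
    \<open>J\<close>. It is built up one coordinate at a time and equals \<open>x\<close> when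
    \<open>J\<close> is the finite support.\<close>
  let ?r = "\<lambda>J. \<lambda>i\<in>I. if i \<in> J then x i else \<zero>\<^bsub>U i\<^esub>"
  have r: "?r J \<in> carrier Sm" for J
    using sum_memI[OF x, of "\<lambda>i u. if i \<in> J then u else \<zero>\<^bsub>U i\<^esub>"] x abelian_group
    by (auto simp: sum_memD abelian_monoid.zero_closed abelian_group.axioms(1))
  have "P (?r J)" if "finite J" "J \<subseteq> I" for J
    using that
  proof (induction J rule: finite_induct)
    case empty
    then show ?case using zero by (simp add: sum_simps restrict_def)
  next
    case (insert j J)
    have j: "j \<in> I" "x j \<in> carrier (U j)"
      using insert x by (auto simp: sum_memD)
    have "?r (insert j J) = sum_incl I U j (x j) \<oplus>\<^bsub>Sm\<^esub> ?r J"
      using insert.hyps(2) abelian_group x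
      by (auto simp: sum_simps(3) sum_incl_def abelian_monoid.l_zero abelian_monoid.r_zero abelian_monoid.zero_closed
          abelian_group.axioms(1) sum_memD intro!: restrict_ext)
    moreover have "P (sum_incl I U j (x j) \<oplus>\<^bsub>Sm\<^esub> ?r J)"
      using insert.IH insert.prems by (intro add[OF incl_closed[OF j] r incl[OF j]]) blast
    ultimately show ?case
      by (simp only:)
  qed
  from this[of "{i \<in> I. x i \<noteq> \<zero>\<^bsub>U i\<^esub>}"] have "P (?r {i \<in> I. x i \<noteq> \<zero>\<^bsub>U i\<^esub>})"
    using x by (auto simp: sum_simps(1))
  also have "?r {i \<in> I. x i \<noteq> \<zero>\<^bsub>U i\<^esub>} = (\<lambda>i\<in>I. x i)"
    by (auto intro!: restrict_ext)
  finally show ?thesis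
    using x by (simp add: sum_restrict)
qed

end

section \<open>Dual bases and traces\<close>

lemma (in abelian_group_hom) hom_finsum:
  assumes "finite I" "f \<in> I \<rightarrow> carrier G"
  shows "h (finsum G f I) = (\<Oplus>\<^bsub>H\<^esub>i\<in>I. h (f i))"
  using assms by (induction I rule: finite_induct) (auto simp: Pi_iff G.finsum_insert H.finsum_insert)

lemma (in abelian_monoid) finsum_swap:
  assumes "finite I" "finite J" "\<And>i j. i \<in> I \<Longrightarrow> j \<in> J \<Longrightarrow> f i j \<in> carrier G"
  shows "(\<Oplus>i\<in>I. \<Oplus>j\<in>J. f i j) = (\<Oplus>j\<in>J. \<Oplus>i\<in>I. f i j)"
  using assms(1,3)
proof (induction I rule: finite_induct)
  case empty
  then show ?case by simp
next
  case (insert i I)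
  then have "(\<Oplus>k\<in>insert i I. \<Oplus>j\<in>J. f k j) = (\<Oplus>j\<in>J. f i j) \<oplus> (\<Oplus>j\<in>J. \<Oplus>k\<in>I. f k j)"
    by (subst finsum_insert) (auto intro!: finsum_closed)
  also have "\<dots> = (\<Oplus>j\<in>J. f i j \<oplus> (\<Oplus>k\<in>I. f k j))"
    using insert.prems by (subst finsum_addf) (auto intro!: finsum_closed)
  also have "\<dots> = (\<Oplus>j\<in>J. \<Oplus>k\<in>insert i I. f k j)"
    using insert by (intro finsum_cong') (auto simp: finsum_insert Pi_def)
  finally show ?case .
qed

definition linear_map :: "('k, 'c) ring_scheme \<Rightarrow> ('k, 'a, 'd) module_scheme \<Rightarrow> ('k, 'b, 'e) module_scheme
    \<Rightarrow> ('a \<Rightarrow> 'b) \<Rightarrow> bool" where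
  "linear_map K V W f \<longleftrightarrow> (\<forall>x\<in>carrier V. f x \<in> carrier W) \<and>
     (\<forall>x\<in>carrier V. \<forall>y\<in>carrier V. f (x \<oplus>\<^bsub>V\<^esub> y) = f x \<oplus>\<^bsub>W\<^esub> f y) \<and>
     (\<forall>c\<in>carrier K. \<forall>x\<in>carrier V. f (c \<odot>\<^bsub>V\<^esub> x) = c \<odot>\<^bsub>W\<^esub> f x)"

text \<open>Kept apart from \<open>linear_map\<close> because the field is a ring record without
  scalar multiplication and so cannot be the codomain there.\<close>

definition linear_functional :: "('k, 'c) ring_scheme \<Rightarrow> ('k, 'a, 'd) module_scheme \<Rightarrow> ('a \<Rightarrow> 'k) \<Rightarrow> bool" where
  "linear_functional K V f \<longleftrightarrow> (\<forall>x\<in>carrier V. f x \<in> carrier K) \<and>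
     (\<forall>x\<in>carrier V. \<forall>y\<in>carrier V. f (x \<oplus>\<^bsub>V\<^esub> y) = f x \<oplus>\<^bsub>K\<^esub> f y) \<and>
     (\<forall>c\<in>carrier K. \<forall>x\<in>carrier V. f (c \<odot>\<^bsub>V\<^esub> x) = c \<otimes>\<^bsub>K\<^esub> f x)"

lemma linear_functional_comp:
  "linear_map K V W f \<Longrightarrow> linear_functional K W l \<Longrightarrow> linear_functional K V (\<lambda>x. l (f x))"
  by (simp add: linear_map_def linear_functional_def)

lemma linear_map_comp:
  "linear_map K V W f \<Longrightarrow> linear_map K W Z g \<Longrightarrow> linear_map K V Z (\<lambda>x. g (f x))"
  by (simp add: linear_map_def)

text \<open>A coordinate system in the sense of the dual basis lemma for projective modules:
  finitely many elements with functionals that reproduce every vector. Traces and separating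
  functionals are both read off from it.\<close>

locale dual_basis = K: field K + module K A for K :: "('k, 'c) ring_scheme" and A :: "('k, 'a, 'd) module_scheme" +
  fixes S :: "'a set" and \<delta> :: "'a \<Rightarrow> 'a \<Rightarrow> 'k"
  assumes finite_S: "finite S" and S_carrier: "S \<subseteq> carrier A"
    and \<delta>_linear: "s \<in> S \<Longrightarrow> linear_functional K A (\<delta> s)"
    and expansion: "x \<in> carrier A \<Longrightarrow> x = (\<Oplus>\<^bsub>A\<^esub>s\<in>S. \<delta> s x \<odot>\<^bsub>A\<^esub> s)"
begin

lemma S_mem: "s \<in> S \<Longrightarrow> s \<in> carrier A"
  using S_carrier by blast

lemma \<delta>_closed: "s \<in> S \<Longrightarrow> x \<in> carrier A \<Longrightarrow> \<delta> s x \<in> carrier K"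
  using \<delta>_linear by (auto simp: linear_functional_def)

lemma functional_expansion:
  assumes l: "linear_functional K A l" and x: "x \<in> carrier A"
  shows "l x = (\<Oplus>\<^bsub>K\<^esub>s\<in>S. \<delta> s x \<otimes>\<^bsub>K\<^esub> l s)"
proof -
  interpret l: abelian_group_hom A K l
    using l by (intro abelian_group_hom_of_additive)
      (auto simp: linear_functional_def M.abelian_group_axioms K.abelian_group_axioms)
  have "l x = l (\<Oplus>\<^bsub>A\<^esub>s\<in>S. \<delta> s x \<odot>\<^bsub>A\<^esub> s)"
    using expansion[OF x] by simp
  also have "\<dots> = (\<Oplus>\<^bsub>K\<^esub>s\<in>S. l (\<delta> s x \<odot>\<^bsub>A\<^esub> s))"
    using x by (intro l.hom_finsum finite_S) (auto simp: \<delta>_closed S_mem)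
  also have "\<dots> = (\<Oplus>\<^bsub>K\<^esub>s\<in>S. \<delta> s x \<otimes>\<^bsub>K\<^esub> l s)"
    using l x by (intro K.finsum_cong') (auto simp: linear_functional_def \<delta>_closed S_mem)
  finally show ?thesis .
qed

text \<open>By the expansion some coordinate of a nonzero vector is nonzero; dividing that
  coordinate functional by its value at \<open>x\<close> normalises it.\<close>

lemma separating_functional:
  assumes "x \<in> carrier A" "x \<noteq> \<zero>\<^bsub>A\<^esub>"
  obtains l where "linear_functional K A l" "l x = \<one>\<^bsub>K\<^esub>"
proof -
  obtain s where s: "s \<in> S" "\<delta> s x \<noteq> \<zero>\<^bsub>K\<^esub>"
  proof (rule ccontr)
    assume "\<not> thesis"
    then have "\<And>s. s \<in> S \<Longrightarrow> \<delta> s x = \<zero>\<^bsub>K\<^esub>"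
      using that by blast
    then have "(\<Oplus>\<^bsub>A\<^esub>s\<in>S. \<delta> s x \<odot>\<^bsub>A\<^esub> s) = (\<Oplus>\<^bsub>A\<^esub>s\<in>S. \<zero>\<^bsub>A\<^esub>)"
      by (intro M.finsum_cong') (auto simp: S_mem)
    then show False
      using expansion[OF assms(1)] assms(2) by simp
  qed
  have inv: "inv\<^bsub>K\<^esub> \<delta> s x \<in> carrier K" "inv\<^bsub>K\<^esub> \<delta> s x \<otimes>\<^bsub>K\<^esub> \<delta> s x = \<one>\<^bsub>K\<^esub>"
    using s assms K.field_Units by (auto simp: \<delta>_closed)
  show thesis
  proof (rule that)
    show "linear_functional K A (\<lambda>y. inv\<^bsub>K\<^esub> \<delta> s x \<otimes>\<^bsub>K\<^esub> \<delta> s y)"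
      using \<delta>_linear[OF s(1)] inv(1) by (auto simp: linear_functional_def K.r_distr K.m_lcomm)
  qed (rule inv(2))
qed

definition trace :: "('a \<Rightarrow> 'a) \<Rightarrow> 'k" where
  "trace V = (\<Oplus>\<^bsub>K\<^esub>s\<in>S. \<delta> s (V s))"

lemma trace_closed: "(\<And>x. x \<in> carrier A \<Longrightarrow> V x \<in> carrier A) \<Longrightarrow> trace V \<in> carrier K"
  unfolding trace_def by (auto intro!: K.finsum_closed \<delta>_closed simp: S_mem)

lemma trace_cong:
  "(\<And>x. x \<in> carrier A \<Longrightarrow> W x \<in> carrier A) \<Longrightarrow> (\<And>x. x \<in> carrier A \<Longrightarrow> V x = W x) \<Longrightarrow> trace V = trace W"
  unfolding trace_def by (intro K.finsum_cong') (auto simp: \<delta>_closed S_mem)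

lemma trace_add:
  assumes "\<And>x. x \<in> carrier A \<Longrightarrow> V x \<in> carrier A" "\<And>x. x \<in> carrier A \<Longrightarrow> W x \<in> carrier A"
  shows "trace (\<lambda>x. V x \<oplus>\<^bsub>A\<^esub> W x) = trace V \<oplus>\<^bsub>K\<^esub> trace W"
proof -
  have "trace (\<lambda>x. V x \<oplus>\<^bsub>A\<^esub> W x) = (\<Oplus>\<^bsub>K\<^esub>s\<in>S. \<delta> s (V s) \<oplus>\<^bsub>K\<^esub> \<delta> s (W s))"
    unfolding trace_def using assms \<delta>_linear
    by (intro K.finsum_cong') (auto simp: linear_functional_def S_mem)
  also have "\<dots> = trace V \<oplus>\<^bsub>K\<^esub> trace W"
    unfolding trace_def by (rule K.finsum_addf) (auto simp: \<delta>_closed S_mem assms)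
  finally show ?thesis .
qed

lemma trace_zero: "(\<And>x. x \<in> carrier A \<Longrightarrow> V x = \<zero>\<^bsub>A\<^esub>) \<Longrightarrow> trace V = \<zero>\<^bsub>K\<^esub>"
proof -
  assume V: "\<And>x. x \<in> carrier A \<Longrightarrow> V x = \<zero>\<^bsub>A\<^esub>"
  \<comment> \<open>Since zero equals zero plus zero, \<open>V\<close> agrees with its pointwise sum
    with itself, and cancellation in \<open>K\<close> leaves zero.\<close>
  have "trace V = trace V \<oplus>\<^bsub>K\<^esub> trace V"
    using trace_add[of V V] trace_cong[of V "\<lambda>x. V x \<oplus>\<^bsub>A\<^esub> V x"] V by simp
  then show ?thesis
    using trace_closed[of V] V by simp
qed

lemma trace_rank_one:
  assumes l: "linear_functional K A l" and a: "a \<in> carrier A"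
  shows "trace (\<lambda>x. l x \<odot>\<^bsub>A\<^esub> a) = l a"
proof -
  have "trace (\<lambda>x. l x \<odot>\<^bsub>A\<^esub> a) = (\<Oplus>\<^bsub>K\<^esub>s\<in>S. \<delta> s a \<otimes>\<^bsub>K\<^esub> l s)"
    unfolding trace_def using l \<delta>_linear a
    by (intro K.finsum_cong') (auto simp: linear_functional_def S_mem K.m_comm)
  then show ?thesis
    using functional_expansion[OF l a] by simp
qed

text \<open>Expanding the inner vector in coordinates turns either side into a double sum of
  products of matrix entries. The two double sums differ by the order of summation and of the
  factors.\<close>

lemma trace_commute:
  assumes V: "linear_map K A A V" and W: "linear_map K A A W"
  shows "trace (\<lambda>x. V (W x)) = trace (\<lambda>x. W (V x))"
proof -
  have expand: "trace (\<lambda>x. V (W x)) = (\<Oplus>\<^bsub>K\<^esub>s\<in>S. \<Oplus>\<^bsub>K\<^esub>s'\<in>S. \<delta> s' (W s) \<otimes>\<^bsub>K\<^esub> \<delta> s (V s'))"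
    if V: "linear_map K A A V" and W: "linear_map K A A W" for V W
    unfolding trace_def
  proof (intro K.finsum_cong' refl)
    show "(\<lambda>s. \<Oplus>\<^bsub>K\<^esub>s'\<in>S. \<delta> s' (W s) \<otimes>\<^bsub>K\<^esub> \<delta> s (V s')) \<in> S \<rightarrow> carrier K"
      using V W by (auto intro!: K.finsum_closed K.m_closed \<delta>_closed simp: linear_map_def S_mem)
    fix s assume "s \<in> S"
    then show "\<delta> s (V (W s)) = (\<Oplus>\<^bsub>K\<^esub>s'\<in>S. \<delta> s' (W s) \<otimes>\<^bsub>K\<^esub> \<delta> s (V s'))"
      using functional_expansion[OF linear_functional_comp[OF V \<delta>_linear], of s "W s"] W
      by (auto simp: linear_map_def S_mem)
  qed
  have "trace (\<lambda>x. V (W x)) = (\<Oplus>\<^bsub>K\<^esub>s'\<in>S. \<Oplus>\<^bsub>K\<^esub>s\<in>S. \<delta> s' (W s) \<otimes>\<^bsub>K\<^esub> \<delta> s (V s'))"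
    unfolding expand[OF V W] using V W
    by (intro K.finsum_swap finite_S) (auto intro!: K.m_closed \<delta>_closed simp: linear_map_def S_mem)
  also have "\<dots> = (\<Oplus>\<^bsub>K\<^esub>s'\<in>S. \<Oplus>\<^bsub>K\<^esub>s\<in>S. \<delta> s (V s') \<otimes>\<^bsub>K\<^esub> \<delta> s' (W s))"
    using V W by (intro K.finsum_cong' refl)
      (auto intro!: K.finsum_closed K.m_closed K.m_comm \<delta>_closed simp: linear_map_def S_mem)
  finally show ?thesis
    unfolding expand[OF W V] .
qed

end

text \<open>A spanning set of least cardinality has unique coefficients, since a nontrivial relation
  would allow one element to be dropped. Uniqueness then makes the chosen coordinates
  linear.\<close>

lemma fin_dim_algebra_dual_basis:
  assumes K: "field K" and fd: "fin_dim_algebra K A"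
  obtains S \<delta> where "dual_basis K A S \<delta>"
proof -
  interpret K: field K by fact
  interpret A: assoc_algebra K A using fd by (simp add: fin_dim_algebra_def)
  define L where "L S c = (\<Oplus>\<^bsub>A\<^esub>s\<in>S. c s \<odot>\<^bsub>A\<^esub> s)" for S c
  define spans where "spans S \<longleftrightarrow> finite S \<and> S \<subseteq> carrier A \<and> (\<forall>x\<in>carrier A. \<exists>c\<in>S \<rightarrow> carrier K. x = L S c)" for S
  obtain S0 where "spans S0"
    using fd by (auto simp: fin_dim_algebra_def spans_def L_def)
  then obtain S where S: "spans S" and min: "\<And>S'. spans S' \<Longrightarrow> card S \<le> card S'"
    using ex_has_least_nat[of spans S0 card] by auto
  have fin: "finite S" and sub: "s \<in> S \<Longrightarrow> s \<in> carrier A" for s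
    using S by (auto simp: spans_def)
  have L_closed: "L S c \<in> carrier A" if "c \<in> S \<rightarrow> carrier K" for c
    unfolding L_def using that sub by (intro A.M.finsum_closed) auto
  have L_add: "L S (\<lambda>s. c s \<oplus>\<^bsub>K\<^esub> c' s) = L S c \<oplus>\<^bsub>A\<^esub> L S c'" if c: "c \<in> S \<rightarrow> carrier K" "c' \<in> S \<rightarrow> carrier K" for c c'
  proof -
    have "L S (\<lambda>s. c s \<oplus>\<^bsub>K\<^esub> c' s) = (\<Oplus>\<^bsub>A\<^esub>s\<in>S. c s \<odot>\<^bsub>A\<^esub> s \<oplus>\<^bsub>A\<^esub> c' s \<odot>\<^bsub>A\<^esub> s)"
      unfolding L_def using c sub by (intro A.M.finsum_cong') (auto simp: A.smult_l_distr Pi_iff)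
    also have "\<dots> = L S c \<oplus>\<^bsub>A\<^esub> L S c'"
      unfolding L_def using c sub by (intro A.M.finsum_addf) auto
    finally show ?thesis .
  qed
  have L_smult: "L S (\<lambda>s. k \<otimes>\<^bsub>K\<^esub> c s) = k \<odot>\<^bsub>A\<^esub> L S c" if c: "k \<in> carrier K" "c \<in> S \<rightarrow> carrier K" for k c
  proof -
    have "L S (\<lambda>s. k \<otimes>\<^bsub>K\<^esub> c s) = (\<Oplus>\<^bsub>A\<^esub>s\<in>S. k \<odot>\<^bsub>A\<^esub> (c s \<odot>\<^bsub>A\<^esub> s))"
      unfolding L_def using c sub by (intro A.M.finsum_cong') (auto simp: A.smult_assoc1 Pi_iff)
    also have "\<dots> = k \<odot>\<^bsub>A\<^esub> L S c"
      unfolding L_def using c sub fin by (intro A.finsum_smult_ldistr[symmetric]) auto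
    finally show ?thesis .
  qed
  have unique: "c s = c' s" if c: "c \<in> S \<rightarrow> carrier K" "c' \<in> S \<rightarrow> carrier K" "L S c = L S c'" and s: "s \<in> S" for c c' s
  proof (rule ccontr)
    assume neq: "c s \<noteq> c' s"
    \<comment> \<open>The difference is written with the scalar -1 so that \<open>L_add\<close> and
      \<open>L_smult\<close> apply; \<open>d\<close> is a relation among the elements of
      \<open>S\<close> whose coefficient at \<open>s\<close> is nonzero.\<close>
    define d where "d r = c r \<oplus>\<^bsub>K\<^esub> (\<ominus>\<^bsub>K\<^esub> \<one>\<^bsub>K\<^esub>) \<otimes>\<^bsub>K\<^esub> c' r" for r
    have m: "(\<lambda>s. (\<ominus>\<^bsub>K\<^esub> \<one>\<^bsub>K\<^esub>) \<otimes>\<^bsub>K\<^esub> c' s) \<in> S \<rightarrow> carrier K"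
      using c by auto
    have d: "d \<in> S \<rightarrow> carrier K"
      using c by (auto simp: d_def Pi_iff)
    have "L S d = L S c \<oplus>\<^bsub>A\<^esub> (\<ominus>\<^bsub>K\<^esub> \<one>\<^bsub>K\<^esub>) \<odot>\<^bsub>A\<^esub> L S c'"
      unfolding d_def using c m by (simp add: L_add L_smult)
    then have Ld: "L S d = \<zero>\<^bsub>A\<^esub>"
      using c L_closed[of c'] by (simp add: A.smult_l_minus A.M.r_neg)
    have ds: "d s \<noteq> \<zero>\<^bsub>K\<^esub>"
    proof
      assume "d s = \<zero>\<^bsub>K\<^esub>"
      then have "c s \<ominus>\<^bsub>K\<^esub> c' s = \<zero>\<^bsub>K\<^esub>"
        using c s by (auto simp: d_def a_minus_def K.l_minus Pi_iff)
      then show False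
        using neq c s by (auto simp: Pi_iff)
    qed
    have dc: "d s \<in> carrier K" using d s by auto
    have inv: "inv\<^bsub>K\<^esub> d s \<in> carrier K" "inv\<^bsub>K\<^esub> d s \<otimes>\<^bsub>K\<^esub> d s = \<one>\<^bsub>K\<^esub>"
      using dc ds K.field_Units by auto
    have "spans (S - {s})"
      unfolding spans_def
    proof (intro conjI ballI)
      fix x assume "x \<in> carrier A"
      then obtain e where e: "e \<in> S \<rightarrow> carrier K" "x = L S e"
        using S by (auto simp: spans_def)
      \<comment> \<open>Adding \<open>k\<close> times the relation \<open>d\<close> leaves the
        represented vector unchanged, and this \<open>k\<close> makes the coefficient at
        \<open>s\<close> vanish.\<close>
      define k where "k = \<ominus>\<^bsub>K\<^esub> (e s \<otimes>\<^bsub>K\<^esub> inv\<^bsub>K\<^esub> d s)"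
      define e' where "e' r = e r \<oplus>\<^bsub>K\<^esub> k \<otimes>\<^bsub>K\<^esub> d r" for r
      have es: "e s \<in> carrier K" using e s by auto
      have k: "k \<in> carrier K" using es inv by (simp add: k_def)
      have e': "e' \<in> S \<rightarrow> carrier K"
        using e d k by (auto simp: e'_def Pi_iff)
      have kd: "(\<lambda>s. k \<otimes>\<^bsub>K\<^esub> d s) \<in> S \<rightarrow> carrier K"
        using d k by auto
      have "L S e' = x"
        unfolding e'_def using e d k kd L_closed[of e] by (simp add: L_add L_smult Ld)
      moreover have "e' s = \<zero>\<^bsub>K\<^esub>"
        using es inv dc by (simp add: e'_def k_def K.l_minus K.m_assoc K.r_neg)
      moreover have "L S e' = e' s \<odot>\<^bsub>A\<^esub> s \<oplus>\<^bsub>A\<^esub> L (S - {s}) e'"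
      proof -
        have "L (insert s (S - {s})) e' = e' s \<odot>\<^bsub>A\<^esub> s \<oplus>\<^bsub>A\<^esub> L (S - {s}) e'"
          unfolding L_def using e' fin sub s by (intro A.M.finsum_insert) auto
        then show ?thesis
          using s by (simp add: insert_absorb)
      qed
      moreover have "L (S - {s}) e' \<in> carrier A"
        unfolding L_def using e' sub by (intro A.M.finsum_closed) auto
      ultimately have "x = L (S - {s}) e'"
        using s sub by simp
      then show "\<exists>c\<in>S - {s} \<rightarrow> carrier K. x = L (S - {s}) c"
        using e' by auto
    qed (use fin sub in auto)
    then have "card S \<le> card (S - {s})" by (rule min)
    then show False
      using card_Diff1_less[OF fin s] by linarith
  qed
  define coords where "coords x = (SOME c. c \<in> S \<rightarrow> carrier K \<and> x = L S c)" for x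
  have coords: "coords x \<in> S \<rightarrow> carrier K" "L S (coords x) = x" if "x \<in> carrier A" for x
  proof -
    have "\<exists>c. c \<in> S \<rightarrow> carrier K \<and> x = L S c"
      using S that unfolding spans_def by blast
    from someI_ex[OF this] show "coords x \<in> S \<rightarrow> carrier K" "L S (coords x) = x"
      by (simp_all add: coords_def)
  qed
  have "linear_functional K A (\<lambda>x. coords x s)" if s: "s \<in> S" for s
    unfolding linear_functional_def
  proof (intro conjI ballI)
    show "coords x s \<in> carrier K" if "x \<in> carrier A" for x
      using coords[OF that] s by auto
    show "coords (x \<oplus>\<^bsub>A\<^esub> y) s = coords x s \<oplus>\<^bsub>K\<^esub> coords y s" if "x \<in> carrier A" "y \<in> carrier A" for x y
    proof (rule unique[OF _ _ _ s])
      show "(\<lambda>s. coords x s \<oplus>\<^bsub>K\<^esub> coords y s) \<in> S \<rightarrow> carrier K"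
        using coords(1)[OF that(1)] coords(1)[OF that(2)] by (auto simp: Pi_iff)
    qed (use that coords in \<open>simp_all add: L_add\<close>)
    show "coords (c \<odot>\<^bsub>A\<^esub> x) s = c \<otimes>\<^bsub>K\<^esub> coords x s" if "c \<in> carrier K" "x \<in> carrier A" for c x
    proof (rule unique[OF _ _ _ s])
      show "(\<lambda>s. c \<otimes>\<^bsub>K\<^esub> coords x s) \<in> S \<rightarrow> carrier K"
        using coords(1)[OF that(2)] that by (auto simp: Pi_iff)
    qed (use that coords in \<open>simp_all add: L_smult\<close>)
  qed
  then have "dual_basis K A S (\<lambda>s x. coords x s)"
  proof unfold_locales
    show "finite S" "S \<subseteq> carrier A"
      using fin sub by auto
    show "x = (\<Oplus>\<^bsub>A\<^esub>s\<in>S. coords x s \<odot>\<^bsub>A\<^esub> s)" if "x \<in> carrier A" for x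
      using coords(2)[OF that] unfolding L_def by (rule sym)
  qed
  then show thesis by (rule that)
qed

section \<open>Homomorphisms into spaces of linear maps\<close>

text \<open>\<open>\<Phi>\<close> is a \<open>C\<close>-\<open>D\<close>-bimodule homomorphism from \<open>U\<close> to the space of \<open>K\<close>-linear maps from \<open>D\<close> to \<open>C\<close>.\<close>

definition hom_map :: "('k, 'e) ring_scheme \<Rightarrow> ('k, 'c, 'f) module_scheme \<Rightarrow> ('k, 'd, 'g) module_scheme
    \<Rightarrow> ('c, 'd, 'x) bimodule \<Rightarrow> ('x \<Rightarrow> 'd \<Rightarrow> 'c) \<Rightarrow> bool" where
  "hom_map K C D U \<Phi> \<longleftrightarrow> (\<forall>u\<in>carrier U. linear_map K D C (\<Phi> u)) \<and>
     (\<forall>u\<in>carrier U. \<forall>v\<in>carrier U. \<forall>t\<in>carrier D. \<Phi> (u \<oplus>\<^bsub>U\<^esub> v) t = \<Phi> u t \<oplus>\<^bsub>C\<^esub> \<Phi> v t) \<and>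
     (\<forall>b\<in>carrier C. \<forall>u\<in>carrier U. \<forall>t\<in>carrier D. \<Phi> (lact U b u) t = b \<otimes>\<^bsub>C\<^esub> \<Phi> u t) \<and>
     (\<forall>u\<in>carrier U. \<forall>a\<in>carrier D. \<forall>t\<in>carrier D. \<Phi> (ract U u a) t = \<Phi> u (a \<otimes>\<^bsub>D\<^esub> t))"

lemma hom_map_closed:
  "hom_map K C D U \<Phi> \<Longrightarrow> u \<in> carrier U \<Longrightarrow> t \<in> carrier D \<Longrightarrow> \<Phi> u t \<in> carrier C"
  by (simp add: hom_map_def linear_map_def)

locale alg_pair = K: field K + C: assoc_algebra K C + D: assoc_algebra K D
  for K :: "('k, 'e) ring_scheme" and C :: "('k, 'c, 'f) module_scheme" and D :: "('k, 'd, 'g) module_scheme"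
begin

lemma smult_minus:
  "c \<in> carrier K \<Longrightarrow> x \<in> carrier C \<Longrightarrow> y \<in> carrier C \<Longrightarrow>
    c \<odot>\<^bsub>C\<^esub> (x \<ominus>\<^bsub>C\<^esub> y) = c \<odot>\<^bsub>C\<^esub> x \<ominus>\<^bsub>C\<^esub> c \<odot>\<^bsub>C\<^esub> y"
  by (simp add: a_minus_def C.smult_r_distr C.smult_r_minus)

lemma mult_minus:
  "c \<in> carrier C \<Longrightarrow> x \<in> carrier C \<Longrightarrow> y \<in> carrier C \<Longrightarrow>
    c \<otimes>\<^bsub>C\<^esub> (x \<ominus>\<^bsub>C\<^esub> y) = c \<otimes>\<^bsub>C\<^esub> x \<ominus>\<^bsub>C\<^esub> c \<otimes>\<^bsub>C\<^esub> y"
  by (simp add: a_minus_def C.r_distr C.r_minus)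

lemma minus_interchange:
  "s \<in> carrier C \<Longrightarrow> s' \<in> carrier C \<Longrightarrow> t \<in> carrier C \<Longrightarrow> t' \<in> carrier C \<Longrightarrow>
    (s \<oplus>\<^bsub>C\<^esub> t) \<ominus>\<^bsub>C\<^esub> (s' \<oplus>\<^bsub>C\<^esub> t') = (s \<ominus>\<^bsub>C\<^esub> s') \<oplus>\<^bsub>C\<^esub> (t \<ominus>\<^bsub>C\<^esub> t')"
  by (simp add: a_minus_def C.M.minus_add C.M.a_ac)

end

text \<open>The universal property is applied for each \<open>t\<close> separately, so that no group of maps is needed as
  codomain; linearity in \<open>t\<close> is checked afterwards on generators.\<close>

lemma (in alg_pair) hom_map_tensor:
  fixes R :: "('r, 'h) ring_scheme"
  assumes tp: "tensor_pair C R D U V"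
    and f_lin: "\<And>x y. x \<in> carrier U \<Longrightarrow> y \<in> carrier V \<Longrightarrow> linear_map K D C (f x y)"
    and f_left: "\<And>x x' y t. x \<in> carrier U \<Longrightarrow> x' \<in> carrier U \<Longrightarrow> y \<in> carrier V \<Longrightarrow> t \<in> carrier D \<Longrightarrow>
      f (x \<oplus>\<^bsub>U\<^esub> x') y t = f x y t \<oplus>\<^bsub>C\<^esub> f x' y t"
    and f_right: "\<And>x y y' t. x \<in> carrier U \<Longrightarrow> y \<in> carrier V \<Longrightarrow> y' \<in> carrier V \<Longrightarrow> t \<in> carrier D \<Longrightarrow>
      f x (y \<oplus>\<^bsub>V\<^esub> y') t = f x y t \<oplus>\<^bsub>C\<^esub> f x y' t"
    and f_bal: "\<And>x r y t. x \<in> carrier U \<Longrightarrow> r \<in> carrier R \<Longrightarrow> y \<in> carrier V \<Longrightarrow> t \<in> carrier D \<Longrightarrow>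
      f (ract U x r) y t = f x (lact V r y) t"
    and f_lact: "\<And>b x y t. b \<in> carrier C \<Longrightarrow> x \<in> carrier U \<Longrightarrow> y \<in> carrier V \<Longrightarrow> t \<in> carrier D \<Longrightarrow>
      f (lact U b x) y t = b \<otimes>\<^bsub>C\<^esub> f x y t"
    and f_ract: "\<And>x y a t. x \<in> carrier U \<Longrightarrow> y \<in> carrier V \<Longrightarrow> a \<in> carrier D \<Longrightarrow> t \<in> carrier D \<Longrightarrow>
      f x (ract V y a) t = f x y (a \<otimes>\<^bsub>D\<^esub> t)"
  obtains \<Phi> where "hom_map K C D (tensor R U V) \<Phi>"
    "\<And>x y t. x \<in> carrier U \<Longrightarrow> y \<in> carrier V \<Longrightarrow> t \<in> carrier D \<Longrightarrow> \<Phi> (tens R U V x y) t = f x y t"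
proof -
  interpret tensor_pair C R D U V by (rule tp)
  have "\<exists>h. abelian_group_hom W C h \<and> (\<forall>x\<in>carrier U. \<forall>y\<in>carrier V. h (tens R U V x y) = f x y t)"
    if t: "t \<in> carrier D" for t
  proof -
    obtain h where "abelian_group_hom W C h"
      "\<And>x y. x \<in> carrier U \<Longrightarrow> y \<in> carrier V \<Longrightarrow> h (tens R U V x y) = f x y t"
      by (rule tensor_universal[of C "\<lambda>x y. f x y t"])
        (use t f_lin in \<open>auto simp: C.M.abelian_group_axioms f_left f_right f_bal linear_map_def\<close>)
    then show ?thesis by blast
  qed
  then obtain H where H: "\<And>t. t \<in> carrier D \<Longrightarrow> abelian_group_hom W C (H t)"
    and Ht: "\<And>t x y. t \<in> carrier D \<Longrightarrow> x \<in> carrier U \<Longrightarrow> y \<in> carrier V \<Longrightarrow> H t (tens R U V x y) = f x y t"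
    by metis
  note [simp] = abelian_group_hom.hom_minus[OF H] abelian_group_hom.hom_zero[OF H]
    abelian_group_hom.hom_closed[OF H] abelian_group_hom.hom_add[OF H] Ht
    smult_minus mult_minus minus_interchange
  have "linear_map K D C (\<lambda>t. H t u)" if "u \<in> carrier W" for u
    using that
  proof (induction u rule: tensor_induct)
    case zero
    then show ?case by (simp add: linear_map_def)
  next
    case (tens x y)
    then show ?case using f_lin[OF tens] by (simp add: linear_map_def)
  next
    case (minus T T')
    then show ?case by (simp add: linear_map_def)
  qed
  moreover have "H t (lact W b u) = b \<otimes>\<^bsub>C\<^esub> H t u" if "u \<in> carrier W" "b \<in> carrier C" "t \<in> carrier D" for b u t
    using that by (induction u rule: tensor_induct) (auto simp: lact_tensor(2) f_lact tensor.lact_minus)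
  moreover have "H t (ract W u a) = H (a \<otimes>\<^bsub>D\<^esub> t) u" if "u \<in> carrier W" "a \<in> carrier D" "t \<in> carrier D" for a u t
    using that by (induction u rule: tensor_induct) (auto simp: ract_tensor(2) f_ract tensor.ract_minus)
  ultimately have "hom_map K C D W (\<lambda>u t. H t u)"
    by (simp add: hom_map_def)
  then show thesis
    by (rule that) simp
qed

section \<open>Direct sums of bimodules generated by a tensor of two idempotents\<close>

lemma left_proj_ops:
  "x \<oplus>\<^bsub>left_proj A e\<^esub> y = x \<oplus>\<^bsub>A\<^esub> y" "\<zero>\<^bsub>left_proj A e\<^esub> = \<zero>\<^bsub>A\<^esub>"
  "lact (left_proj A e) a x = a \<otimes>\<^bsub>A\<^esub> x" "ract (left_proj A e) x c = c \<odot>\<^bsub>A\<^esub> x"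
  by (simp_all add: left_proj_def)

lemma right_proj_ops:
  "x \<oplus>\<^bsub>right_proj A e\<^esub> y = x \<oplus>\<^bsub>A\<^esub> y" "\<zero>\<^bsub>right_proj A e\<^esub> = \<zero>\<^bsub>A\<^esub>"
  "lact (right_proj A e) c x = c \<odot>\<^bsub>A\<^esub> x" "ract (right_proj A e) x a = x \<otimes>\<^bsub>A\<^esub> a"
  by (simp_all add: right_proj_def)

text \<open>The summand at \<open>i\<close> is \<open>C l\<^sub>i \<otimes> r\<^sub>i D\<close>.
  Repeated copies are different indices with the same idempotents. The locale serves both
  \<open>N\<close> (with \<open>C = A\<close>, \<open>D = B\<close>) and \<open>M\<close> (with the
  roles exchanged).\<close>

locale proj_family = alg_pair K C D
  for K :: "('k, 'e) ring_scheme" and C :: "('k, 'c, 'f) module_scheme" and D :: "('k, 'd, 'g) module_scheme" +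
  fixes I :: "'i set" and l :: "'i \<Rightarrow> 'c" and r :: "'i \<Rightarrow> 'd"
  assumes l: "i \<in> I \<Longrightarrow> l i \<in> carrier C" "i \<in> I \<Longrightarrow> l i \<otimes>\<^bsub>C\<^esub> l i = l i"
    and r: "i \<in> I \<Longrightarrow> r i \<in> carrier D" "i \<in> I \<Longrightarrow> r i \<otimes>\<^bsub>D\<^esub> r i = r i"
begin

abbreviation LP where "LP i \<equiv> left_proj C (l i) :: ('c, 'k, 'c) bimodule"
abbreviation RP where "RP i \<equiv> right_proj D (r i) :: ('k, 'd, 'd) bimodule"
abbreviation U where "U i \<equiv> tensor K (LP i) (RP i)"

lemma tensor_pair: "i \<in> I \<Longrightarrow> tensor_pair C K D (LP i) (RP i)"
  unfolding tensor_pair_def using C.bimod_left_proj D.bimod_right_proj l r by blast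

sublocale bimod_family C D I U
proof (rule bimod_family.intro)
  show "ring C" "ring D" by unfold_locales
  show "bimod C D (U i)" if "i \<in> I" for i
    using tensor_pair[OF that] by (rule tensor_pair.bimod_tensor)
qed

text \<open>The element \<open>l\<^sub>i \<otimes> r\<^sub>i\<close>, which generates the summand at
  \<open>i\<close> as a bimodule.\<close>

definition w where "w i = sum_incl I U i (tens K (LP i) (RP i) (l i) (r i))"

lemma proj_mem:
  assumes "i \<in> I"
  shows "x \<in> carrier (LP i) \<Longrightarrow> x \<in> carrier C" "y \<in> carrier (RP i) \<Longrightarrow> y \<in> carrier D"
    "x \<in> carrier (LP i) \<Longrightarrow> x \<otimes>\<^bsub>C\<^esub> l i = x" "y \<in> carrier (RP i) \<Longrightarrow> r i \<otimes>\<^bsub>D\<^esub> y = y"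
    "l i \<in> carrier (LP i)" "r i \<in> carrier (RP i)"
  using assms l[OF assms] r[OF assms]
  by (auto simp: left_proj_def right_proj_def C.m_assoc D.m_assoc[symmetric] intro!: exI[of _ "\<one>\<^bsub>_\<^esub>"])

lemma tens_gen_closed: "i \<in> I \<Longrightarrow> tens K (LP i) (RP i) (l i) (r i) \<in> carrier (U i)"
  by (intro tensor_pair.tens_closed[OF tensor_pair] proj_mem)

lemma w_closed [simp]: "i \<in> I \<Longrightarrow> w i \<in> carrier Sm"
  unfolding w_def by (intro incl_closed tens_gen_closed)

lemma lact_w: "i \<in> I \<Longrightarrow> lact Sm (l i) (w i) = w i"
  unfolding w_def
  by (simp add: lact_incl l tensor_pair.lact_tensor(2)[OF tensor_pair] proj_mem)
    (simp add: left_proj_def l)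

lemma ract_w: "i \<in> I \<Longrightarrow> ract Sm (w i) (r i) = w i"
  unfolding w_def
  by (simp add: ract_incl r tensor_pair.ract_tensor(2)[OF tensor_pair] proj_mem)
    (simp add: right_proj_def r)

text \<open>Because \<open>x l\<^sub>i = x\<close> and \<open>r\<^sub>i y = y\<close>, acting on
  \<open>l\<^sub>i \<otimes> r\<^sub>i\<close> from both sides already produces every pure tensor of
  the summand.\<close>

lemma incl_tens:
  assumes "i \<in> I" "x \<in> carrier (LP i)" "y \<in> carrier (RP i)"
  shows "sum_incl I U i (tens K (LP i) (RP i) x y) = lact Sm x (ract Sm (w i) y)"
proof -
  interpret T: tensor_pair C K D "LP i" "RP i"
    using assms(1) by (rule tensor_pair)
  note mem = proj_mem(5,6)[OF assms(1)] proj_mem(1)[OF assms(1,2)] proj_mem(2)[OF assms(1,3)]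
  have act: "lact (LP i) x (l i) = x" "ract (RP i) (r i) y = y"
    using proj_mem(3)[OF assms(1,2)] proj_mem(4)[OF assms(1,3)]
    by (simp_all add: left_proj_def right_proj_def)
  have "lact Sm x (ract Sm (w i) y) = sum_incl I U i (lact (U i) x (ract (U i) (tens K (LP i) (RP i) (l i) (r i)) y))"
    unfolding w_def by (simp only: lact_incl ract_incl assms(1) mem)
  also have "\<dots> = sum_incl I U i (tens K (LP i) (RP i) x y)"
    using assms(2,3) mem by (simp only: T.ract_tensor(2) T.lact_tensor(2) act)
  finally show ?thesis ..
qed

lemma family_induct [consumes 1, case_names zero gen minus]:
  assumes "x \<in> carrier Sm" and zero: "P \<zero>\<^bsub>Sm\<^esub>"
    and gen: "\<And>i b a. i \<in> I \<Longrightarrow> b \<in> carrier C \<Longrightarrow> a \<in> carrier D \<Longrightarrow> P (lact Sm b (ract Sm (w i) a))"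
    and minus: "\<And>x y. x \<in> carrier Sm \<Longrightarrow> y \<in> carrier Sm \<Longrightarrow> P x \<Longrightarrow> P y \<Longrightarrow> P (x \<ominus>\<^bsub>Sm\<^esub> y)"
  shows "P x"
  using assms(1)
proof (induction x rule: sum_induct)
  case zero
  show ?case by fact
next
  case (incl i u)
  interpret T: tensor_pair C K D "LP i" "RP i"
    using incl(1) by (rule tensor_pair)
  interpret incl: abelian_group_hom "U i" Sm "sum_incl I U i"
    using incl(1) by (rule incl_hom)
  show ?case
    using incl(2)
  proof (induction u rule: T.tensor_induct)
    case (tens x y)
    then show ?case
      using incl_tens[OF incl(1)] gen[OF incl(1)] proj_mem[OF incl(1)] by simp
  next
    case (minus T T')
    then show ?case
      using assms(4) by (simp add: incl(1))
  qed (simp add: zero)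
next
  case (add x y)
  \<comment> \<open>The direct sum is built by addition while the rule offers only differences; a
    sum is recovered by subtracting a negative.\<close>
  have "x \<ominus>\<^bsub>Sm\<^esub> (\<zero>\<^bsub>Sm\<^esub> \<ominus>\<^bsub>Sm\<^esub> y) = x \<oplus>\<^bsub>Sm\<^esub> y"
    using add by (simp add: a_minus_def)
  moreover have "P (x \<ominus>\<^bsub>Sm\<^esub> (\<zero>\<^bsub>Sm\<^esub> \<ominus>\<^bsub>Sm\<^esub> y))"
    using add by (intro minus zero) auto
  ultimately show ?case by simp
qed

text \<open>The map sends \<open>x \<otimes> y\<close> to the rank one operator
  \<open>t \<mapsto> \<mu> (y t) x\<close> and is preceded by the projection to the summand
  \<open>i\<close>, which is why it vanishes on every other generator.\<close>

lemma functional_hom_map: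
  assumes i: "i \<in> I" and \<mu>: "linear_functional K D \<mu>"
  obtains \<Phi> where "hom_map K C D Sm \<Phi>"
    "\<And>t. t \<in> carrier D \<Longrightarrow> \<Phi> (w i) t = \<mu> (r i \<otimes>\<^bsub>D\<^esub> t) \<odot>\<^bsub>C\<^esub> l i"
    "\<And>k t. k \<in> I \<Longrightarrow> k \<noteq> i \<Longrightarrow> t \<in> carrier D \<Longrightarrow> \<Phi> (w k) t = \<zero>\<^bsub>C\<^esub>"
proof -
  interpret T: tensor_pair C K D "LP i" "RP i"
    using i by (rule tensor_pair)
  interpret pr: abelian_group_hom Sm "U i" "\<lambda>x. x i"
    using i by (rule proj_hom)
  note \<mu>D = \<mu>[unfolded linear_functional_def, THEN conjunct1, rule_format]
    \<mu>[unfolded linear_functional_def, THEN conjunct2, THEN conjunct1, rule_format]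
    \<mu>[unfolded linear_functional_def, THEN conjunct2, THEN conjunct2, rule_format]
  obtain \<Phi> where \<Phi>: "hom_map K C D (U i) \<Phi>"
    "\<And>x y t. x \<in> carrier (LP i) \<Longrightarrow> y \<in> carrier (RP i) \<Longrightarrow> t \<in> carrier D \<Longrightarrow>
      \<Phi> (tens K (LP i) (RP i) x y) t = \<mu> (y \<otimes>\<^bsub>D\<^esub> t) \<odot>\<^bsub>C\<^esub> x"
  proof (rule hom_map_tensor[OF T.tensor_pair_axioms, of "\<lambda>x y t. \<mu> (y \<otimes>\<^bsub>D\<^esub> t) \<odot>\<^bsub>C\<^esub> x"])
    show "\<mu> (y \<otimes>\<^bsub>D\<^esub> t) \<odot>\<^bsub>C\<^esub> (x \<oplus>\<^bsub>LP i\<^esub> x') = \<mu> (y \<otimes>\<^bsub>D\<^esub> t) \<odot>\<^bsub>C\<^esub> x \<oplus>\<^bsub>C\<^esub> \<mu> (y \<otimes>\<^bsub>D\<^esub> t) \<odot>\<^bsub>C\<^esub> x'"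
      if "x \<in> carrier (LP i)" "x' \<in> carrier (LP i)" "y \<in> carrier (RP i)" "t \<in> carrier D" for x x' y t
      using that(4) proj_mem(1)[OF i that(1)] proj_mem(1)[OF i that(2)] proj_mem(2)[OF i that(3)] by (simp add: left_proj_ops C.smult_r_distr \<mu>D)
    show "\<mu> ((y \<oplus>\<^bsub>RP i\<^esub> y') \<otimes>\<^bsub>D\<^esub> t) \<odot>\<^bsub>C\<^esub> x = \<mu> (y \<otimes>\<^bsub>D\<^esub> t) \<odot>\<^bsub>C\<^esub> x \<oplus>\<^bsub>C\<^esub> \<mu> (y' \<otimes>\<^bsub>D\<^esub> t) \<odot>\<^bsub>C\<^esub> x"
      if "x \<in> carrier (LP i)" "y \<in> carrier (RP i)" "y' \<in> carrier (RP i)" "t \<in> carrier D" for x y y' t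
      using that(4) proj_mem(1)[OF i that(1)] proj_mem(2)[OF i that(2)] proj_mem(2)[OF i that(3)] by (simp add: right_proj_ops C.smult_l_distr D.l_distr \<mu>D)
    show "\<mu> (y \<otimes>\<^bsub>D\<^esub> t) \<odot>\<^bsub>C\<^esub> ract (LP i) x s = \<mu> (lact (RP i) s y \<otimes>\<^bsub>D\<^esub> t) \<odot>\<^bsub>C\<^esub> x"
      if "x \<in> carrier (LP i)" "s \<in> carrier K" "y \<in> carrier (RP i)" "t \<in> carrier D" for x s y t
      using that(2,4) proj_mem(1)[OF i that(1)] proj_mem(2)[OF i that(3)] by (simp add: left_proj_ops right_proj_ops C.smult_assoc1[symmetric] D.smult_assoc_left K.m_comm \<mu>D)
    show "\<mu> (y \<otimes>\<^bsub>D\<^esub> t) \<odot>\<^bsub>C\<^esub> lact (LP i) b x = b \<otimes>\<^bsub>C\<^esub> (\<mu> (y \<otimes>\<^bsub>D\<^esub> t) \<odot>\<^bsub>C\<^esub> x)"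
      if "b \<in> carrier C" "x \<in> carrier (LP i)" "y \<in> carrier (RP i)" "t \<in> carrier D" for b x y t
      using that(1,4) proj_mem(1)[OF i that(2)] proj_mem(2)[OF i that(3)] by (simp add: left_proj_ops C.smult_assoc_right \<mu>D)
    show "\<mu> (ract (RP i) y a \<otimes>\<^bsub>D\<^esub> t) \<odot>\<^bsub>C\<^esub> x = \<mu> (y \<otimes>\<^bsub>D\<^esub> (a \<otimes>\<^bsub>D\<^esub> t)) \<odot>\<^bsub>C\<^esub> x"
      if "x \<in> carrier (LP i)" "y \<in> carrier (RP i)" "a \<in> carrier D" "t \<in> carrier D" for x y a t
      using that(3,4) proj_mem(1)[OF i that(1)] proj_mem(2)[OF i that(2)] by (simp add: right_proj_ops D.m_assoc)
    show "linear_map K D C (\<lambda>t. \<mu> (y \<otimes>\<^bsub>D\<^esub> t) \<odot>\<^bsub>C\<^esub> x)"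
      if "x \<in> carrier (LP i)" "y \<in> carrier (RP i)" for x y
      using proj_mem(1)[OF i that(1)] proj_mem(2)[OF i that(2)] by (simp add: linear_map_def \<mu>D D.r_distr C.smult_l_distr D.smult_assoc_right C.smult_assoc1)
  qed blast
  show thesis
  proof (rule that[of "\<lambda>x. \<Phi> (x i)"])
    show "hom_map K C D Sm (\<lambda>x. \<Phi> (x i))"
      using \<Phi>(1) i by (simp add: hom_map_def sum_simps(3-5) sum_memD)
    show "\<Phi> (w i i) t = \<mu> (r i \<otimes>\<^bsub>D\<^esub> t) \<odot>\<^bsub>C\<^esub> l i" if "t \<in> carrier D" for t
      using that i by (simp add: w_def incl_eq \<Phi>(2) proj_mem)
    show "\<Phi> (w k i) t = \<zero>\<^bsub>C\<^esub>" if "k \<in> I" "k \<noteq> i" "t \<in> carrier D" for k t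
    proof -
      \<comment> \<open>The value at zero is obtained by writing zero as a pure tensor, since
        \<open>\<Phi>\<close> is known explicitly only on those.\<close>
      have "\<Phi> \<zero>\<^bsub>U i\<^esub> t = \<Phi> (tens K (LP i) (RP i) \<zero>\<^bsub>LP i\<^esub> (r i)) t"
        using i by (simp add: proj_mem)
      also have "\<dots> = \<mu> (r i \<otimes>\<^bsub>D\<^esub> t) \<odot>\<^bsub>C\<^esub> \<zero>\<^bsub>C\<^esub>"
        using that proj_mem(6)[OF i] T.U.U.zero_closed by (subst \<Phi>(2)) (simp_all add: left_proj_ops)
      also have "\<dots> = \<zero>\<^bsub>C\<^esub>"
        using i that by (simp add: \<mu>D r)
      finally show ?thesis
        using that i by (simp add: w_def incl_neq)
    qed
  qed
qed

end

section \<open>The tensor product of two projective bimodules\<close>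

text \<open>Models a direct sum of copies of \<open>A f\<^sub>j \<otimes> V\<^sub>j \<otimes> e\<^sub>j A\<close> with vector spaces \<open>V\<^sub>j\<close>; \<open>Q j\<close> stands for the elements
  \<open>f\<^sub>j \<otimes> v \<otimes> e\<^sub>j\<close>.\<close>

locale split_bimodule = K: field K + A: assoc_algebra K A + P: bimod A A P
  for K :: "('k, 'c) ring_scheme" and A :: "('k, 'a, 'd) module_scheme"
    and P :: "('a, 'a, 'p) bimodule" +
  fixes J :: "'j set" and f :: "'j \<Rightarrow> 'a" and e :: "'j \<Rightarrow> 'a" and Q :: "'j \<Rightarrow> 'p set"
  assumes f: "j \<in> J \<Longrightarrow> f j \<in> carrier A" and e: "j \<in> J \<Longrightarrow> e j \<in> carrier A"
    and Q_closed: "j \<in> J \<Longrightarrow> q \<in> Q j \<Longrightarrow> q \<in> carrier P"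
    and lact_Q: "j \<in> J \<Longrightarrow> q \<in> Q j \<Longrightarrow> lact P (f j) q = q"
    and ract_Q: "j \<in> J \<Longrightarrow> q \<in> Q j \<Longrightarrow> ract P q (e j) = q"
    and P_induct: "\<And>x p. x \<in> carrier P \<Longrightarrow> p \<zero>\<^bsub>P\<^esub> \<Longrightarrow>
      (\<And>j q a a'. j \<in> J \<Longrightarrow> q \<in> Q j \<Longrightarrow> a \<in> carrier A \<Longrightarrow> a' \<in> carrier A \<Longrightarrow> p (lact P a (ract P q a'))) \<Longrightarrow>
      (\<And>x y. x \<in> carrier P \<Longrightarrow> y \<in> carrier P \<Longrightarrow> p x \<Longrightarrow> p y \<Longrightarrow> p (x \<ominus>\<^bsub>P\<^esub> y)) \<Longrightarrow> p x"
    and hom_map_Q: "j \<in> J \<Longrightarrow> q \<in> Q j \<Longrightarrow> q \<noteq> \<zero>\<^bsub>P\<^esub> \<Longrightarrow> linear_functional K A \<mu> \<Longrightarrow>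
      \<exists>\<Phi>. hom_map K A A P \<Phi> \<and> (\<forall>t\<in>carrier A. \<Phi> q t = \<mu> (e j \<otimes>\<^bsub>A\<^esub> t) \<odot>\<^bsub>A\<^esub> f j) \<and>
        (\<forall>j'\<in>J. \<forall>q'\<in>Q j'. \<forall>t\<in>carrier A. j' \<noteq> j \<longrightarrow> \<Phi> q' t = \<zero>\<^bsub>A\<^esub>)"

lemma (in alg_pair) linear_map_zero:
  assumes "linear_map K D C h"
  shows "h \<zero>\<^bsub>D\<^esub> = \<zero>\<^bsub>C\<^esub>"
proof -
  have "h (\<zero>\<^bsub>K\<^esub> \<odot>\<^bsub>D\<^esub> \<zero>\<^bsub>D\<^esub>) = \<zero>\<^bsub>K\<^esub> \<odot>\<^bsub>C\<^esub> h \<zero>\<^bsub>D\<^esub>" "h \<zero>\<^bsub>D\<^esub> \<in> carrier C"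
    using assms by (simp_all only: linear_map_def K.zero_closed D.M.zero_closed)
  then show ?thesis by simp
qed

text \<open>The first family models \<open>N\<close>, the second \<open>M\<close>. The dual basis of
  \<open>B\<close> supplies functionals on the spaces \<open>r\<^sub>i B l'\<^sub>k\<close> that
  arise between them.\<close>

locale proj_pair = N: proj_family K A B I l r + M: proj_family K B A I' l' r' + B: dual_basis K B S \<delta>
  for K :: "('k, 'e) ring_scheme" and A :: "('k, 'a, 'f) module_scheme" and B :: "('k, 'b, 'g) module_scheme"
    and I :: "'i set" and l r and I' :: "'j set" and l' r' S \<delta>
begin

abbreviation P where "P \<equiv> tensor B N.Sm M.Sm"
abbreviation tns where "tns \<equiv> tens B N.Sm M.Sm"

sublocale AA: alg_pair K A A
  by unfold_locales

sublocale P: tensor_pair A B A N.Sm M.Sm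
  by (simp add: tensor_pair_def N.sum.bimod_axioms M.sum.bimod_axioms)

text \<open>Stands for \<open>l\<^sub>i \<otimes> r\<^sub>i v l'\<^sub>k \<otimes>
  r'\<^sub>k\<close>. Letting \<open>v\<close> range over all of \<open>B\<close> avoids a carrier
  for \<open>r\<^sub>i B l'\<^sub>k\<close>; only the corner of \<open>v\<close> between the two
  idempotents matters.\<close>

definition gen :: "'i \<Rightarrow> 'j \<Rightarrow> 'b \<Rightarrow> (('i \<Rightarrow> ('a \<times> 'b \<Rightarrow>\<^sub>0 int) set) \<times> ('j \<Rightarrow> ('b \<times> 'a \<Rightarrow>\<^sub>0 int) set) \<Rightarrow>\<^sub>0 int) set" where
  "gen i k v = tns (N.w i) (lact M.Sm v (M.w k))"

lemma gen_closed [simp]: "i \<in> I \<Longrightarrow> k \<in> I' \<Longrightarrow> v \<in> carrier B \<Longrightarrow> gen i k v \<in> carrier P"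
  by (simp add: gen_def)

lemma lact_gen: "i \<in> I \<Longrightarrow> k \<in> I' \<Longrightarrow> v \<in> carrier B \<Longrightarrow> lact P (l i) (gen i k v) = gen i k v"
  by (simp add: gen_def P.lact_tensor(2) N.l N.lact_w)

lemma ract_gen: "i \<in> I \<Longrightarrow> k \<in> I' \<Longrightarrow> v \<in> carrier B \<Longrightarrow> ract P (gen i k v) (r' k) = gen i k v"
  by (simp add: gen_def P.ract_tensor(2) M.r M.ract_w M.sum.lact_ract[symmetric])

text \<open>The idempotents fixing \<open>w i\<close> and \<open>w k\<close> can be inserted and
  moved across the tensor sign, where they collect around \<open>v\<close>. Contrapositively, a
  nonzero \<open>gen i k v\<close> yields a nonzero element of \<open>B\<close>.\<close>

lemma gen_eq_zero:
  assumes "i \<in> I" "k \<in> I'" "v \<in> carrier B" "r i \<otimes>\<^bsub>B\<^esub> (v \<otimes>\<^bsub>B\<^esub> l' k) = \<zero>\<^bsub>B\<^esub>"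
  shows "gen i k v = \<zero>\<^bsub>P\<^esub>"
proof -
  have "gen i k v = tns (ract N.Sm (N.w i) (r i)) (lact M.Sm v (lact M.Sm (l' k) (M.w k)))"
    using assms by (simp add: gen_def N.ract_w M.lact_w)
  also have "\<dots> = tns (N.w i) (lact M.Sm (r i \<otimes>\<^bsub>B\<^esub> (v \<otimes>\<^bsub>B\<^esub> l' k)) (M.w k))"
    using assms(1-3) by (simp add: P.tens_balanced N.r M.l M.sum.lact_mult)
  finally show ?thesis
    using assms by simp
qed

lemma tns_gens:
  assumes "i \<in> I" "k \<in> I'" "a \<in> carrier A" "b \<in> carrier B" "b' \<in> carrier B" "a' \<in> carrier A"
  shows "tns (lact N.Sm a (ract N.Sm (N.w i) b)) (lact M.Sm b' (ract M.Sm (M.w k) a')) =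
    lact P a (ract P (gen i k (b \<otimes>\<^bsub>B\<^esub> b')) a')"
  using assms
  by (simp add: gen_def P.ract_tensor(2) P.lact_tensor(2) M.sum.lact_ract N.sum.lact_ract
      P.tens_balanced M.sum.lact_mult)

lemma gen_induct [consumes 1, case_names zero gen minus]:
  assumes "x \<in> carrier P" and zero: "p \<zero>\<^bsub>P\<^esub>"
    and gen: "\<And>i k v a a'. i \<in> I \<Longrightarrow> k \<in> I' \<Longrightarrow> v \<in> carrier B \<Longrightarrow> a \<in> carrier A \<Longrightarrow> a' \<in> carrier A \<Longrightarrow>
      p (lact P a (ract P (gen i k v) a'))"
    and minus: "\<And>x y. x \<in> carrier P \<Longrightarrow> y \<in> carrier P \<Longrightarrow> p x \<Longrightarrow> p y \<Longrightarrow> p (x \<ominus>\<^bsub>P\<^esub> y)"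
  shows "p x"
  using assms(1)
proof (induction x rule: P.tensor_induct)
  case (tens y x)
  note left = P.tens_left_hom[THEN abelian_group_hom.hom_minus]
    and right = P.tens_right_hom[THEN abelian_group_hom.hom_minus]
  show ?case
    using tens(1)
  proof (induction y rule: N.family_induct)
    case zero
    then show ?case using \<open>p \<zero>\<^bsub>P\<^esub>\<close> tens(2) by simp
  next
    case (gen i a b)
    show ?case
      using tens(2)
    proof (induction x rule: M.family_induct)
      case zero
      then show ?case using \<open>p \<zero>\<^bsub>P\<^esub>\<close> gen by simp
    next
      case (gen k b' a')
      with \<open>i \<in> I\<close> \<open>a \<in> carrier A\<close> \<open>b \<in> carrier B\<close> show ?case
        by (simp add: tns_gens assms(3))
    next
      case (minus x y)
      with gen show ?case by (simp add: right assms(4))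
    qed
  next
    case (minus y y')
    with tens(2) show ?case by (simp add: left assms(4))
  qed
qed (use assms in auto)

text \<open>A composite \<open>\<Phi>N y \<circ> \<Phi>M x\<close> is balanced over \<open>B\<close>
  and thus defines a map on the tensor product. With a functional \<open>\<nu>\<close> on
  \<open>B\<close> that is 1 on the middle element, the contribution of \<open>B\<close> to the
  value on \<open>gen i k v\<close> is the scalar 1.\<close>

lemma hom_map_gen:
  assumes i: "i \<in> I" and k: "k \<in> I'" and v: "v \<in> carrier B" and nz: "gen i k v \<noteq> \<zero>\<^bsub>P\<^esub>"
    and \<mu>: "linear_functional K A \<mu>"
  obtains \<Phi> where "hom_map K A A P \<Phi>"
    "\<And>t. t \<in> carrier A \<Longrightarrow> \<Phi> (gen i k v) t = \<mu> (r' k \<otimes>\<^bsub>A\<^esub> t) \<odot>\<^bsub>A\<^esub> l i"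
    "\<And>i' k' v' t. i' \<in> I \<Longrightarrow> k' \<in> I' \<Longrightarrow> v' \<in> carrier B \<Longrightarrow> t \<in> carrier A \<Longrightarrow> (i', k') \<noteq> (i, k) \<Longrightarrow>
      \<Phi> (gen i' k' v') t = \<zero>\<^bsub>A\<^esub>"
proof -
  let ?\<beta> = "r i \<otimes>\<^bsub>B\<^esub> (v \<otimes>\<^bsub>B\<^esub> l' k)"
  have \<beta>: "?\<beta> \<in> carrier B"
    using i k v by (simp add: N.r M.l)
  have "?\<beta> \<noteq> \<zero>\<^bsub>B\<^esub>"
    using gen_eq_zero[OF i k v] nz by blast
  then obtain \<nu> where \<nu>: "linear_functional K B \<nu>" "\<nu> ?\<beta> = \<one>\<^bsub>K\<^esub>"
    using B.separating_functional[OF \<beta>] by blast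
  obtain \<Phi>N where \<Phi>N: "hom_map K A B N.Sm \<Phi>N"
    "\<And>t. t \<in> carrier B \<Longrightarrow> \<Phi>N (N.w i) t = \<nu> (r i \<otimes>\<^bsub>B\<^esub> t) \<odot>\<^bsub>A\<^esub> l i"
    "\<And>i' t. i' \<in> I \<Longrightarrow> i' \<noteq> i \<Longrightarrow> t \<in> carrier B \<Longrightarrow> \<Phi>N (N.w i') t = \<zero>\<^bsub>A\<^esub>"
    using N.functional_hom_map[OF i \<nu>(1)] by blast
  obtain \<Phi>M where \<Phi>M: "hom_map K B A M.Sm \<Phi>M"
    "\<And>t. t \<in> carrier A \<Longrightarrow> \<Phi>M (M.w k) t = \<mu> (r' k \<otimes>\<^bsub>A\<^esub> t) \<odot>\<^bsub>B\<^esub> l' k"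
    "\<And>k' t. k' \<in> I' \<Longrightarrow> k' \<noteq> k \<Longrightarrow> t \<in> carrier A \<Longrightarrow> \<Phi>M (M.w k') t = \<zero>\<^bsub>B\<^esub>"
    using M.functional_hom_map[OF k \<mu>] by blast
  note closed [simp] = hom_map_closed[OF \<Phi>N(1)] hom_map_closed[OF \<Phi>M(1)]
  note N = \<Phi>N(1)[unfolded hom_map_def] and M = \<Phi>M(1)[unfolded hom_map_def]
  have linN: "linear_map K B A (\<Phi>N y)" if "y \<in> carrier N.Sm" for y
    using N that by blast
  have linM: "linear_map K A B (\<Phi>M x)" if "x \<in> carrier M.Sm" for x
    using M that by blast
  obtain \<Phi> where \<Phi>: "hom_map K A A P \<Phi>"
    "\<And>y x t. y \<in> carrier N.Sm \<Longrightarrow> x \<in> carrier M.Sm \<Longrightarrow> t \<in> carrier A \<Longrightarrow> \<Phi> (tns y x) t = \<Phi>N y (\<Phi>M x t)"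
  proof (rule AA.hom_map_tensor[OF P.tensor_pair_axioms, of "\<lambda>y x t. \<Phi>N y (\<Phi>M x t)"])
    show "linear_map K A A (\<lambda>t. \<Phi>N y (\<Phi>M x t))" if "y \<in> carrier N.Sm" "x \<in> carrier M.Sm" for y x
      using linM[OF that(2)] linN[OF that(1)] by (rule linear_map_comp)
    show "\<Phi>N y (\<Phi>M (x \<oplus>\<^bsub>M.Sm\<^esub> x') t) = \<Phi>N y (\<Phi>M x t) \<oplus>\<^bsub>A\<^esub> \<Phi>N y (\<Phi>M x' t)"
      if "y \<in> carrier N.Sm" "x \<in> carrier M.Sm" "x' \<in> carrier M.Sm" "t \<in> carrier A" for y x x' t
      using that M linN[OF that(1), unfolded linear_map_def] by simp
  qed (use N M in \<open>simp_all\<close>)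
  show thesis
  proof (rule that[OF \<Phi>(1)])
    fix t assume t: "t \<in> carrier A"
    let ?c = "\<mu> (r' k \<otimes>\<^bsub>A\<^esub> t)"
    have c: "?c \<in> carrier K"
      using \<mu> t k by (simp add: linear_functional_def M.r)
    have "\<Phi> (gen i k v) t = \<Phi>N (N.w i) (v \<otimes>\<^bsub>B\<^esub> (?c \<odot>\<^bsub>B\<^esub> l' k))"
      using i k v t M by (simp add: gen_def \<Phi>(2) \<Phi>M(2))
    also have "v \<otimes>\<^bsub>B\<^esub> (?c \<odot>\<^bsub>B\<^esub> l' k) = ?c \<odot>\<^bsub>B\<^esub> (v \<otimes>\<^bsub>B\<^esub> l' k)"
      using c v k by (simp add: N.D.smult_assoc_right M.l)
    also have "\<Phi>N (N.w i) \<dots> = ?c \<odot>\<^bsub>A\<^esub> \<Phi>N (N.w i) (v \<otimes>\<^bsub>B\<^esub> l' k)"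
      using linN[of "N.w i"] c v k i by (simp add: linear_map_def M.l)
    also have "\<dots> = ?c \<odot>\<^bsub>A\<^esub> l i"
      using i k v by (simp add: \<Phi>N(2) \<nu>(2) M.l N.l)
    finally show "\<Phi> (gen i k v) t = ?c \<odot>\<^bsub>A\<^esub> l i" .
  next
    fix i' k' v' t
    assume *: "i' \<in> I" "k' \<in> I'" "v' \<in> carrier B" "t \<in> carrier A" "(i', k') \<noteq> (i, k)"
    then have "\<Phi> (gen i' k' v') t = \<Phi>N (N.w i') (v' \<otimes>\<^bsub>B\<^esub> \<Phi>M (M.w k') t)"
      using M by (simp add: gen_def \<Phi>(2))
    also have "\<dots> = \<zero>\<^bsub>A\<^esub>"
    proof (cases "i' = i")
      case True
      then show ?thesis
        using * N.linear_map_zero[OF linN, of "N.w i'"] by (simp add: \<Phi>M(3))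
    next
      case False
      then show ?thesis
        using * by (simp add: \<Phi>N(3))
    qed
    finally show "\<Phi> (gen i' k' v') t = \<zero>\<^bsub>A\<^esub>" .
  qed
qed

text \<open>The letters are pairs of a summand of \<open>N\<close> and a summand of
  \<open>M\<close>, so that different copies of one summand are different letters.\<close>

lemma split_bimodule:
  "split_bimodule K A P (I \<times> I') (\<lambda>(i, k). l i) (\<lambda>(i, k). r' k) (\<lambda>(i, k). gen i k ` carrier B)"
proof -
  interpret bimod A A P by (rule P.bimod_tensor)
  show ?thesis
  proof unfold_locales
    fix j q \<mu>
    assume j: "j \<in> I \<times> I'" "q \<in> (case j of (i, k) \<Rightarrow> gen i k ` carrier B)" "q \<noteq> \<zero>\<^bsub>P\<^esub>"
      and \<mu>: "linear_functional K A \<mu>"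
    then obtain i k v where ik: "j = (i, k)" "i \<in> I" "k \<in> I'" "v \<in> carrier B" "q = gen i k v"
      by auto
    obtain \<Phi> where \<Phi>: "hom_map K A A P \<Phi>"
      "\<And>t. t \<in> carrier A \<Longrightarrow> \<Phi> (gen i k v) t = \<mu> (r' k \<otimes>\<^bsub>A\<^esub> t) \<odot>\<^bsub>A\<^esub> l i"
      "\<And>i' k' v' t. i' \<in> I \<Longrightarrow> k' \<in> I' \<Longrightarrow> v' \<in> carrier B \<Longrightarrow> t \<in> carrier A \<Longrightarrow> (i', k') \<noteq> (i, k) \<Longrightarrow>
        \<Phi> (gen i' k' v') t = \<zero>\<^bsub>A\<^esub>"
      using hom_map_gen[OF ik(2-4) _ \<mu>] j(3) ik(5) by blast
    show "\<exists>\<Phi>. hom_map K A A P \<Phi> \<and>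
        (\<forall>t\<in>carrier A. \<Phi> q t = \<mu> ((case j of (i, k) \<Rightarrow> r' k) \<otimes>\<^bsub>A\<^esub> t) \<odot>\<^bsub>A\<^esub> (case j of (i, k) \<Rightarrow> l i)) \<and>
        (\<forall>j'\<in>I \<times> I'. \<forall>q'\<in>case j' of (i, k) \<Rightarrow> gen i k ` carrier B. \<forall>t\<in>carrier A.
          j' \<noteq> j \<longrightarrow> \<Phi> q' t = \<zero>\<^bsub>A\<^esub>)"
      using \<Phi> ik by (intro exI[of _ \<Phi>]) auto
  next
    fix x p
    assume x: "x \<in> carrier P" "p \<zero>\<^bsub>P\<^esub>"
      and on_gen: "\<And>j q a a'. j \<in> I \<times> I' \<Longrightarrow> q \<in> (case j of (i, k) \<Rightarrow> gen i k ` carrier B) \<Longrightarrow>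
        a \<in> carrier A \<Longrightarrow> a' \<in> carrier A \<Longrightarrow> p (lact P a (ract P q a'))"
      and minus: "\<And>x y. x \<in> carrier P \<Longrightarrow> y \<in> carrier P \<Longrightarrow> p x \<Longrightarrow> p y \<Longrightarrow> p (x \<ominus>\<^bsub>P\<^esub> y)"
    show "p x"
      using x(1)
    proof (induction x rule: gen_induct)
      case (gen i k v a a')
      then show ?case
        by (intro on_gen[of "(i, k)"]) auto
    qed (use x(2) minus in auto)
  qed (auto simp: N.l M.r lact_gen ract_gen)
qed

end

section \<open>Tensor powers and the cyclic action\<close>

abbreviation rot :: "'x list \<Rightarrow> 'x list" where "rot xs \<equiv> last xs # butlast xs"

locale cyclic_power = P: bimod A A P
  for A :: "('a, 'c) ring_scheme" and P :: "('a, 'a, 'p) bimodule" +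
  fixes m :: nat
  assumes m: "m \<ge> 1"
begin

abbreviation gens where "gens \<equiv> power_gens P m"
abbreviation TP where "TP \<equiv> tensor_power A P m"

lemma append_mem_gens:
  "us @ x # vs \<in> gens \<longleftrightarrow> Suc (length us + length vs) = m \<and> set us \<subseteq> carrier P \<and> x \<in> carrier P \<and> set vs \<subseteq> carrier P"
  "x # vs \<in> gens \<longleftrightarrow> Suc (length vs) = m \<and> x \<in> carrier P \<and> set vs \<subseteq> carrier P"
  by (auto simp: power_gens_def)

sublocale presentation gens "power_rels A P m"
proof
  have keys: "Poly_Mapping.keys (u - v) \<subseteq> gens"
    if "Poly_Mapping.keys u \<subseteq> gens" "Poly_Mapping.keys v \<subseteq> gens" for u v :: "'p list \<Rightarrow>\<^sub>0 int"
    using that by (auto dest!: subsetD[OF keys_diff])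
  show "power_rels A P m \<subseteq> carrier (free_Abelian_group gens)"
  proof
    fix rel assume "rel \<in> power_rels A P m"
    then show "rel \<in> carrier (free_Abelian_group gens)"
      unfolding power_rels_def carrier_free_Abelian_group_iff
    proof (elim UnE CollectE exE conjE)
      fix us vs x y
      assume "rel = frag_of (us @ [x \<oplus>\<^bsub>P\<^esub> y] @ vs) - frag_of (us @ [x] @ vs) - frag_of (us @ [y] @ vs)"
        and "us @ [x] @ vs \<in> gens" "y \<in> carrier P"
      then show "Poly_Mapping.keys rel \<subseteq> gens"
        by (simp only:) (intro keys, auto simp: append_mem_gens)
    next
      fix us vs x y a
      assume "rel = frag_of (us @ [ract P x a, y] @ vs) - frag_of (us @ [x, lact P a y] @ vs)"
        and "us @ [x, y] @ vs \<in> gens" "a \<in> carrier A"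
      then show "Poly_Mapping.keys rel \<subseteq> gens"
        by (simp only:) (intro keys, auto simp: append_mem_gens)
    qed
  qed
qed

text \<open>What a function on pure tensors must satisfy to factor through the tensor power. The
  target is written multiplicatively because the presented group, the homology and
  \<open>add_monoid K\<close> all occur as \<open>Z\<close>.\<close>

definition multiadditive :: "('p list \<Rightarrow> 'z) \<Rightarrow> ('z, 'y) monoid_scheme \<Rightarrow> bool" where
  "multiadditive F Z \<longleftrightarrow> (\<forall>ps\<in>gens. F ps \<in> carrier Z) \<and>
     (\<forall>us x y vs. us @ [x] @ vs \<in> gens \<longrightarrow> y \<in> carrier P \<longrightarrow>
        F (us @ [x \<oplus>\<^bsub>P\<^esub> y] @ vs) = F (us @ [x] @ vs) \<otimes>\<^bsub>Z\<^esub> F (us @ [y] @ vs)) \<and>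
     (\<forall>us x y vs a. us @ [x, y] @ vs \<in> gens \<longrightarrow> a \<in> carrier A \<longrightarrow>
        F (us @ [ract P x a, y] @ vs) = F (us @ [x, lact P a y] @ vs))"

text \<open>Stated for every \<open>h\<close> extending \<open>F\<close>, in the form that
  \<open>universal\<close> asks for; the same fact also checks induced maps in
  \<open>presented_map_power\<close>.\<close>

lemma multiadditive_relator:
  assumes Z: "comm_group Z" and F: "multiadditive F Z"
    and h: "h \<in> hom (free_Abelian_group gens) Z" "\<And>ps. ps \<in> gens \<Longrightarrow> h (frag_of ps) = F ps"
    and rel: "rel \<in> power_rels A P m"
  shows "h rel = \<one>\<^bsub>Z\<^esub>"
proof -
  interpret Z: comm_group Z by fact
  interpret h: group_hom "free_Abelian_group gens" Z h
    by unfold_locales (rule h(1))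
  have diff: "h (u - v) = h u \<otimes>\<^bsub>Z\<^esub> inv\<^bsub>Z\<^esub> h v"
    if "Poly_Mapping.keys u \<subseteq> gens" "Poly_Mapping.keys v \<subseteq> gens" for u v
    using h.hom_mult[of u "- v"] h.hom_inv[of v] that by simp
  have keys: "Poly_Mapping.keys (u - v) \<subseteq> gens"
    if "Poly_Mapping.keys u \<subseteq> gens" "Poly_Mapping.keys v \<subseteq> gens" for u v :: "'p list \<Rightarrow>\<^sub>0 int"
    using that by (auto dest!: subsetD[OF keys_diff])
  have Fc: "F ps \<in> carrier Z" if "ps \<in> gens" for ps
    using F that by (simp add: multiadditive_def)
  show ?thesis
    using rel unfolding power_rels_def
  proof (elim UnE CollectE exE conjE)
    fix us vs x y
    assume r: "rel = frag_of (us @ [x \<oplus>\<^bsub>P\<^esub> y] @ vs) - frag_of (us @ [x] @ vs) - frag_of (us @ [y] @ vs)"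
      and g: "us @ [x] @ vs \<in> gens" "y \<in> carrier P"
    then have g': "us @ [x \<oplus>\<^bsub>P\<^esub> y] @ vs \<in> gens" "us @ [y] @ vs \<in> gens"
      by (auto simp: append_mem_gens)
    have "F (us @ [x \<oplus>\<^bsub>P\<^esub> y] @ vs) = F (us @ [x] @ vs) \<otimes>\<^bsub>Z\<^esub> F (us @ [y] @ vs)"
      using F g unfolding multiadditive_def by blast
    then show "h rel = \<one>\<^bsub>Z\<^esub>"
      unfolding r using g g' Fc[OF g(1)] Fc[OF g'(2)]
      by (simp add: diff keys h(2) del: append.simps append_Cons)
        (simp add: Z.m_comm[of "F (us @ [x] @ vs)"] Z.m_assoc del: append.simps append_Cons)
  next
    fix us vs x y a
    assume r: "rel = frag_of (us @ [ract P x a, y] @ vs) - frag_of (us @ [x, lact P a y] @ vs)"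
      and g: "us @ [x, y] @ vs \<in> gens" "a \<in> carrier A"
    then have g': "us @ [ract P x a, y] @ vs \<in> gens" "us @ [x, lact P a y] @ vs \<in> gens"
      by (auto simp: append_mem_gens)
    have "F (us @ [ract P x a, y] @ vs) = F (us @ [x, lact P a y] @ vs)"
      using F g unfolding multiadditive_def by blast
    then show "h rel = \<one>\<^bsub>Z\<^esub>"
      unfolding r using g' Fc[OF g'(2)]
      by (simp add: diff h(2) del: append.simps append_Cons)
  qed
qed

lemma power_universal:
  assumes Z: "comm_group Z" and F: "multiadditive F Z"
  obtains h where "h \<in> hom PG Z" "\<And>ps. ps \<in> gens \<Longrightarrow> h (cls (frag_of ps)) = F ps"
  using universal[OF Z, of F] multiadditive_relator[OF Z F] F
  by (metis (no_types, lifting) image_subsetI multiadditive_def)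

lemma multiadditive_cls: "multiadditive (\<lambda>ps. cls (frag_of ps)) PG"
  unfolding multiadditive_def
proof (intro conjI ballI allI impI)
  fix us x y vs assume *: "us @ [x] @ vs \<in> gens" "y \<in> carrier P"
  show "cls (frag_of (us @ [x \<oplus>\<^bsub>P\<^esub> y] @ vs)) = cls (frag_of (us @ [x] @ vs)) \<otimes>\<^bsub>PG\<^esub> cls (frag_of (us @ [y] @ vs))"
  proof (rule cls_generator_add)
    show "frag_of (us @ [x \<oplus>\<^bsub>P\<^esub> y] @ vs) - frag_of (us @ [x] @ vs) - frag_of (us @ [y] @ vs) \<in> power_rels A P m"
      unfolding power_rels_def using * by blast
  qed (use * in \<open>auto simp: append_mem_gens\<close>)
next
  fix us x y vs a assume *: "us @ [x, y] @ vs \<in> gens" "a \<in> carrier A"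
  show "cls (frag_of (us @ [ract P x a, y] @ vs)) = cls (frag_of (us @ [x, lact P a y] @ vs))"
  proof (rule cls_generator_cong)
    show "frag_of (us @ [ract P x a, y] @ vs) - frag_of (us @ [x, lact P a y] @ vs) \<in> power_rels A P m"
      unfolding power_rels_def using * by blast
  qed (use * in \<open>auto simp: append_mem_gens\<close>)
qed simp

lemma power_simps: "carrier TP = carrier PG" "\<zero>\<^bsub>TP\<^esub> = \<one>\<^bsub>PG\<^esub>" "T \<oplus>\<^bsub>TP\<^esub> T' = T \<otimes>\<^bsub>PG\<^esub> T'"
    "T \<ominus>\<^bsub>TP\<^esub> T' = T \<otimes>\<^bsub>PG\<^esub> inv\<^bsub>PG\<^esub> T'"
  unfolding a_minus_def a_inv_def m_inv_def by (simp_all add: tensor_power_def Let_def)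

lemma hom_power: "hom (add_monoid TP) G = hom PG G" "hom G (add_monoid TP) = hom G PG"
  by (simp_all add: hom_def power_simps)

lemma comm_group_TP: "comm_group (add_monoid TP)"
  by (rule comm_group_cong[OF PG.comm_group_axioms]) (simp_all add: power_simps fun_eq_iff)

sublocale TP: abelian_group TP
  using comm_group_TP by (rule comm_group_abelian_groupI)

text \<open>Well-definedness of a map given on lists of factors reduces to multiadditivity of the
  resulting class, so that relators need not be handled again for each action.\<close>

lemma presented_map_power:
  assumes \<phi>: "\<And>ps. ps \<in> gens \<Longrightarrow> \<phi> ps \<in> gens" and F: "multiadditive (\<lambda>ps. cls (frag_of (\<phi> ps))) PG"
  shows "abelian_group_hom TP TP (presented_map gens (power_rels A P m) \<phi>)"
    and "ps \<in> gens \<Longrightarrow> presented_map gens (power_rels A P m) \<phi> (cls (frag_of ps)) = cls (frag_of (\<phi> ps))"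
proof -
  have "(\<lambda>u. cls (frag_extend (frag_of \<circ> \<phi>) u)) \<in> hom (free_Abelian_group gens) PG"
    by (rule homI) (auto simp: frag_extend_frag_of_keys[OF \<phi>] frag_extend_add cls_add)
  then have "cls (frag_extend (frag_of \<circ> \<phi>) r) = \<one>\<^bsub>PG\<^esub>" if "r \<in> power_rels A P m" for r
    using multiadditive_relator[OF PG.comm_group_axioms F _ _ that] by simp
  note mp = presented_map_cls[OF \<phi> this]
  show "abelian_group_hom TP TP (presented_map gens (power_rels A P m) \<phi>)"
    using mp(2) by (intro abelian_group_hom_of_hom TP.abelian_group_axioms) (simp add: hom_power)
  show "presented_map gens (power_rels A P m) \<phi> (cls (frag_of ps)) = cls (frag_of (\<phi> ps))" if "ps \<in> gens"
    using mp(1)[of "frag_of ps"] that by simp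
qed

lemma gens_not_Nil: "ps \<in> gens \<Longrightarrow> ps \<noteq> []"
  using m by (auto simp: power_gens_def)

lemma multiadditive_add: "multiadditive F Z \<Longrightarrow> us @ x # vs \<in> gens \<Longrightarrow> y \<in> carrier P \<Longrightarrow>
    F (us @ (x \<oplus>\<^bsub>P\<^esub> y) # vs) = F (us @ x # vs) \<otimes>\<^bsub>Z\<^esub> F (us @ y # vs)"
  by (simp add: multiadditive_def)

lemma multiadditive_balanced: "multiadditive F Z \<Longrightarrow> us @ x # y # vs \<in> gens \<Longrightarrow> a \<in> carrier A \<Longrightarrow>
    F (us @ ract P x a # y # vs) = F (us @ x # lact P a y # vs)"
  by (simp add: multiadditive_def)

lemma multiadditiveI:
  assumes "\<And>ps. ps \<in> gens \<Longrightarrow> F ps \<in> carrier Z"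
    and "\<And>us x y vs. us @ x # vs \<in> gens \<Longrightarrow> y \<in> carrier P \<Longrightarrow>
      F (us @ (x \<oplus>\<^bsub>P\<^esub> y) # vs) = F (us @ x # vs) \<otimes>\<^bsub>Z\<^esub> F (us @ y # vs)"
    and "\<And>us x y vs a. us @ x # y # vs \<in> gens \<Longrightarrow> a \<in> carrier A \<Longrightarrow>
      F (us @ ract P x a # y # vs) = F (us @ x # lact P a y # vs)"
  shows "multiadditive F Z"
  using assms by (simp add: multiadditive_def)

text \<open>The action touches only the first factor. If the slot being varied is the first one, the
  bimodule laws for \<open>lact\<close> are needed; otherwise the acted-on factor is a bystander.
  This is the distinction made by \<open>cases us\<close>.\<close>

lemma lact_power:
  assumes a: "a \<in> carrier A"
  shows "abelian_group_hom TP TP (lact TP a)"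
    and "ps \<in> gens \<Longrightarrow> lact TP a (cls (frag_of ps)) = cls (frag_of (lact P a (hd ps) # tl ps))"
proof -
  have eq: "lact TP a = presented_map gens (power_rels A P m) (\<lambda>ps. lact P a (hd ps) # tl ps)"
    by (simp add: tensor_power_def Let_def)
  have closed: "lact P a (hd ps) # tl ps \<in> gens" if "ps \<in> gens" for ps
    using that gens_not_Nil[OF that] a by (cases ps) (auto simp: append_mem_gens)
  have "multiadditive (\<lambda>ps. cls (frag_of (lact P a (hd ps) # tl ps))) PG"
  proof (rule multiadditiveI)
    fix us x y vs assume *: "us @ x # vs \<in> gens" "y \<in> carrier P"
    then show "cls (frag_of (lact P a (hd (us @ (x \<oplus>\<^bsub>P\<^esub> y) # vs)) # tl (us @ (x \<oplus>\<^bsub>P\<^esub> y) # vs))) =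
        cls (frag_of (lact P a (hd (us @ x # vs)) # tl (us @ x # vs))) \<otimes>\<^bsub>PG\<^esub>
        cls (frag_of (lact P a (hd (us @ y # vs)) # tl (us @ y # vs)))"
      using a multiadditive_add[OF multiadditive_cls, of "[]" "lact P a x" vs "lact P a y"]
        multiadditive_add[OF multiadditive_cls, of "lact P a (hd us) # tl us" x vs y]
      by (cases us) (auto simp: append_mem_gens P.lact_add)
  next
    fix us x y vs b assume *: "us @ x # y # vs \<in> gens" "b \<in> carrier A"
    then show "cls (frag_of (lact P a (hd (us @ ract P x b # y # vs)) # tl (us @ ract P x b # y # vs))) =
        cls (frag_of (lact P a (hd (us @ x # lact P b y # vs)) # tl (us @ x # lact P b y # vs)))"
      using a multiadditive_balanced[OF multiadditive_cls, of "[]" "lact P a x" y vs b]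
        multiadditive_balanced[OF multiadditive_cls, of "lact P a (hd us) # tl us" x y vs b]
      by (cases us) (auto simp: append_mem_gens P.lact_ract)
  qed (simp add: closed)
  from presented_map_power[OF closed this]
  show "abelian_group_hom TP TP (lact TP a)"
    "ps \<in> gens \<Longrightarrow> lact TP a (cls (frag_of ps)) = cls (frag_of (lact P a (hd ps) # tl ps))"
    unfolding eq by auto
qed

text \<open>The mirror image of \<open>lact_power\<close>: now the last factor is special, hence the
  case split from the right end of \<open>vs\<close>.\<close>

lemma ract_power:
  assumes a: "a \<in> carrier A"
  shows "abelian_group_hom TP TP (\<lambda>T. ract TP T a)"
    and "ps \<in> gens \<Longrightarrow> ract TP (cls (frag_of ps)) a = cls (frag_of (butlast ps @ [ract P (last ps) a]))"
proof -
  have eq: "ract TP T a = presented_map gens (power_rels A P m) (\<lambda>ps. butlast ps @ [ract P (last ps) a]) T" for T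
    by (simp add: tensor_power_def Let_def)
  have closed: "butlast ps @ [ract P (last ps) a] \<in> gens" if "ps \<in> gens" for ps
    using that gens_not_Nil[OF that] a by (cases ps rule: rev_cases) (auto simp: append_mem_gens)
  have "multiadditive (\<lambda>ps. cls (frag_of (butlast ps @ [ract P (last ps) a]))) PG"
  proof (rule multiadditiveI)
    fix us x y vs assume *: "us @ x # vs \<in> gens" "y \<in> carrier P"
    then show "cls (frag_of (butlast (us @ (x \<oplus>\<^bsub>P\<^esub> y) # vs) @ [ract P (last (us @ (x \<oplus>\<^bsub>P\<^esub> y) # vs)) a])) =
        cls (frag_of (butlast (us @ x # vs) @ [ract P (last (us @ x # vs)) a])) \<otimes>\<^bsub>PG\<^esub>
        cls (frag_of (butlast (us @ y # vs) @ [ract P (last (us @ y # vs)) a]))"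
      using a multiadditive_add[OF multiadditive_cls, of us "ract P x a" "[]" "ract P y a"]
        multiadditive_add[OF multiadditive_cls, of us x "butlast vs @ [ract P (last vs) a]" y]
      by (cases vs rule: rev_cases) (auto simp: append_mem_gens P.ract_add butlast_append)
  next
    fix us x y vs b assume *: "us @ x # y # vs \<in> gens" "b \<in> carrier A"
    then show "cls (frag_of (butlast (us @ ract P x b # y # vs) @ [ract P (last (us @ ract P x b # y # vs)) a])) =
        cls (frag_of (butlast (us @ x # lact P b y # vs) @ [ract P (last (us @ x # lact P b y # vs)) a]))"
      using a multiadditive_balanced[OF multiadditive_cls, of us x "ract P y a" "[]" b]
        multiadditive_balanced[OF multiadditive_cls, of us x y "butlast vs @ [ract P (last vs) a]" b]
      by (cases vs rule: rev_cases) (auto simp: append_mem_gens P.lact_ract butlast_append)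
  qed (simp add: closed)
  from presented_map_power[OF closed this]
  show "abelian_group_hom TP TP (\<lambda>T. ract TP T a)"
    "ps \<in> gens \<Longrightarrow> ract TP (cls (frag_of ps)) a = cls (frag_of (butlast ps @ [ract P (last ps) a]))"
    unfolding eq by auto
qed

section \<open>The homology group of a tensor power and its universal property\<close>

abbreviation H where "H \<equiv> H0 A TP"
abbreviation comms where "comms \<equiv> commutator_subgroup A TP"
abbreviation \<kappa> where "\<kappa> \<equiv> H0_class A TP"
definition C :: "'p list \<Rightarrow> ('p list \<Rightarrow>\<^sub>0 int) set set" where "C ps = \<kappa> (cls (frag_of ps))"

lemma commutator_closed:
  "a \<in> carrier A \<Longrightarrow> z \<in> carrier TP \<Longrightarrow> lact TP a z \<ominus>\<^bsub>TP\<^esub> ract TP z a \<in> carrier TP"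
  using abelian_group_hom.hom_closed[OF lact_power(1), of a z]
    abelian_group_hom.hom_closed[OF ract_power(1), of a z] by simp

lemma subgroup_comms: "subgroup comms (add_monoid TP)"
  unfolding commutator_subgroup_def
  by (rule group.generate_is_subgroup[OF TP.a_group]) (use commutator_closed in auto)

lemma normal_comms: "normal comms (add_monoid TP)"
  by (rule comm_group.normal_iff_subgroup[OF comm_group_TP, THEN iffD2, OF subgroup_comms])

lemma H_def: "H = add_monoid TP Mod comms" and \<kappa>_def: "\<kappa> z = comms #>\<^bsub>add_monoid TP\<^esub> z"
  by (simp_all add: H0_def A_FactGroup_def H0_class_def a_r_coset_def)

sublocale H: comm_group H
  unfolding H_def by (rule comm_group.abelian_FactGroup[OF comm_group_TP subgroup_comms])

lemma carrier_H: "carrier H = \<kappa> ` carrier TP"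
  unfolding H_def \<kappa>_def by (simp add: carrier_FactGroup)

lemma \<kappa>_hom: "\<kappa> \<in> hom (add_monoid TP) H"
  unfolding H_def \<kappa>_def[abs_def] by (rule normal.r_coset_hom_Mod[OF normal_comms])

lemma \<kappa>_group_hom: "group_hom (add_monoid TP) H \<kappa>"
  by (simp add: group_hom_def group_hom_axioms_def \<kappa>_hom TP.a_group H.is_group)

lemma power_induct [consumes 1, case_names zero gen minus]:
  assumes "T \<in> carrier TP" "p \<zero>\<^bsub>TP\<^esub>" "\<And>ps. ps \<in> gens \<Longrightarrow> p (cls (frag_of ps))"
    "\<And>T T'. T \<in> carrier TP \<Longrightarrow> T' \<in> carrier TP \<Longrightarrow> p T \<Longrightarrow> p T' \<Longrightarrow> p (T \<ominus>\<^bsub>TP\<^esub> T')"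
  shows "p T"
  using assms unfolding power_simps by (induction T rule: PG_induct) auto

lemma cls_frag_closed: "ps \<in> gens \<Longrightarrow> cls (frag_of ps) \<in> carrier TP"
  by (simp add: power_simps)

lemma C_closed [simp]: "ps \<in> gens \<Longrightarrow> C ps \<in> carrier H"
  unfolding C_def carrier_H by (intro imageI cls_frag_closed)

lemma \<kappa>_minus:
  "x \<in> carrier TP \<Longrightarrow> y \<in> carrier TP \<Longrightarrow> \<kappa> (x \<ominus>\<^bsub>TP\<^esub> y) = \<kappa> x \<otimes>\<^bsub>H\<^esub> inv\<^bsub>H\<^esub> \<kappa> y"
  using group_hom.hom_mult[OF \<kappa>_group_hom, of x "\<ominus>\<^bsub>TP\<^esub> y"] group_hom.hom_inv[OF \<kappa>_group_hom, of y]
  by (simp add: a_minus_def a_inv_def[symmetric])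

lemma \<kappa>_zero: "\<kappa> \<zero>\<^bsub>TP\<^esub> = \<one>\<^bsub>H\<^esub>"
  using group_hom.hom_one[OF \<kappa>_group_hom] by simp

lemma \<kappa>_comms: "n \<in> comms \<Longrightarrow> \<kappa> n = \<one>\<^bsub>H\<^esub>"
  using group.coset_join2[OF TP.a_group _ subgroup_comms, of n] subgroup.mem_carrier[OF subgroup_comms]
  by (simp add: H_def \<kappa>_def)

lemma multiadditive_C: "multiadditive C H"
proof (rule multiadditiveI)
  fix us x y vs assume *: "us @ x # vs \<in> gens" "y \<in> carrier P"
  then have "us @ y # vs \<in> gens" by (simp add: append_mem_gens)
  then show "C (us @ (x \<oplus>\<^bsub>P\<^esub> y) # vs) = C (us @ x # vs) \<otimes>\<^bsub>H\<^esub> C (us @ y # vs)"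
    unfolding C_def multiadditive_add[OF multiadditive_cls *]
    using hom_mult[OF \<kappa>_hom, of "cls (frag_of (us @ x # vs))" "cls (frag_of (us @ y # vs))"] *
    by (simp add: cls_frag_closed power_simps)
next
  fix us x y vs a assume "us @ x # y # vs \<in> gens" "a \<in> carrier A"
  then show "C (us @ ract P x a # y # vs) = C (us @ x # lact P a y # vs)"
    by (simp add: C_def multiadditive_balanced[OF multiadditive_cls])
qed simp

lemmas C_add = multiadditive_add[OF multiadditive_C]
lemmas C_balanced = multiadditive_balanced[OF multiadditive_C]

lemma C_cyclic:
  assumes "ps \<in> gens" "a \<in> carrier A"
  shows "C (lact P a (hd ps) # tl ps) = C (butlast ps @ [ract P (last ps) a])"
proof -
  let ?z = "cls (frag_of ps)"
  have z: "?z \<in> carrier TP"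
    using assms(1) by (rule cls_frag_closed)
  have c: "lact TP a ?z \<in> carrier TP" "ract TP ?z a \<in> carrier TP"
    using abelian_group_hom.hom_closed[OF lact_power(1)[OF assms(2)] z]
      abelian_group_hom.hom_closed[OF ract_power(1)[OF assms(2)] z] by auto
  have "lact TP a ?z \<ominus>\<^bsub>TP\<^esub> ract TP ?z a \<in> comms"
    unfolding commutator_subgroup_def using assms(2) z by (intro generate.incl) blast
  then have "\<kappa> (lact TP a ?z) \<otimes>\<^bsub>H\<^esub> inv\<^bsub>H\<^esub> \<kappa> (ract TP ?z a) = \<one>\<^bsub>H\<^esub>"
    using c by (simp add: \<kappa>_comms flip: \<kappa>_minus)
  moreover have "\<kappa> (lact TP a ?z) \<in> carrier H" "\<kappa> (ract TP ?z a) \<in> carrier H"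
    using c by (auto simp: carrier_H)
  ultimately have "\<kappa> (lact TP a ?z) = \<kappa> (ract TP ?z a)"
    by (simp add: H.inv_solve_right')
  then show ?thesis
    using assms by (simp add: C_def lact_power(2) ract_power(2))
qed

text \<open>Besides multiadditivity, a homomorphism out of the homology needs balancedness between
  the last and the first factor. The commutator relation for arbitrary \<open>z\<close> follows from
  that for pure tensors, because both actions are additive.\<close>

lemma H_universal:
  assumes Z: "comm_group Z" and F: "multiadditive F Z"
    and cyclic: "\<And>ps a. ps \<in> gens \<Longrightarrow> a \<in> carrier A \<Longrightarrow>
      F (lact P a (hd ps) # tl ps) = F (butlast ps @ [ract P (last ps) a])"
  obtains h where "h \<in> hom H Z" "\<And>ps. ps \<in> gens \<Longrightarrow> h (C ps) = F ps"
proof -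
  interpret Z: comm_group Z by fact
  obtain g where g: "g \<in> hom PG Z" "\<And>ps. ps \<in> gens \<Longrightarrow> g (cls (frag_of ps)) = F ps"
    using power_universal[OF Z F] by blast
  interpret g: group_hom PG Z g by unfold_locales (rule g(1))
  interpret g': group_hom "add_monoid TP" Z g
    using g(1) by (simp add: group_hom_def group_hom_axioms_def hom_power TP.a_group Z.is_group)
  have g_minus: "g (x \<ominus>\<^bsub>TP\<^esub> y) = g x \<otimes>\<^bsub>Z\<^esub> inv\<^bsub>Z\<^esub> g y" if "x \<in> carrier TP" "y \<in> carrier TP" for x y
    using that by (simp add: power_simps)
  have actions: "lact TP a z \<in> carrier TP" "ract TP z a \<in> carrier TP" if "a \<in> carrier A" "z \<in> carrier TP" for a z
    using abelian_group_hom.hom_closed[OF lact_power(1)[OF that(1)] that(2)]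
      abelian_group_hom.hom_closed[OF ract_power(1)[OF that(1)] that(2)] by auto
  have g_cyclic: "g (lact TP a z) = g (ract TP z a)" if a: "a \<in> carrier A" and z: "z \<in> carrier TP" for a z
    using z
  proof (induction z rule: power_induct)
    case zero
    then show ?case
      using abelian_group_hom.hom_zero[OF lact_power(1)[OF a]]
        abelian_group_hom.hom_zero[OF ract_power(1)[OF a]] by simp
  next
    case (gen ps)
    have "lact P a (hd ps) # tl ps \<in> gens"
      using gen gens_not_Nil[OF gen] a by (cases ps) (auto simp: append_mem_gens)
    moreover have "butlast ps @ [ract P (last ps) a] \<in> gens"
      using gen gens_not_Nil[OF gen] a by (cases ps rule: rev_cases) (auto simp: append_mem_gens)
    ultimately have closed: "lact P a (hd ps) # tl ps \<in> gens" "butlast ps @ [ract P (last ps) a] \<in> gens"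
      by auto
    then show ?case
      using gen a by (simp add: lact_power(2) ract_power(2) g(2) cyclic)
  next
    case (minus T T')
    then show ?case
      using abelian_group_hom.hom_minus[OF lact_power(1)[OF a]]
        abelian_group_hom.hom_minus[OF ract_power(1)[OF a]] a by (simp add: g_minus actions)
  qed
  have "{lact TP a z \<ominus>\<^bsub>TP\<^esub> ract TP z a | a z. a \<in> carrier A \<and> z \<in> carrier TP} \<subseteq>
      kernel (add_monoid TP) Z g"
    using g'.hom_closed by (auto simp: kernel_def commutator_closed g_minus actions g_cyclic)
  then have "comms \<subseteq> kernel (add_monoid TP) Z g"
    unfolding commutator_subgroup_def
    by (rule group.generate_subgroup_incl[OF TP.a_group _ g'.subgroup_kernel])
  then have ker: "g n = \<one>\<^bsub>Z\<^esub>" if "n \<in> comms" for n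
    using that by (auto simp: kernel_def)
  have eq: "g x = g y" if "x \<in> carrier (add_monoid TP)" "y \<in> carrier (add_monoid TP)"
    "comms #>\<^bsub>add_monoid TP\<^esub> x = comms #>\<^bsub>add_monoid TP\<^esub> y" for x y
  proof -
    have "x \<in> comms #>\<^bsub>add_monoid TP\<^esub> y"
      using group.rcos_self[OF TP.a_group that(1) subgroup_comms] that(3) by simp
    then obtain n where n: "n \<in> comms" "x = n \<otimes>\<^bsub>add_monoid TP\<^esub> y"
      by (auto simp: r_coset_def)
    have nc: "n \<in> carrier (add_monoid TP)"
      using subgroup.mem_carrier[OF subgroup_comms n(1)] .
    have "g x = g n \<otimes>\<^bsub>Z\<^esub> g y"
      unfolding n(2) by (rule g'.hom_mult[OF nc that(2)])
    then show ?thesis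
      using ker[OF n(1)] g'.hom_closed[OF that(2)] by simp
  qed
  obtain h where "h \<in> hom H Z" "\<And>x. x \<in> carrier (add_monoid TP) \<Longrightarrow> h (\<kappa> x) = g x"
    using FactGroup_universal[OF g'.homh normal_comms eq] unfolding H_def \<kappa>_def by blast
  then show thesis
    by (intro that[of h]) (simp_all add: C_def g(2) cls_frag_closed)
qed

lemma H_induct [consumes 1, case_names one gen div]:
  assumes x: "x \<in> carrier H" and "p \<one>\<^bsub>H\<^esub>" "\<And>ps. ps \<in> gens \<Longrightarrow> p (C ps)"
    "\<And>x y. x \<in> carrier H \<Longrightarrow> y \<in> carrier H \<Longrightarrow> p x \<Longrightarrow> p y \<Longrightarrow> p (x \<otimes>\<^bsub>H\<^esub> inv\<^bsub>H\<^esub> y)"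
  shows "p x"
proof -
  obtain z where z: "z \<in> carrier TP" "x = \<kappa> z"
    using x by (auto simp: carrier_H)
  have "p (\<kappa> z)"
    using z(1) by (induction z rule: power_induct) (use assms in \<open>auto simp: C_def \<kappa>_zero \<kappa>_minus carrier_H\<close>)
  then show ?thesis using z by simp
qed

section \<open>The cyclic shift on homology\<close>

lemma rot_gens: "ps \<in> gens \<Longrightarrow> rot ps \<in> gens"
  using gens_not_Nil[of ps] by (cases ps rule: rev_cases) (auto simp: power_gens_def)

text \<open>Rotation keeps neighbours adjacent, except that a balanced pair at the right end is torn
  apart: its second member becomes the first factor and its first member the last. There
  balancedness turns into the commutator relation \<open>C_cyclic\<close>.\<close>

lemma multiadditive_C_rot: "multiadditive (\<lambda>ps. C (rot ps)) H"
proof (rule multiadditiveI)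
  fix us x y vs assume *: "us @ x # vs \<in> gens" "y \<in> carrier P"
  then show "C (rot (us @ (x \<oplus>\<^bsub>P\<^esub> y) # vs)) = C (rot (us @ x # vs)) \<otimes>\<^bsub>H\<^esub> C (rot (us @ y # vs))"
    using C_add[of "[]" x us y] C_add[of "last vs # us" x "butlast vs" y]
    by (cases vs rule: rev_cases) (auto simp: append_mem_gens butlast_append)
next
  fix us x y vs a assume *: "us @ x # y # vs \<in> gens" "a \<in> carrier A"
  then show "C (rot (us @ ract P x a # y # vs)) = C (rot (us @ x # lact P a y # vs))"
    using C_cyclic[of "y # us @ [x]" a] C_balanced[of "last vs # us" x y "butlast vs" a]
    by (cases vs rule: rev_cases) (auto simp: append_mem_gens butlast_append)
qed (simp add: rot_gens)

text \<open>Conversely, rotation makes the last and the first factor adjacent, so the commutator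
  relation becomes ordinary balancedness. With a single factor rotation does nothing and the
  relation is kept.\<close>

lemma C_rot_cyclic:
  assumes ps: "ps \<in> gens" and a: "a \<in> carrier A"
  shows "C (rot (lact P a (hd ps) # tl ps)) = C (rot (butlast ps @ [ract P (last ps) a]))"
proof (cases ps)
  case (Cons x qs)
  show ?thesis
  proof (cases qs rule: rev_cases)
    case Nil
    then show ?thesis using C_cyclic[OF ps a] Cons by simp
  next
    case (snoc rs y)
    then show ?thesis
      using C_balanced[of "[]" y x rs a] ps a Cons by (simp add: append_mem_gens)
  qed
qed (use gens_not_Nil[OF ps] in simp)

text \<open>The universal property gives a homomorphism \<open>h\<close> with the right values on
  pure tensors. It then remains to see that the double union of the definition runs over copies of
  \<open>h c\<close>.\<close>

lemma cyclic_shift: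
  "cyclic_shift A P m \<in> hom H H" and cyclic_shift_C: "ps \<in> gens \<Longrightarrow> cyclic_shift A P m (C ps) = C (rot ps)"
proof -
  obtain h where h: "h \<in> hom H H" "\<And>ps. ps \<in> gens \<Longrightarrow> h (C ps) = C (rot ps)"
    using H_universal[OF H.comm_group_axioms multiadditive_C_rot C_rot_cyclic] by blast
  interpret h: group_hom H H h by unfold_locales (rule h(1))
  have h_cls: "h (\<kappa> (cls u)) = \<kappa> (cls (frag_extend (frag_of \<circ> rot) u))" if "Poly_Mapping.keys u \<subseteq> gens" for u
    using that
  proof (induction u rule: free_Abelian_group_induct[consumes 1])
    case 1
    then show ?case
      by (simp add: cls_zero \<kappa>_zero flip: power_simps)
  next
    case (2 u v)
    have ku: "Poly_Mapping.keys (frag_extend (frag_of \<circ> rot) u) \<subseteq> gens" if "Poly_Mapping.keys u \<subseteq> gens" for u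
      using rot_gens that by (rule frag_extend_frag_of_keys)
    have diff: "\<kappa> (cls (u - v)) = \<kappa> (cls u) \<otimes>\<^bsub>H\<^esub> inv\<^bsub>H\<^esub> \<kappa> (cls v)" and mem: "\<kappa> (cls u) \<in> carrier H"
      if "Poly_Mapping.keys u \<subseteq> gens" "Poly_Mapping.keys v \<subseteq> gens" for u v
      using that \<kappa>_minus[of "cls u" "cls v"] by (simp_all add: power_simps cls_diff carrier_H)
    show ?case
    proof -
      have "h (\<kappa> (cls (u - v))) = h (\<kappa> (cls u)) \<otimes>\<^bsub>H\<^esub> inv\<^bsub>H\<^esub> h (\<kappa> (cls v))"
        using diff[OF 2(1,2)] mem[OF 2(1,1)] mem[OF 2(2,2)] by simp
      also have "\<dots> = \<kappa> (cls (frag_extend (frag_of \<circ> rot) (u - v)))"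
        unfolding 2(3,4) frag_extend_diff using diff[OF ku[OF 2(1)] ku[OF 2(2)]] by (rule sym)
      finally show ?thesis .
    qed
  next
    case (3 ps)
    then show ?case using h(2)[of ps] by (simp add: C_def)
  qed
  have eq: "cyclic_shift A P m c = h c" if c: "c \<in> carrier H" for c
  proof -
    obtain u0 where u0: "Poly_Mapping.keys u0 \<subseteq> gens" "c = \<kappa> (cls u0)"
      using c by (auto simp: carrier_H power_simps carrier_PG)
    \<comment> \<open>Every representative taken through both layers of cosets has class
      \<open>c\<close>, so \<open>h_cls\<close> gives the same value for each; the representative
      \<open>u0\<close> shows below that there is at least one.\<close>
    have "\<kappa> (cls (frag_extend (frag_of \<circ> rot) u)) = h c" if "T \<in> c" "u \<in> T" for T u
    proof -
      have z0: "cls u0 \<in> carrier (add_monoid TP)"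
        using u0 by (simp add: power_simps)
      have "T \<in> carrier (add_monoid TP)"
        using monoid.r_coset_subset_G[OF group.is_monoid[OF TP.a_group] subgroup.subset[OF subgroup_comms] z0] that(1)
        unfolding u0(2) \<kappa>_def by blast
      then obtain v where v: "Poly_Mapping.keys v \<subseteq> gens" "T = cls v"
        by (auto simp: power_simps carrier_PG)
      have "\<kappa> T = c"
        using group.repr_independence[OF TP.a_group _ z0 subgroup_comms, of T] that(1) u0(2) by (simp add: \<kappa>_def)
      have kv: "v \<in> carrier (free_Abelian_group gens)"
        using v by simp
      have "u \<in> carrier (free_Abelian_group gens)"
        using free.r_coset_subset_G[OF relators.subset kv] that(2) v(2)
        unfolding presented_class_def by blast
      then have "Poly_Mapping.keys u \<subseteq> gens"
        by simp
      moreover have "cls u = T"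
        using free.repr_independence[OF _ kv subgroup_relators, of u] that(2) v(2)
        by (simp add: presented_class_def)
      ultimately show ?thesis
        using h_cls[of u] \<open>\<kappa> T = c\<close> by simp
    qed
    moreover have "u0 \<in> cls u0"
      using free.rcos_self[OF _ subgroup_relators, of u0] u0 by (simp add: presented_class_def)
    moreover have "cls u0 \<in> c"
      using group.rcos_self[OF TP.a_group _ subgroup_comms, of "cls u0"] cls_closed[OF u0(1)]
      unfolding u0(2) \<kappa>_def by (simp add: power_simps)
    ultimately have "(\<Union>T\<in>c. \<Union>u\<in>T. \<kappa> (cls (frag_extend (frag_of \<circ> rot) u))) = h c"
      by blast
    then show ?thesis
      unfolding cyclic_shift_def .
  qed
  show "cyclic_shift A P m \<in> hom H H"
    using h.homh by (auto simp: hom_def eq Pi_iff)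
  show "cyclic_shift A P m (C ps) = C (rot ps)" if "ps \<in> gens"
    using that by (simp add: eq h(2))
qed

end

section \<open>Invariants from closed walks\<close>

lemma hom_finprod:
  assumes "comm_group G" "comm_group H" "h \<in> hom G H" "finite I" "z \<in> I \<rightarrow> carrier G"
  shows "h (finprod G z I) = finprod H (\<lambda>i. h (z i)) I"
proof -
  interpret G: comm_group G by fact
  interpret H: comm_group H by fact
  interpret group_hom G H h by unfold_locales (rule assms)
  show ?thesis
    using assms(4,5) by (induction I rule: finite_induct) (auto simp: Pi_iff G.finprod_insert H.finprod_insert)
qed

text \<open>The leftmost factor acts last. Recursion is on the maps alone, so the factors are read
  with \<open>hd\<close> and \<open>tl\<close>, and equality of the lengths is a hypothesis of the
  lemmas.\<close>

primrec compose_maps :: "('p \<Rightarrow> 'a \<Rightarrow> 'a) list \<Rightarrow> 'p list \<Rightarrow> 'a \<Rightarrow> 'a" where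
  "compose_maps [] ps t = t"
| "compose_maps (\<Phi> # \<Phi>s) ps t = \<Phi> (hd ps) (compose_maps \<Phi>s (tl ps) t)"

lemma rot_rotate1: "ps \<noteq> [] \<Longrightarrow> last (rotate1 ps) # butlast (rotate1 ps) = ps"
  by (cases ps) (simp_all add: butlast_append)

text \<open>The list of cyclically consecutive pairs of a rotated word is the rotated list of pairs.
  Both the stability of closed walks and the action of the shift on the chosen elements rest on
  this.\<close>

lemma zip_rotate1_rot:
  assumes "ps \<noteq> []"
  shows "zip (last ps # butlast ps) (rotate1 (last ps # butlast ps)) =
    last (zip ps (rotate1 ps)) # butlast (zip ps (rotate1 ps))"
proof -
  obtain us x where ps: "ps = us @ [x]"
    using assms by (cases ps rule: rev_cases) auto
  show ?thesis
  proof (cases us)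
    case Nil
    then show ?thesis by (simp add: ps)
  next
    case (Cons u us')
    have "zip (us @ [x]) (rotate1 (us @ [x])) = zip us (us' @ [x]) @ [(x, u)]"
      using zip_append[of us "us' @ [x]" "[x]" "[u]"] Cons by simp
    moreover have "zip (x # us) (us @ [x]) = (x, u) # zip us (us' @ [x])"
      using Cons by simp
    ultimately show ?thesis by (simp add: ps)
  qed
qed

section \<open>Traces of composites as functionals on homology\<close>

locale cyclic_split = SB: split_bimodule K A P J f e Q + DB: dual_basis K A S \<delta> + cyclic_power A P m
  for K :: "('k, 'c) ring_scheme" and A :: "('k, 'a, 'd) module_scheme"
    and P :: "('a, 'a, 'p) bimodule" and J :: "'j set" and f e Q S \<delta> m
begin

sublocale AA: alg_pair K A A
  by unfold_locales

lemma left_mult_linear: "a \<in> carrier A \<Longrightarrow> linear_map K A A (\<lambda>t. a \<otimes>\<^bsub>A\<^esub> t)"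
  by (simp add: linear_map_def SB.A.r_distr SB.A.smult_assoc_right)

abbreviation hom_maps where "hom_maps \<Phi>s \<equiv> \<forall>\<Phi>\<in>set \<Phi>s. hom_map K A A P \<Phi>"

lemma compose_linear:
  "hom_maps \<Phi>s \<Longrightarrow> length ps = length \<Phi>s \<Longrightarrow> set ps \<subseteq> carrier P \<Longrightarrow> linear_map K A A (compose_maps \<Phi>s ps)"
proof (induction \<Phi>s arbitrary: ps)
  case Nil
  then show ?case by (simp add: linear_map_def)
next
  case (Cons \<Phi> \<Phi>s)
  then obtain p ps' where ps: "ps = p # ps'"
    by (cases ps) auto
  have "linear_map K A A (compose_maps \<Phi>s ps')" "linear_map K A A (\<Phi> p)"
    using Cons ps by (auto simp: hom_map_def)
  then show ?case
    using linear_map_comp by (fastforce simp: ps)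
qed

lemma compose_closed:
  "hom_maps \<Phi>s \<Longrightarrow> length ps = length \<Phi>s \<Longrightarrow> set ps \<subseteq> carrier P \<Longrightarrow> t \<in> carrier A \<Longrightarrow>
    compose_maps \<Phi>s ps t \<in> carrier A"
  using compose_linear[of \<Phi>s ps] by (simp add: linear_map_def)

lemma compose_add:
  "hom_maps \<Phi>s \<Longrightarrow> Suc (length us + length vs) = length \<Phi>s \<Longrightarrow> set us \<subseteq> carrier P \<Longrightarrow> set vs \<subseteq> carrier P \<Longrightarrow>
    x \<in> carrier P \<Longrightarrow> y \<in> carrier P \<Longrightarrow> t \<in> carrier A \<Longrightarrow>
    compose_maps \<Phi>s (us @ (x \<oplus>\<^bsub>P\<^esub> y) # vs) t =
      compose_maps \<Phi>s (us @ x # vs) t \<oplus>\<^bsub>A\<^esub> compose_maps \<Phi>s (us @ y # vs) t"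
proof (induction us arbitrary: \<Phi>s)
  case Nil
  then obtain \<Phi> \<Phi>s' where "\<Phi>s = \<Phi> # \<Phi>s'"
    by (cases \<Phi>s) auto
  then show ?case
    using Nil compose_closed[of \<Phi>s' vs t] by (simp add: hom_map_def)
next
  case (Cons u us)
  then obtain \<Phi> \<Phi>s' where \<Phi>s: "\<Phi>s = \<Phi> # \<Phi>s'"
    by (cases \<Phi>s) auto
  have "linear_map K A A (\<Phi> u)"
    using Cons.prems \<Phi>s by (simp add: hom_map_def)
  then show ?case
    using Cons \<Phi>s compose_closed[of \<Phi>s' "us @ x # vs" t] compose_closed[of \<Phi>s' "us @ y # vs" t]
    by (simp add: linear_map_def)
qed

lemma compose_balanced:
  "hom_maps \<Phi>s \<Longrightarrow> Suc (Suc (length us + length vs)) = length \<Phi>s \<Longrightarrow> set us \<subseteq> carrier P \<Longrightarrow>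
    set vs \<subseteq> carrier P \<Longrightarrow> x \<in> carrier P \<Longrightarrow> y \<in> carrier P \<Longrightarrow> a \<in> carrier A \<Longrightarrow> t \<in> carrier A \<Longrightarrow>
    compose_maps \<Phi>s (us @ ract P x a # y # vs) t = compose_maps \<Phi>s (us @ x # lact P a y # vs) t"
proof (induction us arbitrary: \<Phi>s)
  case Nil
  then obtain \<Phi> \<Psi> \<Phi>s' where \<Phi>s: "\<Phi>s = \<Phi> # \<Psi> # \<Phi>s'"
    by (cases \<Phi>s; cases "tl \<Phi>s") auto
  then have "compose_maps (\<Psi> # \<Phi>s') (y # vs) t \<in> carrier A"
    using Nil by (intro compose_closed) auto
  then show ?case
    using Nil \<Phi>s compose_closed[of \<Phi>s' vs t] by (simp add: hom_map_def)
next
  case (Cons u us)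
  then obtain \<Phi> \<Phi>s' where "\<Phi>s = \<Phi> # \<Phi>s'"
    by (cases \<Phi>s) auto
  then show ?case
    using Cons by simp
qed

lemma compose_lact_hd:
  "hom_maps \<Phi>s \<Longrightarrow> length ps = length \<Phi>s \<Longrightarrow> ps \<noteq> [] \<Longrightarrow> set ps \<subseteq> carrier P \<Longrightarrow> a \<in> carrier A \<Longrightarrow> t \<in> carrier A \<Longrightarrow>
    compose_maps \<Phi>s (lact P a (hd ps) # tl ps) t = a \<otimes>\<^bsub>A\<^esub> compose_maps \<Phi>s ps t"
  using compose_closed[of "tl \<Phi>s" "tl ps" t]
  by (cases \<Phi>s; cases ps) (auto simp: hom_map_def)

lemma compose_ract_last:
  "hom_maps \<Phi>s \<Longrightarrow> length ps = length \<Phi>s \<Longrightarrow> ps \<noteq> [] \<Longrightarrow> set ps \<subseteq> carrier P \<Longrightarrow> a \<in> carrier A \<Longrightarrow> t \<in> carrier A \<Longrightarrow>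
    compose_maps \<Phi>s (butlast ps @ [ract P (last ps) a]) t = compose_maps \<Phi>s ps (a \<otimes>\<^bsub>A\<^esub> t)"
proof (induction \<Phi>s arbitrary: ps)
  case (Cons \<Phi> \<Phi>s)
  then obtain p ps' where ps: "ps = p # ps'"
    by (cases ps) auto
  show ?case
    using Cons ps by (cases "ps' = []") (auto simp: hom_map_def)
qed simp

lemma compose_zero:
  "hom_maps \<Phi>s \<Longrightarrow> length ps = length \<Phi>s \<Longrightarrow> set ps \<subseteq> carrier P \<Longrightarrow> i < length ps \<Longrightarrow>
    (\<And>t. t \<in> carrier A \<Longrightarrow> (\<Phi>s ! i) (ps ! i) t = \<zero>\<^bsub>A\<^esub>) \<Longrightarrow> t \<in> carrier A \<Longrightarrow> compose_maps \<Phi>s ps t = \<zero>\<^bsub>A\<^esub>"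
proof (induction \<Phi>s arbitrary: ps i)
  case (Cons \<Phi> \<Phi>s)
  then obtain p ps' where ps: "ps = p # ps'"
    by (cases ps) auto
  show ?case
  proof (cases i)
    case 0
    then show ?thesis
      using Cons.prems ps compose_closed[of \<Phi>s ps' t] by simp
  next
    case (Suc k)
    then have "compose_maps \<Phi>s ps' t = \<zero>\<^bsub>A\<^esub>"
      using Cons.prems ps by (intro Cons.IH[of ps' k]) auto
    then show ?thesis
      using Cons.prems ps AA.linear_map_zero[of "\<Phi> p"] by (simp add: hom_map_def)
  qed
qed simp

text \<open>Multiplication by \<open>a\<close> comes out in front of the composite when
  \<open>a\<close> acts on the first factor and enters at the back when it acts on the last. The two
  traces agree by \<open>trace_commute\<close>, and this is the cyclic condition of
  \<open>H_universal\<close>.\<close>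

lemma trace_functional:
  assumes \<Phi>s: "hom_maps \<Phi>s" "length \<Phi>s = m"
  obtains \<phi> where "\<phi> \<in> hom H (add_monoid K)"
    "\<And>ps. ps \<in> gens \<Longrightarrow> \<phi> (C ps) = DB.trace (compose_maps \<Phi>s ps)"
proof (rule H_universal[of "add_monoid K" "\<lambda>ps. DB.trace (compose_maps \<Phi>s ps)"])
  show "comm_group (add_monoid K)"
    by (rule SB.K.a_comm_group)
  have closed: "compose_maps \<Phi>s ps t \<in> carrier A" if "ps \<in> gens" "t \<in> carrier A" for ps t
    using that compose_closed[of \<Phi>s ps t] \<Phi>s by (simp add: power_gens_def)
  show "multiadditive (\<lambda>ps. DB.trace (compose_maps \<Phi>s ps)) (add_monoid K)"
  proof (rule multiadditiveI)
    show "DB.trace (compose_maps \<Phi>s ps) \<in> carrier (add_monoid K)" if "ps \<in> gens" for ps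
      using closed[OF that] DB.trace_closed by simp
  next
    fix us x y vs assume *: "us @ x # vs \<in> gens" "y \<in> carrier P"
    then have "us @ y # vs \<in> gens" by (simp add: append_mem_gens)
    note c = closed[OF *(1)] closed[OF this]
    have "DB.trace (compose_maps \<Phi>s (us @ (x \<oplus>\<^bsub>P\<^esub> y) # vs)) =
        DB.trace (\<lambda>t. compose_maps \<Phi>s (us @ x # vs) t \<oplus>\<^bsub>A\<^esub> compose_maps \<Phi>s (us @ y # vs) t)"
      using * c \<Phi>s by (intro DB.trace_cong) (auto simp: append_mem_gens compose_add)
    also have "\<dots> = DB.trace (compose_maps \<Phi>s (us @ x # vs)) \<oplus>\<^bsub>K\<^esub> DB.trace (compose_maps \<Phi>s (us @ y # vs))"
      using c by (rule DB.trace_add)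
    finally show "DB.trace (compose_maps \<Phi>s (us @ (x \<oplus>\<^bsub>P\<^esub> y) # vs)) =
        DB.trace (compose_maps \<Phi>s (us @ x # vs)) \<otimes>\<^bsub>add_monoid K\<^esub> DB.trace (compose_maps \<Phi>s (us @ y # vs))"
      by simp
  next
    fix us x y vs a assume *: "us @ x # y # vs \<in> gens" "a \<in> carrier A"
    then have "us @ x # lact P a y # vs \<in> gens" by (simp add: append_mem_gens)
    then show "DB.trace (compose_maps \<Phi>s (us @ ract P x a # y # vs)) =
        DB.trace (compose_maps \<Phi>s (us @ x # lact P a y # vs))"
      using * \<Phi>s closed by (intro DB.trace_cong compose_balanced) (auto simp: append_mem_gens)
  qed
next
  fix ps a assume *: "ps \<in> gens" "a \<in> carrier A"
  have ps: "length ps = length \<Phi>s" "set ps \<subseteq> carrier P" "ps \<noteq> []"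
    using *(1) \<Phi>s gens_not_Nil[OF *(1)] by (auto simp: power_gens_def)
  note lin = compose_linear[OF \<Phi>s(1) ps(1,2)]
  have "DB.trace (compose_maps \<Phi>s (lact P a (hd ps) # tl ps)) = DB.trace (\<lambda>t. a \<otimes>\<^bsub>A\<^esub> compose_maps \<Phi>s ps t)"
    using *(2) \<Phi>s(1) ps compose_closed[OF \<Phi>s(1) ps(1,2)] by (intro DB.trace_cong compose_lact_hd) auto
  also have "\<dots> = DB.trace (\<lambda>t. compose_maps \<Phi>s ps (a \<otimes>\<^bsub>A\<^esub> t))"
    using left_mult_linear[OF *(2)] lin by (rule DB.trace_commute)
  also have "\<dots> = DB.trace (compose_maps \<Phi>s (butlast ps @ [ract P (last ps) a]))"
    using *(2) \<Phi>s(1) ps compose_closed[OF \<Phi>s(1) ps(1,2)]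
    by (intro DB.trace_cong) (auto simp: compose_ract_last)
  finally show "DB.trace (compose_maps \<Phi>s (lact P a (hd ps) # tl ps)) =
      DB.trace (compose_maps \<Phi>s (butlast ps @ [ract P (last ps) a]))" .
qed (use that in blast)

section \<open>From nonzero homology to a closed walk\<close>

definition linked :: "'j \<Rightarrow> 'j \<Rightarrow> bool" where
  "linked j j' \<longleftrightarrow> j \<in> J \<and> j' \<in> J \<and> (\<exists>q\<in>Q j. q \<noteq> \<zero>\<^bsub>P\<^esub>) \<and>
     (\<exists>a\<in>carrier A. e j \<otimes>\<^bsub>A\<^esub> (a \<otimes>\<^bsub>A\<^esub> f j') \<noteq> \<zero>\<^bsub>A\<^esub>)"

text \<open>Closed walks of length \<open>m\<close> in the directed graph \<open>linked\<close>, the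
  last letter being followed by the first; for \<open>m = 1\<close> they are loops.
  \<open>linked\<close> asks for a nonzero element of \<open>Q\<close> at its source only, since
  every letter of a closed walk is the source of one edge.\<close>

definition closed_walks :: "'j list set" where
  "closed_walks = {js. length js = m \<and> (\<forall>(j, j')\<in>set (zip js (rotate1 js)). linked j j')}"

lemma C_zero:
  assumes "us @ \<zero>\<^bsub>P\<^esub> # vs \<in> gens"
  shows "C (us @ \<zero>\<^bsub>P\<^esub> # vs) = \<one>\<^bsub>H\<^esub>"
  using C_add[OF assms SB.P.U.zero_closed] assms by simp

lemma C_minus:
  assumes "us @ x # vs \<in> gens" "y \<in> carrier P"
    "C (us @ x # vs) = \<one>\<^bsub>H\<^esub>" "C (us @ y # vs) = \<one>\<^bsub>H\<^esub>"
  shows "C (us @ (x \<ominus>\<^bsub>P\<^esub> y) # vs) = \<one>\<^bsub>H\<^esub>"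
proof -
  have x: "x \<in> carrier P" and g: "us @ (x \<ominus>\<^bsub>P\<^esub> y) # vs \<in> gens"
    using assms(1,2) by (auto simp: append_mem_gens)
  have "(x \<ominus>\<^bsub>P\<^esub> y) \<oplus>\<^bsub>P\<^esub> y = x"
    using x assms(2) by (simp add: a_minus_def SB.P.U.a_assoc SB.P.U.l_neg)
  then show ?thesis
    using C_add[OF g assms(2)] assms(3,4) g by simp
qed

definition elementary :: "'p set" where
  "elementary = {lact P a (ract P q a') | j q a a'. j \<in> J \<and> q \<in> Q j \<and> a \<in> carrier A \<and> a' \<in> carrier A}"

text \<open>The factors are replaced one at a time from right to left: \<open>vs\<close> is the part
  already elementary, and \<open>P_induct\<close> handles the last factor of \<open>us\<close> while
  all others stay fixed.\<close>

lemma trivial_if_elementary_trivial: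
  assumes "\<And>ps. ps \<in> gens \<Longrightarrow> set ps \<subseteq> elementary \<Longrightarrow> C ps = \<one>\<^bsub>H\<^esub>"
  shows "carrier H = {\<one>\<^bsub>H\<^esub>}"
proof -
  have "C (us @ vs) = \<one>\<^bsub>H\<^esub>" if "us @ vs \<in> gens" "set vs \<subseteq> elementary" for us vs
    using that
  proof (induction us arbitrary: vs rule: rev_induct)
    case Nil
    then show ?case using assms by simp
  next
    case (snoc x us)
    have x: "x \<in> carrier P"
      using snoc.prems by (simp add: append_mem_gens)
    have g: "us @ y # vs \<in> gens" if "y \<in> carrier P" for y
      using snoc.prems that by (simp add: append_mem_gens)
    show ?case
      unfolding append_assoc append_Cons append_Nil
    proof (rule SB.P_induct[OF x])
      show "C (us @ \<zero>\<^bsub>P\<^esub> # vs) = \<one>\<^bsub>H\<^esub>"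
        by (rule C_zero[OF g]) simp
      show "C (us @ (y \<ominus>\<^bsub>P\<^esub> z) # vs) = \<one>\<^bsub>H\<^esub>"
        if "y \<in> carrier P" "z \<in> carrier P" "C (us @ y # vs) = \<one>\<^bsub>H\<^esub>" "C (us @ z # vs) = \<one>\<^bsub>H\<^esub>" for y z
        using g that by (intro C_minus)
      show "C (us @ lact P a (ract P q a') # vs) = \<one>\<^bsub>H\<^esub>"
        if "j \<in> J" "q \<in> Q j" "a \<in> carrier A" "a' \<in> carrier A" for j q a a'
      proof (rule snoc.IH)
        show "us @ lact P a (ract P q a') # vs \<in> gens"
          using that SB.Q_closed by (intro g) auto
        show "set (lact P a (ract P q a') # vs) \<subseteq> elementary"
          using that snoc.prems unfolding elementary_def by auto
      qed
    qed
  qed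
  from this[of _ "[]"] have C: "C ps = \<one>\<^bsub>H\<^esub>" if "ps \<in> gens" for ps
    using that by simp
  have "x = \<one>\<^bsub>H\<^esub>" if "x \<in> carrier H" for x
    using that by (induction x rule: H_induct) (auto simp: C)
  then show ?thesis by auto
qed

text \<open>The shift undoes \<open>rotate1\<close> and, being a homomorphism, preserves the unit.
  Vanishing may therefore be tested after any rotation.\<close>

lemma C_rotate:
  assumes "ps \<in> gens" "C (rotate n ps) = \<one>\<^bsub>H\<^esub>"
  shows "C ps = \<one>\<^bsub>H\<^esub>"
  using assms
proof (induction n arbitrary: ps)
  case (Suc n)
  interpret t: group_hom H H "cyclic_shift A P m"
    by unfold_locales (rule cyclic_shift)
  have r: "rotate n ps \<in> gens" "rotate n ps \<noteq> []" "rotate1 (rotate n ps) \<in> gens"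
    using Suc.prems(1) gens_not_Nil[OF Suc.prems(1)] by (auto simp: power_gens_def)
  have "C (rotate n ps) = cyclic_shift A P m (C (rotate1 (rotate n ps)))"
    using cyclic_shift_C[OF r(3)] rot_rotate1[OF r(2)] by simp
  also have "\<dots> = \<one>\<^bsub>H\<^esub>"
    using Suc.prems(2) by simp
  finally show ?case
    using Suc by blast
qed simp

text \<open>A nonzero class is carried by a tensor of elementary factors. If a factor had
  \<open>q = 0\<close>, or if two cyclic neighbours were separated by \<open>e a f' = 0\<close>, the
  class would vanish; hence the letters of the factors form a closed walk.\<close>

lemma exists_closed_walk:
  assumes "carrier H \<noteq> {\<one>\<^bsub>H\<^esub>}"
  shows "closed_walks \<noteq> {}"
proof -
  obtain ps where ps: "ps \<in> gens" "set ps \<subseteq> elementary" "C ps \<noteq> \<one>\<^bsub>H\<^esub>"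
    using trivial_if_elementary_trivial assms by blast
  have "\<forall>p\<in>elementary. \<exists>j q a a'. j \<in> J \<and> q \<in> Q j \<and> a \<in> carrier A \<and> a' \<in> carrier A \<and> p = lact P a (ract P q a')"
    unfolding elementary_def by blast
  then obtain jj qq aa aa' where el: "\<And>p. p \<in> elementary \<Longrightarrow> jj p \<in> J \<and> qq p \<in> Q (jj p) \<and>
      aa p \<in> carrier A \<and> aa' p \<in> carrier A \<and> p = lact P (aa p) (ract P (qq p) (aa' p))"
    by metis
  have len: "length ps = m"
    using ps(1) by (simp add: power_gens_def)
  have "linked (jj (ps ! i)) (jj (ps ! (Suc i mod m)))" if i: "i < m" for i
  proof -
    \<comment> \<open>This rotation places the factor \<open>i\<close> last and its cyclic successor
      first, so that all neighbours, including the wrap-around pair, are treated by the one relation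
      \<open>C_cyclic\<close>.\<close>
    let ?rs = "rotate (Suc i) ps"
    have rs: "?rs \<in> gens" "?rs \<noteq> []" "set ?rs \<subseteq> elementary" "C ?rs \<noteq> \<one>\<^bsub>H\<^esub>"
      using ps C_rotate[OF ps(1), of "Suc i"] gens_not_Nil[OF ps(1)] by (auto simp: power_gens_def)
    have hd: "hd ?rs = ps ! (Suc i mod m)"
      using rs(2) len i by (simp add: hd_rotate_conv_nth del: rotate_Suc)
    have last: "last ?rs = ps ! i"
    proof -
      have "last ?rs = ?rs ! (m - 1)"
        using rs(2) len by (simp add: last_conv_nth del: rotate_Suc)
      also have "\<dots> = ps ! ((Suc i + (m - 1)) mod m)"
        using len m by (subst nth_rotate) auto
      also have "(Suc i + (m - 1)) mod m = i"
        using i by simp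
      finally show ?thesis .
    qed
    define p p' where "p = ps ! i" and "p' = ps ! (Suc i mod m)"
    have "i < length ps" "Suc i mod m < length ps"
      using len i m by simp_all
    then have p: "p \<in> elementary" "p' \<in> elementary"
      using ps(2) unfolding p_def p'_def by (blast dest: nth_mem)+
    note P = el[OF p(1)] and P' = el[OF p(2)]
    have carr: "qq p \<in> carrier P" "qq p' \<in> carrier P"
      using P P' SB.Q_closed by auto
    obtain us where us: "?rs = p' # us"
      using rs(2) hd by (cases ?rs) (auto simp: p'_def)
    have us_gens: "Suc (length us) = m" "set us \<subseteq> carrier P"
      using rs(1) unfolding us by (auto simp: append_mem_gens)
    have "qq p \<noteq> \<zero>\<^bsub>P\<^esub>"
    proof
      assume "qq p = \<zero>\<^bsub>P\<^esub>"
      then have "p = \<zero>\<^bsub>P\<^esub>"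
        using P by (metis SB.P.lact_zero SB.P.zero_ract SB.P.ract_zero)
      moreover have "?rs = butlast ?rs @ p # []"
        using append_butlast_last_id[OF rs(2)] unfolding last p_def by (rule sym)
      ultimately have "C ?rs = \<one>\<^bsub>H\<^esub>"
        using C_zero[of "butlast ?rs" "[]"] rs(1) by metis
      then show False using rs(4) by simp
    qed
    moreover have "e (jj p) \<otimes>\<^bsub>A\<^esub> ((aa' p \<otimes>\<^bsub>A\<^esub> aa p') \<otimes>\<^bsub>A\<^esub> f (jj p')) \<noteq> \<zero>\<^bsub>A\<^esub>"
    proof
      assume zero: "e (jj p) \<otimes>\<^bsub>A\<^esub> ((aa' p \<otimes>\<^bsub>A\<^esub> aa p') \<otimes>\<^bsub>A\<^esub> f (jj p')) = \<zero>\<^bsub>A\<^esub>"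
      \<comment> \<open>The first factor is \<open>b\<close> acting on \<open>x\<close>. Moved
        cyclically behind the last factor, \<open>b\<close> meets \<open>q e a'\<close> of
        \<open>p\<close>, and \<open>e a' b\<close> is the product assumed to vanish.\<close>
      define b where "b = aa p' \<otimes>\<^bsub>A\<^esub> f (jj p')"
      have mem: "e (jj p) \<in> carrier A" "f (jj p') \<in> carrier A" "aa p \<in> carrier A" "aa' p \<in> carrier A"
        "aa p' \<in> carrier A" "aa' p' \<in> carrier A" "b \<in> carrier A"
        using P P' SB.e SB.f by (auto simp: b_def)
      have zero': "e (jj p) \<otimes>\<^bsub>A\<^esub> (aa' p \<otimes>\<^bsub>A\<^esub> b) = \<zero>\<^bsub>A\<^esub>"
        using zero mem by (simp add: b_def SB.A.m_assoc)
      define x where "x = ract P (qq p') (aa' p')"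
      have x: "x \<in> carrier P"
        using carr mem by (simp add: x_def)
      have "lact P (f (jj p')) x = x"
        using carr mem P' SB.lact_Q[of "jj p'" "qq p'"] by (simp add: x_def SB.P.lact_ract)
      then have p'_eq: "p' = lact P b x"
        using P' mem x SB.P.lact_mult[of "aa p'" "f (jj p')" x] by (simp add: b_def x_def)
      have kill: "ract P (ract P (qq p) (aa' p)) b = \<zero>\<^bsub>P\<^esub>"
      proof -
        have "ract P (ract P (qq p) (aa' p)) b = ract P (ract P (qq p) (e (jj p))) (aa' p \<otimes>\<^bsub>A\<^esub> b)"
          using SB.ract_Q[of "jj p" "qq p"] P carr mem by (simp add: SB.P.ract_mult)
        also have "\<dots> = ract P (qq p) (e (jj p) \<otimes>\<^bsub>A\<^esub> (aa' p \<otimes>\<^bsub>A\<^esub> b))"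
          using carr mem by (simp add: SB.P.ract_mult)
        finally show ?thesis
          using zero' carr by simp
      qed
      have "ract P (last (x # us)) b = \<zero>\<^bsub>P\<^esub>"
      \<comment> \<open>For a single factor the first is also the last: once \<open>b\<close> has
        been stripped off, the last factor is \<open>x\<close> itself and no longer
        \<open>p\<close>.\<close>
      proof (cases "us = []")
        case True
        then have "p = p'"
          using last us by (simp add: p_def)
        then show ?thesis
          using kill True by (simp add: x_def)
      next
        case False
        then have "last (x # us) = p"
          using last us by (simp add: p_def)
        also have "p = lact P (aa p) (ract P (qq p) (aa' p))"
          using P by blast
        finally show ?thesis
          using kill carr mem SB.P.lact_ract[of "aa p" "ract P (qq p) (aa' p)" b] by simp
      qed
      moreover have g: "x # us \<in> gens"
        using us_gens x by (simp add: append_mem_gens)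
      moreover have "butlast (x # us) @ [\<zero>\<^bsub>P\<^esub>] \<in> gens"
        using g by (cases us rule: rev_cases) (auto simp: append_mem_gens)
      ultimately have "C (lact P b x # us) = \<one>\<^bsub>H\<^esub>"
        using C_cyclic[OF g mem(7)] C_zero[of "butlast (x # us)" "[]"] by simp
      then show False
        using rs(4) us p'_eq by simp
    qed
    moreover have "aa' p \<otimes>\<^bsub>A\<^esub> aa p' \<in> carrier A"
      using P P' by simp
    ultimately show ?thesis
      unfolding linked_def using P P' unfolding p_def p'_def by blast
  qed
  moreover have "Suc i mod length ps < length ps" for i
    using len m by simp
  ultimately have "map jj ps \<in> closed_walks"
    using len by (auto simp: closed_walks_def set_zip nth_rotate1)
  then show ?thesis by blast
qed

section \<open>From a closed walk to an invariant\<close>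

lemma compose_walk:
  assumes \<Psi>: "\<And>j j'. linked j j' \<Longrightarrow> hom_map K A A P (\<Psi> j j') \<and> g j j' \<in> carrier P \<and>
      (\<exists>l. linear_functional K A l \<and> l (f j') = \<one>\<^bsub>K\<^esub> \<and> (\<forall>t\<in>carrier A. \<Psi> j j' (g j j') t = l t \<odot>\<^bsub>A\<^esub> f j))"
  shows "js \<noteq> [] \<Longrightarrow> length js = length ks \<Longrightarrow> \<forall>(j, j')\<in>set (zip js ks). linked j j' \<Longrightarrow> tl js = butlast ks \<Longrightarrow>
    \<exists>l. linear_functional K A l \<and> l (f (last ks)) = \<one>\<^bsub>K\<^esub> \<and>
      (\<forall>t\<in>carrier A. compose_maps (map2 \<Psi> js ks) (map2 g js ks) t = l t \<odot>\<^bsub>A\<^esub> f (hd js))"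
\<comment> \<open>The second list is kept separate and merely shifted by one, because the tail of a
  closed walk is no longer closed; the induction runs over open walks.\<close>
proof (induction js arbitrary: ks)
  case (Cons j js)
  then obtain k ks' where ks: "ks = k # ks'"
    by (cases ks) auto
  have linked: "linked j k"
    using Cons.prems ks by simp
  obtain l where l: "linear_functional K A l" "l (f k) = \<one>\<^bsub>K\<^esub>"
    "\<And>t. t \<in> carrier A \<Longrightarrow> \<Psi> j k (g j k) t = l t \<odot>\<^bsub>A\<^esub> f j"
    using \<Psi>[OF linked] by blast
  have fjk: "f j \<in> carrier A" "f k \<in> carrier A"
    using linked SB.f by (auto simp: linked_def)
  show ?case
  proof (cases "js = []")
    case True
    then show ?thesis
      using Cons.prems ks l by auto
  next
    case False
    then have hd: "hd js = k" "tl js = butlast ks'" "ks' \<noteq> []"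
      using Cons.prems ks by (auto split: if_splits)
    obtain l' where l': "linear_functional K A l'" "l' (f (last ks')) = \<one>\<^bsub>K\<^esub>"
      "\<And>t. t \<in> carrier A \<Longrightarrow> compose_maps (map2 \<Psi> js ks') (map2 g js ks') t = l' t \<odot>\<^bsub>A\<^esub> f k"
      using Cons.IH[of ks'] Cons.prems ks False hd by auto
    \<comment> \<open>The inner composite has its image in the line of \<open>f k\<close>, on which
      \<open>l\<close> is normalised to 1. So the outer map only replaces \<open>f k\<close> by
      \<open>f j\<close>, and the functional of the innermost step survives unchanged.\<close>
    have "compose_maps (map2 \<Psi> (j # js) ks) (map2 g (j # js) ks) t = l' t \<odot>\<^bsub>A\<^esub> f j" if t: "t \<in> carrier A" for t
    proof -
      have "l' t \<in> carrier K"
        using l'(1) t by (simp add: linear_functional_def)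
      then show ?thesis
        using l t fjk ks l'(3) by (simp add: linear_functional_def)
    qed
    then show ?thesis
      using l' hd ks by auto
  qed
qed simp

text \<open>An edge provides \<open>q \<noteq> 0\<close> and \<open>a\<close> with
  \<open>e a f' \<noteq> 0\<close>. A functional \<open>\<mu>\<close> with value 1 at
  \<open>e a f'\<close> gives \<open>l t = \<mu> (e a t)\<close>, which makes the operator of
  \<open>q a\<close> send \<open>f'\<close> exactly to \<open>f\<close>; operators coming from other
  letters vanish whatever coefficient \<open>b\<close> is used.\<close>

lemma linked_hom_map:
  assumes "linked j j'"
  obtains q a \<Phi> l where "q \<in> Q j" "a \<in> carrier A" "hom_map K A A P \<Phi>"
    "linear_functional K A l" "l (f j') = \<one>\<^bsub>K\<^esub>"
    "\<And>t. t \<in> carrier A \<Longrightarrow> \<Phi> (ract P q a) t = l t \<odot>\<^bsub>A\<^esub> f j"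
    "\<And>i q' b t. i \<in> J \<Longrightarrow> q' \<in> Q i \<Longrightarrow> i \<noteq> j \<Longrightarrow> b \<in> carrier A \<Longrightarrow> t \<in> carrier A \<Longrightarrow> \<Phi> (ract P q' b) t = \<zero>\<^bsub>A\<^esub>"
proof -
  obtain q a where q: "j \<in> J" "j' \<in> J" "q \<in> Q j" "q \<noteq> \<zero>\<^bsub>P\<^esub>"
    and a: "a \<in> carrier A" "e j \<otimes>\<^bsub>A\<^esub> (a \<otimes>\<^bsub>A\<^esub> f j') \<noteq> \<zero>\<^bsub>A\<^esub>"
    using assms by (auto simp: linked_def)
  have mem: "e j \<in> carrier A" "f j' \<in> carrier A" "q \<in> carrier P"
    using q SB.e SB.f SB.Q_closed by auto
  obtain \<mu> where \<mu>: "linear_functional K A \<mu>" "\<mu> (e j \<otimes>\<^bsub>A\<^esub> (a \<otimes>\<^bsub>A\<^esub> f j')) = \<one>\<^bsub>K\<^esub>"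
    using DB.separating_functional[OF _ a(2)] mem a(1) by auto
  obtain \<Phi> where \<Phi>: "hom_map K A A P \<Phi>" "\<And>t. t \<in> carrier A \<Longrightarrow> \<Phi> q t = \<mu> (e j \<otimes>\<^bsub>A\<^esub> t) \<odot>\<^bsub>A\<^esub> f j"
    "\<And>i q' t. i \<in> J \<Longrightarrow> q' \<in> Q i \<Longrightarrow> t \<in> carrier A \<Longrightarrow> i \<noteq> j \<Longrightarrow> \<Phi> q' t = \<zero>\<^bsub>A\<^esub>"
    using SB.hom_map_Q[OF q(1,3,4) \<mu>(1)] by blast
  have ract: "\<Phi> (ract P p b) t = \<Phi> p (b \<otimes>\<^bsub>A\<^esub> t)" if "p \<in> carrier P" "b \<in> carrier A" "t \<in> carrier A" for p b t
    using \<Phi>(1) that by (simp add: hom_map_def)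
  show thesis
  proof (rule that[OF q(3) a(1) \<Phi>(1)])
    show "linear_functional K A (\<lambda>t. \<mu> (e j \<otimes>\<^bsub>A\<^esub> (a \<otimes>\<^bsub>A\<^esub> t)))"
      using linear_functional_comp[OF linear_map_comp[OF left_mult_linear left_mult_linear] \<mu>(1)] mem a(1) by blast
    show "\<Phi> (ract P q a) t = \<mu> (e j \<otimes>\<^bsub>A\<^esub> (a \<otimes>\<^bsub>A\<^esub> t)) \<odot>\<^bsub>A\<^esub> f j" if "t \<in> carrier A" for t
      using that mem a(1) by (simp add: ract \<Phi>(2))
    show "\<Phi> (ract P q' b) t = \<zero>\<^bsub>A\<^esub>"
      if "i \<in> J" "q' \<in> Q i" "i \<noteq> j" "b \<in> carrier A" "t \<in> carrier A" for i q' b t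
      using that SB.Q_closed[of i q'] by (simp add: ract \<Phi>(3))
  qed (rule \<mu>(2))
qed

lemma closed_walks_rot:
  assumes "js \<in> closed_walks"
  shows "rot js \<in> closed_walks" "js \<noteq> []" "length js = m"
proof -
  show js: "js \<noteq> []" "length js = m"
    using assms m by (auto simp: closed_walks_def)
  let ?z = "zip js (rotate1 js)"
  have "?z \<noteq> []"
    using js by (cases js) auto
  then have "set (last ?z # butlast ?z) = set ?z"
    by (cases ?z rule: rev_cases) auto
  then show "rot js \<in> closed_walks"
    using assms js m zip_rotate1_rot[OF js(1)] by (simp add: closed_walks_def)
qed

lemma closed_walk_linked:
  assumes "js \<in> closed_walks" "i < m"
  shows "linked (js ! i) (rotate1 js ! i)"
  using assms nth_mem[of i "zip js (rotate1 js)"] by (auto simp: closed_walks_def)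

text \<open>The shift permutes the elements attached to a rotation-stable set of walks, so their sum
  \<open>w\<close> is fixed. The trace functional built from \<open>\<sigma>\<close> is 1 on the
  term of \<open>\<sigma>\<close> and 0 on all others, so \<open>w\<close> is nonzero in every
  characteristic.\<close>

lemma invariant_of_closed_walk:
  assumes \<sigma>: "\<sigma> \<in> closed_walks"
  obtains w where "w \<in> carrier H" "w \<noteq> \<one>\<^bsub>H\<^esub>" "cyclic_shift A P m w = w"
proof -
  have "\<exists>q a \<Phi> l. q \<in> Q j \<and> a \<in> carrier A \<and> hom_map K A A P \<Phi> \<and>
      linear_functional K A l \<and> l (f j') = \<one>\<^bsub>K\<^esub> \<and> (\<forall>t\<in>carrier A. \<Phi> (ract P q a) t = l t \<odot>\<^bsub>A\<^esub> f j) \<and>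
      (\<forall>i q' b t. i \<in> J \<longrightarrow> q' \<in> Q i \<longrightarrow> i \<noteq> j \<longrightarrow> b \<in> carrier A \<longrightarrow> t \<in> carrier A \<longrightarrow> \<Phi> (ract P q' b) t = \<zero>\<^bsub>A\<^esub>)"
    if "linked j j'" for j j'
    using linked_hom_map[OF that] by metis
  then obtain q a \<Psi> l where \<Psi>: "\<And>j j'. linked j j' \<Longrightarrow> q j j' \<in> Q j \<and> a j j' \<in> carrier A \<and> hom_map K A A P (\<Psi> j j') \<and>
      linear_functional K A (l j j') \<and> l j j' (f j') = \<one>\<^bsub>K\<^esub> \<and>
      (\<forall>t\<in>carrier A. \<Psi> j j' (ract P (q j j') (a j j')) t = l j j' t \<odot>\<^bsub>A\<^esub> f j) \<and>
      (\<forall>i q' b t. i \<in> J \<longrightarrow> q' \<in> Q i \<longrightarrow> i \<noteq> j \<longrightarrow> b \<in> carrier A \<longrightarrow> t \<in> carrier A \<longrightarrow> \<Psi> j j' (ract P q' b) t = \<zero>\<^bsub>A\<^esub>)"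
    by metis
  \<comment> \<open>The factor attached to an edge depends on that edge alone and not on its
    position or on the walk; this is what makes \<open>gs\<close> commute with rotation.\<close>
  define g where "g j j' = ract P (q j j') (a j j')" for j j'
  have g: "g j j' \<in> carrier P" if "linked j j'" for j j'
    using \<Psi>[OF that] that SB.Q_closed unfolding g_def linked_def by (intro SB.P.ract_closed) blast+
  define gs where "gs js = map2 g js (rotate1 js)" for js
  have gs: "gs js \<in> gens" if "js \<in> closed_walks" for js
    using that g by (auto simp: closed_walks_def gs_def power_gens_def)
  have gs_rot: "rot (gs js) = gs (rot js)" if "js \<in> closed_walks" for js
  proof -
    have "zip js (rotate1 js) \<noteq> []"
      using closed_walks_rot(2)[OF that] by (cases js) auto
    then show ?thesis
      unfolding gs_def zip_rotate1_rot[OF closed_walks_rot(2)[OF that]]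
      by (simp add: last_map map_butlast)
  qed
  \<comment> \<open>Restricting to the letters of \<open>\<sigma>\<close> makes the set finite
    without any assumption on \<open>J\<close>, and keeps it stable under rotation. Being a set, it
    contains a periodic walk only once.\<close>
  define Ws where "Ws = {js \<in> closed_walks. set js \<subseteq> set \<sigma>}"
  have finWs: "finite Ws"
    using finite_lists_length_eq[of "set \<sigma>" m] by (rule finite_subset[rotated]) (auto simp: Ws_def closed_walks_def)
  have rotWs: "rot ` Ws = Ws"
  \<comment> \<open>An injective self-map of a finite set is onto, which the reindexing of the
    product needs. Injectivity holds because \<open>rotate1\<close> inverts
    \<open>rot\<close>.\<close>
  proof (rule endo_inj_surj[OF finWs])
    show "rot ` Ws \<subseteq> Ws"
    proof
      fix ks assume "ks \<in> rot ` Ws"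
      then obtain js where js: "js \<in> closed_walks" "set js \<subseteq> set \<sigma>" "ks = rot js"
        by (auto simp: Ws_def)
      have "set (rot js) = set js"
        using closed_walks_rot(2)[OF js(1)] by (cases js rule: rev_cases) auto
      then show "ks \<in> Ws"
        using js closed_walks_rot(1)[OF js(1)] by (simp add: Ws_def)
    qed
    show inj: "inj_on rot Ws"
      by (rule inj_on_inverseI[of _ rotate1]) (auto simp: Ws_def closed_walks_rot(2))
  qed
  have injWs: "inj_on rot Ws"
    by (rule inj_on_inverseI[of _ rotate1]) (auto simp: Ws_def closed_walks_rot(2))
  have \<sigma>Ws: "\<sigma> \<in> Ws"
    using \<sigma> by (simp add: Ws_def)
  define z where "z js = C (gs js)" for js
  have z: "z \<in> Ws \<rightarrow> carrier H"
    using gs by (auto simp: z_def Ws_def)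
  define w where "w = finprod H z Ws"
  have w: "w \<in> carrier H"
    unfolding w_def using z by (rule H.finprod_closed)
  have "cyclic_shift A P m w = finprod H (\<lambda>js. cyclic_shift A P m (z js)) Ws"
    unfolding w_def by (rule hom_finprod[OF H.comm_group_axioms H.comm_group_axioms cyclic_shift finWs z])
  also have "\<dots> = finprod H (\<lambda>js. z (rot js)) Ws"
    using z closed_walks_rot(1) gs
    by (intro H.finprod_cong') (auto simp: Ws_def z_def cyclic_shift_C gs_rot)
  also have "\<dots> = finprod H z (rot ` Ws)"
    using injWs z rotWs by (intro H.finprod_reindex[symmetric]) auto
  finally have inv: "cyclic_shift A P m w = w"
    by (simp add: rotWs w_def)
  have linked_\<sigma>: "\<forall>(j, j')\<in>set (zip \<sigma> (rotate1 \<sigma>)). linked j j'" and len_\<sigma>: "length \<sigma> = m" "\<sigma> \<noteq> []"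
    using \<sigma> closed_walks_rot(2)[OF \<sigma>] by (auto simp: closed_walks_def)
  define \<Phi>s where "\<Phi>s = map2 \<Psi> \<sigma> (rotate1 \<sigma>)"
  have \<Phi>s: "hom_maps \<Phi>s" "length \<Phi>s = m"
    using linked_\<sigma> \<Psi> len_\<sigma> by (auto simp: \<Phi>s_def)
  obtain \<phi> where \<phi>: "\<phi> \<in> hom H (add_monoid K)"
    "\<And>ps. ps \<in> gens \<Longrightarrow> \<phi> (C ps) = DB.trace (compose_maps \<Phi>s ps)"
    using trace_functional[OF \<Phi>s] by blast
  \<comment> \<open>The walk closes up, so the composite is the rank one operator
    \<open>t \<mapsto> l t \<cdot> f (hd \<sigma>)\<close>, and its trace is \<open>l\<close> at
    \<open>f (hd \<sigma>)\<close>, which is 1.\<close>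
  have "\<phi> (z \<sigma>) = \<one>\<^bsub>K\<^esub>"
  proof -
    have shift: "tl \<sigma> = butlast (rotate1 \<sigma>)" "last (rotate1 \<sigma>) = hd \<sigma>"
      using len_\<sigma> by (cases \<sigma>; simp)+
    have walk: "hom_map K A A P (\<Psi> j j') \<and> g j j' \<in> carrier P \<and>
      (\<exists>l. linear_functional K A l \<and> l (f j') = \<one>\<^bsub>K\<^esub> \<and> (\<forall>t\<in>carrier A. \<Psi> j j' (g j j') t = l t \<odot>\<^bsub>A\<^esub> f j))"
      if "linked j j'" for j j'
      using \<Psi>[OF that] g[OF that] unfolding g_def by blast
    obtain l where l: "linear_functional K A l" "l (f (hd \<sigma>)) = \<one>\<^bsub>K\<^esub>"
      "\<And>t. t \<in> carrier A \<Longrightarrow> compose_maps \<Phi>s (gs \<sigma>) t = l t \<odot>\<^bsub>A\<^esub> f (hd \<sigma>)"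
      using compose_walk[of \<Psi> g, OF walk len_\<sigma>(2) _ linked_\<sigma> shift(1)] unfolding gs_def \<Phi>s_def shift(2)
      by auto
    have "f (hd \<sigma>) \<in> carrier A"
    proof -
      have "(hd \<sigma>, hd (rotate1 \<sigma>)) \<in> set (zip \<sigma> (rotate1 \<sigma>))"
        using len_\<sigma>(2) by (cases \<sigma>; cases "rotate1 \<sigma>") auto
      then show ?thesis
        using linked_\<sigma> SB.f by (auto simp: linked_def)
    qed
    moreover have "DB.trace (compose_maps \<Phi>s (gs \<sigma>)) = DB.trace (\<lambda>t. l t \<odot>\<^bsub>A\<^esub> f (hd \<sigma>))"
      using l calculation by (intro DB.trace_cong) (auto simp: linear_functional_def)
    ultimately show ?thesis
      using \<phi>(2)[OF gs[OF \<sigma>]] DB.trace_rank_one[OF l(1)] l(2) by (simp add: z_def)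
  qed
  moreover have "\<phi> (z js) = \<zero>\<^bsub>K\<^esub>" if js_mem: "js \<in> Ws" and neq: "js \<noteq> \<sigma>" for js
  proof -
    have js: "js \<in> closed_walks" "length js = m"
      using js_mem by (auto simp: Ws_def closed_walks_def)
    obtain i where i: "i < m" "js ! i \<noteq> \<sigma> ! i"
      using neq js len_\<sigma>(1) by (metis nth_equalityI)
    have linked: "linked (js ! i) (rotate1 js ! i)" "linked (\<sigma> ! i) (rotate1 \<sigma> ! i)"
      using closed_walk_linked[OF js(1) i(1)] closed_walk_linked[OF \<sigma> i(1)] .
    \<comment> \<open>One differing position suffices: the map there was made for the letter
      \<open>\<sigma> ! i\<close> and vanishes on elements of any other letter, and a single zero
      factor makes the whole composite zero.\<close>
    have kill: "(\<Phi>s ! i) (gs js ! i) t = \<zero>\<^bsub>A\<^esub>" if "t \<in> carrier A" for t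
    proof -
      have "js ! i \<in> J" "q (js ! i) (rotate1 js ! i) \<in> Q (js ! i)" "a (js ! i) (rotate1 js ! i) \<in> carrier A"
        using linked(1) \<Psi>[OF linked(1)] by (auto simp: linked_def)
      then have "\<Psi> (\<sigma> ! i) (rotate1 \<sigma> ! i) (g (js ! i) (rotate1 js ! i)) t = \<zero>\<^bsub>A\<^esub>"
        using \<Psi>[OF linked(2)] i(2) that unfolding g_def by blast
      then show ?thesis
        using i js len_\<sigma> by (simp add: \<Phi>s_def gs_def)
    qed
    have gm: "gs js \<in> gens" "length (gs js) = length \<Phi>s" "set (gs js) \<subseteq> carrier P" "i < length (gs js)"
      using gs[OF js(1)] \<Phi>s i by (auto simp: power_gens_def)
    have "DB.trace (compose_maps \<Phi>s (gs js)) = \<zero>\<^bsub>K\<^esub>"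
      by (rule DB.trace_zero) (rule compose_zero[OF \<Phi>s(1) gm(2-4) kill])
    then show ?thesis
      using \<phi>(2)[OF gm(1)] by (simp add: z_def)
  qed
  moreover have "\<phi> w = (\<Oplus>\<^bsub>K\<^esub>js\<in>Ws. \<phi> (z js))"
    unfolding w_def finsum_def by (rule hom_finprod[OF H.comm_group_axioms SB.K.a_comm_group \<phi>(1) finWs z])
  ultimately have "\<phi> w = (\<Oplus>\<^bsub>K\<^esub>js\<in>Ws. if \<sigma> = js then \<one>\<^bsub>K\<^esub> else \<zero>\<^bsub>K\<^esub>)"
    by (auto intro!: SB.K.finsum_cong')
  then have "\<phi> w = \<one>\<^bsub>K\<^esub>"
    using SB.K.finsum_singleton[OF \<sigma>Ws finWs, of "\<lambda>_. \<one>\<^bsub>K\<^esub>"] by simp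
  moreover have "\<phi> \<one>\<^bsub>H\<^esub> = \<zero>\<^bsub>K\<^esub>"
    using group_hom.hom_one[of H "add_monoid K" \<phi>] \<phi>(1)
    by (simp add: group_hom_def group_hom_axioms_def H.is_group SB.K.a_group)
  ultimately have "w \<noteq> \<one>\<^bsub>H\<^esub>"
    by auto
  then show thesis
    using that w inv by blast
qed

lemma trivial_invariants_imp_trivial:
  assumes "group_invariants (integer_mod_group m) (cyclic_action A P m) (carrier H) = {\<one>\<^bsub>H\<^esub>}"
  shows "carrier H = {\<one>\<^bsub>H\<^esub>}"
proof (rule ccontr)
  assume "carrier H \<noteq> {\<one>\<^bsub>H\<^esub>}"
  then obtain w where w: "w \<in> carrier H" "w \<noteq> \<one>\<^bsub>H\<^esub>" "cyclic_shift A P m w = w"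
    using exists_closed_walk invariant_of_closed_walk by blast
  \<comment> \<open>All group elements act by powers of the shift, so being fixed by the generator
    is enough.\<close>
  have "(cyclic_shift A P m ^^ n) w = w" for n
    by (induction n) (simp_all add: w(3))
  then have "w \<in> group_invariants (integer_mod_group m) (cyclic_action A P m) (carrier H)"
    using w(1) by (simp add: group_invariants_def cyclic_action_def)
  then show False
    using assms w(2) by simp
qed

end

section \<open>Specialisation to the given bimodules\<close>

lemma complete_primitive_idempotentsD:
  assumes "complete_primitive_idempotents A E" "e \<in> E"
  shows "e \<in> carrier A" "e \<otimes>\<^bsub>A\<^esub> e = e"
  using assms by (auto simp: complete_primitive_idempotents_def primitive_idempotent_def idempotent_elem_def)

text \<open>Projections instead of pattern matching make the summands a function of the idempotents
  \<open>l i\<close> and \<open>r i\<close>, as in \<open>proj_family\<close>; used from right to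
  left in the theorem.\<close>

lemma proj_bimodule_eq:
  "proj_bimodule K B A F E c = bimod_sum (SIGMA (g, e) : F \<times> E. {..<c g e})
     (\<lambda>i. tensor K (left_proj B (fst (fst i))) (right_proj A (snd (fst i))))"
  by (simp add: proj_bimodule_def case_prod_beta')

lemma proj_family_idempotents:
  assumes K: "field K" and "fin_dim_algebra K C" "fin_dim_algebra K D"
    and "complete_primitive_idempotents C E" "complete_primitive_idempotents D F"
  shows "proj_family K C D (SIGMA (g, e) : E \<times> F. {..<c g e}) (\<lambda>i. fst (fst i)) (\<lambda>i. snd (fst i))"
  using assms
  by (auto simp: proj_family_def proj_family_axioms_def alg_pair_def fin_dim_algebra_def
      dest: complete_primitive_idempotentsD)

theorem theorem4p3:
  fixes K :: "'k ring"
    and A :: "('k, 'a) module" and B :: "('k, 'b) module"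
    and E :: "'a set" and F :: "'b set"
    and mult_M :: "'b \<Rightarrow> 'a \<Rightarrow> nat" and mult_N :: "'a \<Rightarrow> 'b \<Rightarrow> nat"
    and m :: nat
  assumes "perfect_field K"
    and "fin_dim_algebra K A" and "basic_algebra K A"
    and "fin_dim_algebra K B" and "basic_algebra K B"
    and "complete_primitive_idempotents A E"
    and "complete_primitive_idempotents B F"
    and "M = proj_bimodule K B A F E mult_M"
    and "N = proj_bimodule K A B E F mult_N"
    and "m \<ge> 1"
    and "H = H0 A (tensor_power A (tensor B N M) m)"
    and "group_invariants (integer_mod_group m) (cyclic_action A (tensor B N M) m) (carrier H)
           = {\<one>\<^bsub>H\<^esub>}"
  shows "carrier H = {\<one>\<^bsub>H\<^esub>}"
proof -
  have K: "field K"
    using assms(1) by (simp add: perfect_field_def)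
  obtain S \<delta> where A_basis: "dual_basis K A S \<delta>"
    using fin_dim_algebra_dual_basis[OF K assms(2)] by blast
  obtain S' \<delta>' where B_basis: "dual_basis K B S' \<delta>'"
    using fin_dim_algebra_dual_basis[OF K assms(4)] by blast
  have pair: "proj_pair K A B (SIGMA (f, h) : E \<times> F. {..<mult_N f h}) (\<lambda>i. fst (fst i)) (\<lambda>i. snd (fst i))
      (SIGMA (g, e) : F \<times> E. {..<mult_M g e}) (\<lambda>i. fst (fst i)) (\<lambda>i. snd (fst i)) S' \<delta>'"
    unfolding proj_pair_def
    using proj_family_idempotents[OF K assms(2,4,6,7)] proj_family_idempotents[OF K assms(4,2,7,6)] B_basis
    by blast
  \<comment> \<open>Folding identifies the tensor product of the two abstract direct sums with that
    of \<open>N\<close> and \<open>M\<close>.\<close>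
  note split = proj_pair.split_bimodule[OF pair, folded proj_bimodule_eq, folded assms(8,9)]
  note cyclic = cyclic_power.intro[OF split_bimodule.axioms(3)[OF split] cyclic_power_axioms.intro[OF assms(10)]]
  show ?thesis
    using cyclic_split.trivial_invariants_imp_trivial[OF cyclic_split.intro[OF split A_basis cyclic]]
      assms(12) unfolding assms(11) by blast
qed

end
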